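(* Let $X(t)=Y(E_t)$ for $t\ge0$, where $Y$ is a fractional Brownian motion with values in $\mathbb{R}^d$ of index $H\in(0,1)$ and $E_t=\inf\{x\ge0:D(x)>t\}$ is the inverse of a $\beta$-stable subordinator $D$, $\beta\in(0,1)$, which is independent of $Y$. Then $$\dim_{\rm H}X([0,1])=\dim_{\rm P}X([0,1])=\min\left\{d,\frac1H\right\}\quad\text{a.s.}$$ and $$\dim_{\rm H}{\rm Gr}X([0,1])=\dim_{\rm P}{\rm Gr}X([0,1])=\begin{cases}\frac1H&\text{if }1\le Hd,\\ \beta+(1-H\beta)d&\text{if }1>Hd,\end{cases}\quad\text{a.s.}$$
   Context: $\dim_{\rm H}$ and $\dim_{\rm P}$ denote Hausdorff dimension and packing dimension of subsets of Euclidean space. $X([0,1])=\{X(t):t\in[0,1]\}$ is the range and ${\rm Gr}X([0,1])=\{(t,X(t)):t\in[0,1]\}$ is the graph. A fractional Brownian motion of index $H$ in $\mathbb{R}^d$ is a process with continuous sample paths whose $d$ components are independent centered Gaussian processes with covariance $\frac12(s^{2H}+t^{2H}-|s-t|^{2H})$. A $\beta$-stable subordinator is a nondecreasing strictly $\beta$-stable real Lévy process started at $0$ that is not identically zero. *)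

theory Defs
  imports "HOL-Probability.Probability"
begin

section \<open>Hausdorff dimension\<close>

text \<open>The conventions \<open>\<bar>{}\<bar>\<^sup>s = 0\<close> and \<open>\<bar>U\<bar>\<^sup>0 = 1\<close> for nonempty \<open>U\<close> are spelled out
  because \<open>0 powr 0 = 0\<close>.\<close>

definition diameter_power :: "real \<Rightarrow> 'a::metric_space set \<Rightarrow> real" where
  "diameter_power s U = (if U = {} then 0 else if s = 0 then 1 else diameter U powr s)"

text \<open>Boundedness is required separately because \<open>diameter\<close> is a junk value on unbounded
  sets.\<close>

definition hausdorff_premeasure :: "real \<Rightarrow> real \<Rightarrow> 'a::metric_space set \<Rightarrow> ennreal" where
  "hausdorff_premeasure s \<delta> A =
     (INF U \<in> {U :: nat \<Rightarrow> 'a set. A \<subseteq> (\<Union>i. U i) \<and> (\<forall>i. bounded (U i) \<and> diameter (U i) \<le> \<delta>)}.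
        \<Sum>i. ennreal (diameter_power s (U i)))"

definition hausdorff_measure :: "real \<Rightarrow> 'a::metric_space set \<Rightarrow> ennreal" where
  "hausdorff_measure s A = (SUP \<delta> \<in> {0<..}. hausdorff_premeasure s \<delta> A)"

text \<open>In a Euclidean space the set below contains every \<open>s > DIM('a)\<close> and is bounded below, so
  its real infimum is meaningful. The same holds for the packing dimension.\<close>

definition hausdorff_dimension :: "'a::euclidean_space set \<Rightarrow> real" where
  "hausdorff_dimension A = Inf {s. 0 \<le> s \<and> hausdorff_measure s A = 0}"


section \<open>Packing dimension\<close>

text \<open>Packings by closed balls centred in the set, encoded as sets of (centre, radius) pairs.
  The supremum over finite packings equals the one over countable packings.\<close>

definition ball_packings :: "real \<Rightarrow> 'a::metric_space set \<Rightarrow> ('a \<times> real) set set" where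
  "ball_packings \<delta> A =
     {F. finite F \<and> (\<forall>(x, r) \<in> F. x \<in> A \<and> 0 < r \<and> 2 * r \<le> \<delta>) \<and>
         disjoint_family_on (\<lambda>(x, r). cball x r) F}"

definition packing_premeasure :: "real \<Rightarrow> 'a::metric_space set \<Rightarrow> ennreal" where
  "packing_premeasure s A =
     (INF \<delta> \<in> {0<..}. SUP F \<in> ball_packings \<delta> A. \<Sum>(x, r) \<in> F. ennreal ((2 * r) powr s))"

text \<open>The premeasure is not countably subadditive, hence the second infimum over countable
  covers.\<close>

definition packing_measure :: "real \<Rightarrow> 'a::metric_space set \<Rightarrow> ennreal" where
  "packing_measure s A =
     (INF B \<in> {B :: nat \<Rightarrow> 'a set. A \<subseteq> (\<Union>i. B i)}. \<Sum>i. packing_premeasure s (B i))"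

definition packing_dimension :: "'a::euclidean_space set \<Rightarrow> real" where
  "packing_dimension A = Inf {s. 0 \<le> s \<and> packing_measure s A = 0}"


section \<open>Fractional Brownian motion\<close>

text \<open>Processes are functions of type \<open>real \<Rightarrow> 'w \<Rightarrow> 'b\<close> of which only the values at times
  \<open>t \<ge> 0\<close> matter. As a random element of the product space, a process is its whole path.\<close>

definition process_path :: "(real \<Rightarrow> 'w \<Rightarrow> 'b) \<Rightarrow> 'w \<Rightarrow> real \<Rightarrow> 'b" where
  "process_path Z \<omega> = (\<lambda>t\<in>{0..}. Z t \<omega>)"

abbreviation path_space :: "(real \<Rightarrow> 'b::topological_space) measure" where
  "path_space \<equiv> Pi\<^sub>M {0..} (\<lambda>_. borel)"

text \<open>\<open>indep_var\<close> requires both variables to have the same target type, so independence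
  of two processes is stated for the \<open>\<sigma>\<close>-algebras that their paths generate.\<close>

definition (in prob_space) indep_processes ::
  "(real \<Rightarrow> 'a \<Rightarrow> 'b::topological_space) \<Rightarrow> (real \<Rightarrow> 'a \<Rightarrow> 'c::topological_space) \<Rightarrow> bool" where
  "indep_processes Y Z \<longleftrightarrow>
     random_variable path_space (process_path Y) \<and>
     random_variable path_space (process_path Z) \<and>
     indep_set {process_path Y -` A \<inter> space M | A. A \<in> sets path_space}
               {process_path Z -` A \<inter> space M | A. A \<in> sets path_space}"

text \<open>Degenerate (Dirac) laws count as Gaussian.\<close>

definition gaussian_law :: "real measure \<Rightarrow> bool" where
  "gaussian_law \<mu> \<longleftrightarrow>
     (\<exists>m \<sigma>. 0 < \<sigma> \<and> \<mu> = density lborel (\<lambda>x. ennreal (normal_density m \<sigma> x))) \<or>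
     (\<exists>m. \<mu> = return borel m)"

context prob_space
begin

text \<open>All finite linear combinations, equivalently all finite-dimensional distributions, are
  Gaussian.\<close>

definition gaussian_process :: "(real \<Rightarrow> 'a \<Rightarrow> real) \<Rightarrow> bool" where
  "gaussian_process Z \<longleftrightarrow>
     (\<forall>t\<ge>0. random_variable borel (Z t)) \<and>
     (\<forall>J c. finite J \<and> J \<subseteq> {0..} \<longrightarrow> gaussian_law (distr M borel (\<lambda>\<omega>. \<Sum>t\<in>J. c t * Z t \<omega>)))"

definition covariance :: "('a \<Rightarrow> real) \<Rightarrow> ('a \<Rightarrow> real) \<Rightarrow> real" where
  "covariance U V = expectation (\<lambda>\<omega>. (U \<omega> - expectation U) * (V \<omega> - expectation V))"

definition fractional_brownian_motion :: "real \<Rightarrow> (real \<Rightarrow> 'a \<Rightarrow> real ^ 'n) \<Rightarrow> bool" where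
  "fractional_brownian_motion H Y \<longleftrightarrow>
     (AE \<omega> in M. continuous_on {0..} (\<lambda>t. Y t \<omega>)) \<and>
     indep_vars (\<lambda>_. path_space) (\<lambda>i. process_path (\<lambda>t \<omega>. Y t \<omega> $ i)) UNIV \<and>
     (\<forall>i. gaussian_process (\<lambda>t \<omega>. Y t \<omega> $ i) \<and>
          (\<forall>t\<ge>0. expectation (\<lambda>\<omega>. Y t \<omega> $ i) = 0) \<and>
          (\<forall>s\<ge>0. \<forall>t\<ge>0. covariance (\<lambda>\<omega>. Y s \<omega> $ i) (\<lambda>\<omega>. Y t \<omega> $ i) =
             (s powr (2 * H) + t powr (2 * H) - \<bar>s - t\<bar> powr (2 * H)) / 2))"

end


section \<open>Stable subordinators\<close>

definition cadlag :: "(real \<Rightarrow> real) \<Rightarrow> bool" where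
  "cadlag f \<longleftrightarrow>
     (\<forall>t\<ge>0. (f \<longlongrightarrow> f t) (at_right t)) \<and> (\<forall>t>0. \<exists>l. (f \<longlongrightarrow> l) (at_left t))"

text \<open>If \<open>\<xi>\<close>, \<open>\<xi>'\<close> are independent with law \<open>\<mu>\<close>, then \<open>a \<xi> + b \<xi>'\<close> has the law of
  \<open>(a\<^sup>\<beta> + b\<^sup>\<beta>)\<^bsup>1/\<beta>\<^esup> \<xi>\<close>, without a centring term.\<close>

definition strictly_stable_law :: "real \<Rightarrow> real measure \<Rightarrow> bool" where
  "strictly_stable_law \<beta> \<mu> \<longleftrightarrow>
     (\<forall>a>0. \<forall>b>0.
        distr \<mu> borel (\<lambda>x. a * x) \<star> distr \<mu> borel (\<lambda>x. b * x) =
        distr \<mu> borel (\<lambda>x. (a powr \<beta> + b powr \<beta>) powr (1 / \<beta>) * x))"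

context prob_space
begin

definition levy_process :: "(real \<Rightarrow> 'a \<Rightarrow> real) \<Rightarrow> bool" where
  "levy_process D \<longleftrightarrow>
     (\<forall>t\<ge>0. random_variable borel (D t)) \<and>
     (AE \<omega> in M. D 0 \<omega> = 0) \<and>
     (\<forall>(n::nat) t. 0 \<le> t 0 \<and> (\<forall>k<n. t k \<le> t (Suc k)) \<longrightarrow>
        indep_vars (\<lambda>_. borel) (\<lambda>k \<omega>. D (t (Suc k)) \<omega> - D (t k) \<omega>) {..<n}) \<and>
     (\<forall>s\<ge>0. \<forall>h\<ge>0. distr M borel (\<lambda>\<omega>. D (s + h) \<omega> - D s \<omega>) = distr M borel (D h)) \<and>
     (\<forall>t\<ge>0. \<forall>\<epsilon>>0.
        ((\<lambda>s. \<P>(\<omega> in M. \<epsilon> < \<bar>D s \<omega> - D t \<omega>\<bar>)) \<longlongrightarrow> 0) (at t within {0..})) \<and>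
     (AE \<omega> in M. cadlag (\<lambda>t. D t \<omega>))"

text \<open>A Levy process is strictly stable if its law at time 1 is.\<close>

definition stable_subordinator :: "real \<Rightarrow> (real \<Rightarrow> 'a \<Rightarrow> real) \<Rightarrow> bool" where
  "stable_subordinator \<beta> D \<longleftrightarrow>
     levy_process D \<and>
     strictly_stable_law \<beta> (distr M borel (D 1)) \<and>
     (AE \<omega> in M. mono_on {0..} (\<lambda>t. D t \<omega>)) \<and>
     \<not> (AE \<omega> in M. \<forall>t\<ge>0. D t \<omega> = 0)"

end

text \<open>The set is nonempty for almost every \<open>\<omega>\<close> when \<open>D\<close> is a stable subordinator.\<close>

definition inverse_process :: "(real \<Rightarrow> 'w \<Rightarrow> real) \<Rightarrow> real \<Rightarrow> 'w \<Rightarrow> real" where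
  "inverse_process D t \<omega> = Inf {x. 0 \<le> x \<and> t < D x \<omega>}"

end

theory Submission
  imports Defs
begin

text \<open>Lower bounds: by the energy method it suffices that, for the kernel
  \<open>\<Sum>n. 2\<^bsup>ns\<^esup> exp (-4\<^sup>n u\<^sup>2)\<close> (comparable with \<open>u\<^bsup>-s\<^esup>\<close>), the paths \<open>x \<mapsto> Y x\<close> and \<open>x \<mapsto> (D x, Y x)\<close> have
  finite expected energy. This only involves Gaussian integrals and the Laplace transform
  \<open>exp (- c h \<lambda>\<^sup>\<beta>)\<close> of \<open>D h\<close>, which Cauchy's functional equation extracts from strict stability.

  Upper bounds: \<open>Y\<close> is \<open>\<gamma>\<close>-Hoelder for all \<open>\<gamma> < H\<close>. Since \<open>E\<close> is monotone, the graph of \<open>E\<close> is a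
  staircase that meets about \<open>2\<^sup>m + 2\<^sup>n\<close> boxes of size \<open>2\<^bsup>-m\<^esup> \<times> 2\<^bsup>-n\<^esup>\<close>, which gives \<open>1/H\<close>. If \<open>H d < 1\<close>,
  then \<open>E\<close> is constant on all but about \<open>2\<^bsup>m \<beta>\<^esup>\<close> of the dyadic intervals of length \<open>2\<^bsup>-m\<^esup>\<close>, and on each
  of the exceptional ones \<open>E\<close> grows by about \<open>2\<^bsup>-m \<beta>\<^esup>\<close>, so that \<open>Y \<circ> E\<close> needs about
  \<open>2\<^bsup>m (1 - H \<beta>) d\<^esup>\<close> cubes.\<close>

section \<open>Hausdorff and packing measures\<close>

text \<open>Packing dimension dominates Hausdorff dimension, so each formula is squeezed between
  positivity of Hausdorff measures and a box-counting bound, both along countably many exponents so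
  that the null sets can be united. Integrating over the time \<open>t\<close> of \<open>X\<close>
  would require joint laws of \<open>E\<close>. The lower bounds therefore use Lebesgue measure in
  the operational time \<open>x\<close>: the graph contains \<open>(D x, Y x)\<close> for small
  \<open>x\<close>, and the laws of the increments of \<open>D\<close> and \<open>Y\<close> are
  known. The kernel is a mixture of Gaussians because its expectation then factorises over the
  coordinates of \<open>Y\<close> and, by independence, over \<open>Y\<close> and \<open>D\<close>;
  a power of the distance has no such factorisation. The upper bounds are pathwise once
  Borel-Cantelli has supplied an event of full measure. If \<open>H d < 1\<close>, the staircase
  value \<open>1/H\<close> exceeds the true value \<open>d + \<beta> (1 - H d)\<close>: many cells
  of the staircase over one time interval are then sent to the same small cube, so it is cheaper to
  count the cubes that surround the path over that interval.\<close>

lemma hausdorff_measure_eq_0_iff: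
  "hausdorff_measure s A = 0 \<longleftrightarrow> (\<forall>\<delta>>0. hausdorff_premeasure s \<delta> A = 0)"
  unfolding hausdorff_measure_def bot_ennreal[symmetric] SUP_bot_conv by auto

lemma hausdorff_premeasure_le:
  assumes "A \<subseteq> (\<Union>i. U i)" "\<And>i. bounded (U i)" "\<And>i. diameter (U i) \<le> \<delta>"
  shows "hausdorff_premeasure s \<delta> A \<le> (\<Sum>i. ennreal (diameter_power s (U i)))"
  unfolding hausdorff_premeasure_def by (rule INF_lower) (use assms in auto)

lemma hausdorff_premeasure_less_cover:
  assumes "hausdorff_premeasure s \<delta> A < e"
  obtains U where "A \<subseteq> (\<Union>i::nat. U i)" "\<And>i. bounded (U i)" "\<And>i. diameter (U i) \<le> \<delta>"
    "(\<Sum>i. ennreal (diameter_power s (U i))) < e"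
  using assms unfolding hausdorff_premeasure_def INF_less_iff by auto

lemma diameter_power_nonneg: "0 \<le> diameter_power s U"
  by (simp add: diameter_power_def)

lemma diameter_power_antimono_exponent:
  assumes "bounded U" "diameter U \<le> 1" "0 \<le> s" "s \<le> t"
  shows "diameter_power t U \<le> diameter_power s U"
proof -
  have "diameter U \<ge> 0" using assms(1) by (rule diameter_ge_0)
  then show ?thesis using assms
    by (auto simp: diameter_power_def powr_le1 intro: powr_mono')
qed

lemma diameter_power_le_powr:
  assumes "bounded U" "diameter U \<le> r" "0 < r" "0 \<le> s"
  shows "diameter_power s U \<le> r powr s"
  using assms diameter_ge_0[OF assms(1)] by (auto simp: diameter_power_def intro: powr_mono2)

text \<open>At scale \<open>min \<delta> 1\<close> all covering sets have diameter at most 1, where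
  \<open>diameter_power\<close> decreases in the exponent. This lets a value at one exponent decide
  a whole range of exponents.\<close>

lemma hausdorff_measure_eq_0_mono_exponent:
  assumes "hausdorff_measure s A = 0" "0 \<le> s" "s \<le> t"
  shows "hausdorff_measure t A = 0"
  unfolding hausdorff_measure_eq_0_iff
proof (intro allI impI)
  fix \<delta> :: real assume d: "\<delta> > 0"
  have z: "hausdorff_premeasure s (min \<delta> 1) A = 0"
    using assms(1) d unfolding hausdorff_measure_eq_0_iff by auto
  show "hausdorff_premeasure t \<delta> A = 0"
  proof (rule ccontr)
    assume "hausdorff_premeasure t \<delta> A \<noteq> 0"
    then have "hausdorff_premeasure s (min \<delta> 1) A < hausdorff_premeasure t \<delta> A"
      by (simp add: z zero_less_iff_neq_zero)
    then obtain U where U: "A \<subseteq> (\<Union>i::nat. U i)" "\<And>i. bounded (U i)" "\<And>i. diameter (U i) \<le> min \<delta> 1"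
      "(\<Sum>i. ennreal (diameter_power s (U i))) < hausdorff_premeasure t \<delta> A"
      by (rule hausdorff_premeasure_less_cover) blast
    have "hausdorff_premeasure t \<delta> A \<le> (\<Sum>i. ennreal (diameter_power t (U i)))"
      using U(1-3) by (intro hausdorff_premeasure_le) auto
    also have "\<dots> \<le> (\<Sum>i. ennreal (diameter_power s (U i)))"
      using U(2,3) assms by (intro suminf_le summableI ennreal_leI diameter_power_antimono_exponent) auto
    finally show False using U(4) by simp
  qed
qed

lemma hausdorff_measure_mono:
  assumes "A \<subseteq> B"
  shows "hausdorff_measure s A \<le> hausdorff_measure s B"
  unfolding hausdorff_measure_def hausdorff_premeasure_def
  by (rule SUP_mono'[OF INF_superset_mono]) (use assms in auto)

text \<open>A maximal family of disjoint balls of equal radius centred in the set covers it after doubling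
  the radii.\<close>

lemma packing_premeasure_cover:
  fixes B :: "'a::metric_space set"
  assumes "packing_premeasure s B < e" "0 < \<delta>" "0 \<le> s"
  obtains U where "B \<subseteq> (\<Union>i::nat. U i)" "\<And>i. bounded (U i)" "\<And>i. diameter (U i) \<le> \<delta>"
    "(\<Sum>i. ennreal (diameter_power s (U i))) \<le> ennreal (2 powr s) * e"
proof -
  define P where "P \<eta> = (SUP F \<in> ball_packings \<eta> B. \<Sum>(x, r) \<in> F. ennreal ((2 * r) powr s))" for \<eta>
  obtain \<eta> where \<eta>: "\<eta> > 0" "P \<eta> < e"
    using assms(1) unfolding packing_premeasure_def INF_less_iff P_def by auto
  \<comment> \<open>Balls of radius \<open>r\<close> are admissible in packings at scale
    \<open>\<eta>\<close>, and the doubled balls have diameter at most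
    \<open>4 * r \<le> \<delta>\<close>.\<close>
  define r where "r = min (\<eta> / 2) (\<delta> / 4)"
  have r: "r > 0" "2 * r \<le> \<eta>" "4 * r \<le> \<delta>" using \<eta> assms(2) by (auto simp: r_def)
  define Q where "Q = {C. finite C \<and> C \<subseteq> B \<and> disjoint_family_on (\<lambda>x. cball x r) C}"
  have bound: "of_nat (card C) * ennreal ((2 * r) powr s) \<le> P \<eta>" if "C \<in> Q" for C
  proof -
    have inj: "inj_on (\<lambda>x. (x, r)) C" by (auto simp: inj_on_def)
    have "(\<lambda>x. (x, r)) ` C \<in> ball_packings \<eta> B"
      using that r by (auto simp: Q_def ball_packings_def disjoint_family_on_def)
    then have "(\<Sum>(x, r) \<in> (\<lambda>x. (x, r)) ` C. ennreal ((2 * r) powr s)) \<le> P \<eta>"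
      unfolding P_def by (rule SUP_upper)
    then show ?thesis by (simp add: sum.reindex[OF inj] mult.commute)
  qed
  have Pfin: "P \<eta> < \<top>" using \<eta>(2) by (meson le_less_trans less_le_trans top_greatest)
  \<comment> \<open>Each ball contributes \<open>(2 * r) powr s\<close>, so finiteness of
    \<open>P \<eta>\<close> bounds the number of balls, and a packing of largest cardinality
    exists.\<close>
  define L where "L = enn2real (P \<eta>) / (2 * r) powr s"
  have cardL: "real (card C) \<le> L" if "C \<in> Q" for C
  proof -
    have "ennreal (real (card C) * (2 * r) powr s) \<le> ennreal (enn2real (P \<eta>))"
      using bound[OF that] Pfin
      by (simp add: ennreal_mult ennreal_of_nat_eq_real_of_nat)
    then have "real (card C) * (2 * r) powr s \<le> enn2real (P \<eta>)"
      by (simp)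
    then show ?thesis using r by (simp add: L_def field_simps)
  qed
  have Q0: "{} \<in> Q" by (simp add: Q_def disjoint_family_on_def)
  have Q1: "\<forall>C. C \<in> Q \<longrightarrow> card C < Suc (nat \<lfloor>L\<rfloor>)"
  proof (intro allI impI)
    fix C assume "C \<in> Q" from cardL[OF this] show "card C < Suc (nat \<lfloor>L\<rfloor>)" by linarith
  qed
  from ex_has_greatest_nat[of "\<lambda>C. C \<in> Q" "{}" card "Suc (nat \<lfloor>L\<rfloor>)", OF Q0 Q1]
  obtain C where C: "C \<in> Q" "\<And>C'. C' \<in> Q \<Longrightarrow> card C' \<le> card C" by blast
  have fin: "finite C" using C(1) by (simp add: Q_def)
  have cov: "B \<subseteq> (\<Union>x\<in>C. cball x (2 * r))"
  proof
    fix y assume y: "y \<in> B"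
    show "y \<in> (\<Union>x\<in>C. cball x (2 * r))"
    proof (rule ccontr)
      assume "\<not> ?thesis"
      then have far: "dist x y > 2 * r" if "x \<in> C" for x using that by auto
      have dj: "cball x r \<inter> cball y r = {}" if "x \<in> C" for x
      proof (rule ccontr)
        assume "cball x r \<inter> cball y r \<noteq> {}"
        then obtain z where "dist x z \<le> r" "dist y z \<le> r" by auto
        then show False using far[OF that] dist_triangle[of x y z] by (simp add: dist_commute)
      qed
      have "y \<notin> C" using far[of y] r by auto
      moreover have "insert y C \<in> Q"
        using C(1) y dj by (auto simp: Q_def disjoint_family_on_def Int_commute)
      ultimately show False using C(2)[of "insert y C"] fin by simp
    qed
  qed
  obtain h where h: "bij_betw h {0..<card C} C" using ex_bij_betw_nat_finite[OF fin] by blast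
  define U where "U i = (if i < card C then cball (h i) (2 * r) else {})" for i
  have "B \<subseteq> (\<Union>i. U i)"
  proof
    fix y assume "y \<in> B"
    then obtain x where x: "x \<in> C" "y \<in> cball x (2 * r)" using cov by auto
    then have "x \<in> h ` {0..<card C}" using h by (simp add: bij_betw_def)
    then obtain i where "i < card C" "x = h i" by auto
    then have "y \<in> U i" using x by (simp add: U_def)
    then show "y \<in> (\<Union>i. U i)" by blast
  qed
  moreover have bU: "bounded (U i)" for i by (simp add: U_def)
  moreover have dU: "diameter (U i) \<le> 4 * r" for i
  proof (cases "i < card C")
    case True
    have "dist x y \<le> 4 * r" if "x \<in> cball (h i) (2 * r)" "y \<in> cball (h i) (2 * r)" for x y
      using that dist_triangle[of x y "h i"] by (simp add: dist_commute)
    then have "diameter (cball (h i) (2 * r)) \<le> 4 * r"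
      unfolding diameter_def using r by (auto intro!: cSUP_least)
    then show ?thesis using True by (simp add: U_def)
  qed (use r in \<open>simp add: U_def\<close>)
  moreover have "(\<Sum>i. ennreal (diameter_power s (U i))) \<le> ennreal (2 powr s) * e"
  proof -
    have "(\<Sum>i. ennreal (diameter_power s (U i))) = (\<Sum>i<card C. ennreal (diameter_power s (U i)))"
      by (rule suminf_finite) (auto simp: U_def diameter_power_def)
    also have "\<dots> \<le> (\<Sum>i<card C. ennreal ((4 * r) powr s))"
      using bU dU r assms by (intro sum_mono ennreal_leI diameter_power_le_powr) auto
    also have "\<dots> = ennreal (2 powr s) * (of_nat (card C) * ennreal ((2 * r) powr s))"
    proof -
      have "(4 * r) powr s = 2 powr s * (2 * r) powr s" using r by (simp flip: powr_mult)
      then show ?thesis by (simp add: ennreal_mult ac_simps)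
    qed
    also have "\<dots> \<le> ennreal (2 powr s) * e"
      using bound[OF C(1)] \<eta>(2) by (intro mult_left_mono) auto
    finally show ?thesis .
  qed
  moreover have "\<And>i. diameter (U i) \<le> \<delta>" using dU r(3) by (meson order_trans)
  ultimately show ?thesis using that by blast
qed

text \<open>The pieces of a countable decomposition with small total premeasure are covered one by
  one and the covers are merged into a single sequence. The factor \<open>2 powr s\<close> lost by
  doubling balls is harmless, since only nullity is compared.\<close>

lemma packing_measure_0_imp_hausdorff_measure_0:
  fixes A :: "'a::metric_space set"
  assumes "packing_measure s A = 0" "0 \<le> s"
  shows "hausdorff_measure s A = 0"
  unfolding hausdorff_measure_eq_0_iff
proof (intro allI impI)
  fix \<delta> :: real assume \<delta>: "\<delta> > 0"
  have main: "hausdorff_premeasure s \<delta> A \<le> 0 + ennreal (2 powr s * (2 * e))" if e: "e > 0" for e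
  proof -
    have "packing_measure s A < ennreal e" using assms e by simp
    then obtain B where B: "A \<subseteq> (\<Union>i::nat. B i)" "(\<Sum>i. packing_premeasure s (B i)) < ennreal e"
      unfolding packing_measure_def INF_less_iff by auto
    \<comment> \<open>The cover lemma asks for a strict upper bound on the premeasure of each piece;
      the geometric surplus provides it at total cost \<open>e\<close>.\<close>
    define g where "g i = packing_premeasure s (B i) + ennreal (e * (1/2) ^ Suc i)" for i
    have lt: "packing_premeasure s (B i) < g i" for i
    proof -
      have "(\<Sum>i. packing_premeasure s (B i)) \<noteq> \<top>" using B(2) by auto
      then have "packing_premeasure s (B i) \<noteq> \<top>"
        by (metis ennreal_suminf_lessD infinity_ennreal_def less_top)
      then show ?thesis using e unfolding g_def
        using ennreal_add_left_cancel_less[of "packing_premeasure s (B i)" 0 "ennreal (e * (1/2) ^ Suc i)"]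
        by (simp add: ennreal_zero_less_mult_iff)
    qed
    have "\<exists>V. B i \<subseteq> (\<Union>k::nat. V k) \<and> (\<forall>k. bounded (V k)) \<and> (\<forall>k. diameter (V k) \<le> \<delta>) \<and>
      (\<Sum>k. ennreal (diameter_power s (V k))) \<le> ennreal (2 powr s) * g i" for i
      using packing_premeasure_cover[OF lt \<delta> assms(2), of i] by metis
    then obtain V where V: "\<And>i. B i \<subseteq> (\<Union>k::nat. V i k)" "\<And>i k. bounded (V i k)"
      "\<And>i k. diameter (V i k) \<le> \<delta>"
      "\<And>i. (\<Sum>k. ennreal (diameter_power s (V i k))) \<le> ennreal (2 powr s) * g i"
      by metis
    define W where "W n = case_prod V (prod_decode n)" for n
    have "hausdorff_premeasure s \<delta> A \<le> (\<Sum>n. ennreal (diameter_power s (W n)))"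
    proof (rule hausdorff_premeasure_le)
      show "A \<subseteq> (\<Union>i. W i)"
      proof
        fix x assume "x \<in> A"
        then obtain i k where "x \<in> V i k" using B(1) V(1) by (metis UN_E subsetD)
        then have "x \<in> W (prod_encode (i, k))" by (simp add: W_def)
        then show "x \<in> (\<Union>i. W i)" by blast
      qed
    qed (use V(2,3) in \<open>auto simp: W_def split: prod.split\<close>)
    also have "\<dots> = (\<Sum>i. \<Sum>k. ennreal (diameter_power s (V i k)))"
      using suminf_ennreal_2dimen[of "\<lambda>i. \<Sum>k. ennreal (diameter_power s (V i k))"
         "\<lambda>p. ennreal (diameter_power s (case_prod V p))"]
      by (simp add: W_def comp_def)
    also have "\<dots> \<le> (\<Sum>i. ennreal (2 powr s) * g i)"
      using V(4) by (intro suminf_le summableI) auto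
    also have "\<dots> = ennreal (2 powr s) * (\<Sum>i. g i)" by simp
    also have "(\<Sum>i. g i) = (\<Sum>i. packing_premeasure s (B i)) + (\<Sum>i. ennreal (e * (1/2) ^ Suc i))"
      unfolding g_def by (rule suminf_add[symmetric]) auto
    also have "(\<Sum>i. ennreal (e * (1/2) ^ Suc i)) = ennreal (e * 1)"
      by (rule suminf_ennreal_eq[OF _ sums_mult[OF power_half_series]]) (use e in auto)
    also have "ennreal (2 powr s) * ((\<Sum>i. packing_premeasure s (B i)) + ennreal (e * 1)) \<le>
        ennreal (2 powr s) * (ennreal e + ennreal e)"
      using B(2) by (intro mult_left_mono add_mono) auto
    also have "\<dots> = ennreal (2 powr s * (2 * e))"
      using e by (subst ennreal_plus[symmetric]) (auto simp: ennreal_mult')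
    finally show ?thesis by simp
  qed
  have "hausdorff_premeasure s \<delta> A \<le> 0 + ennreal e" if e: "e > 0" for e
    using main[of "e / (2 * 2 powr s)"] e by (simp add: field_simps)
  then have "hausdorff_premeasure s \<delta> A \<le> 0" by (rule ennreal_le_epsilon)
  then show "hausdorff_premeasure s \<delta> A = 0" by simp
qed

text \<open>Each hypothesis serves both dimensions: packing nullity above \<open>d\<close> entails
  Hausdorff nullity there, and Hausdorff positivity below \<open>d\<close> rules out packing nullity
  there.\<close>

lemma hausdorff_packing_dimension_eqI:
  fixes A :: "'a::euclidean_space set"
  assumes "0 \<le> d" "\<And>s. d < s \<Longrightarrow> packing_measure s A = 0"
    and "\<And>s. 0 \<le> s \<Longrightarrow> s < d \<Longrightarrow> hausdorff_measure s A \<noteq> 0"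
  shows "hausdorff_dimension A = d" "packing_dimension A = d"
proof -
  have *: "Inf S = d" if "\<And>s. d < s \<Longrightarrow> s \<in> S" "\<And>s. s \<in> S \<Longrightarrow> d \<le> s" for S :: "real set"
  proof (rule antisym)
    have bdd: "bdd_below S" using that(2) by (intro bdd_belowI) auto
    show "Inf S \<le> d"
      by (rule field_le_epsilon, rule cInf_lower[OF that(1) bdd]) simp
    show "d \<le> Inf S" using that(1)[of "d + 1"] that(2) by (intro cInf_greatest) auto
  qed
  have H: "hausdorff_measure s A = 0" if "d < s" for s
    using assms(1,2) that by (intro packing_measure_0_imp_hausdorff_measure_0) auto
  have ge: "d \<le> s" if "0 \<le> s" "hausdorff_measure s A = 0" for s
    using assms(3)[OF that(1)] that(2) by (cases "s < d") auto
  show "hausdorff_dimension A = d" unfolding hausdorff_dimension_def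
    by (rule *) (use assms(1) H ge in auto)
  show "packing_dimension A = d" unfolding packing_dimension_def
    by (rule *) (use assms(1,2) packing_measure_0_imp_hausdorff_measure_0[of _ A] ge in auto)
qed

section \<open>Box counting as an upper bound for packing measure\<close>

text \<open>Sizes are bounded through pairwise distances, which makes boundedness a consequence and
  not a side condition. \<open>N\<close> is real so that powers of 2 can be inserted
  directly.\<close>

definition covered_by :: "'a::metric_space set \<Rightarrow> real \<Rightarrow> real \<Rightarrow> bool" where
  "covered_by A N r \<longleftrightarrow>
     (\<exists>\<U>. finite \<U> \<and> A \<subseteq> \<Union>\<U> \<and> real (card \<U>) \<le> N \<and> (\<forall>U\<in>\<U>. \<forall>x\<in>U. \<forall>y\<in>U. dist x y \<le> r))"

text \<open>Says that the upper box dimension is at most \<open>s\<close>, with explicit control at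
  every dyadic scale. One constant serves both the number and the size of the sets, so that covers
  only have to be found up to constants.\<close>

definition box_counting_le :: "'a::metric_space set \<Rightarrow> real \<Rightarrow> bool" where
  "box_counting_le A s \<longleftrightarrow>
     (\<exists>C>0. \<forall>m::nat. covered_by A (C * 2 powr (real m * s)) (C * 2 powr - real m))"

lemma covered_by_mono:
  assumes "covered_by A N r" "B \<subseteq> A" "N \<le> N'" "r \<le> r'"
  shows "covered_by B N' r'"
proof -
  obtain \<U> where \<U>: "finite \<U>" "A \<subseteq> \<Union>\<U>" "real (card \<U>) \<le> N" "\<forall>U\<in>\<U>. \<forall>x\<in>U. \<forall>y\<in>U. dist x y \<le> r"
    using assms(1) unfolding covered_by_def by blast
  have "\<forall>U\<in>\<U>. \<forall>x\<in>U. \<forall>y\<in>U. dist x y \<le> r'" using \<U>(4) assms(4) by (meson order_trans)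
  moreover have "B \<subseteq> \<Union>\<U>" "real (card \<U>) \<le> N'" using \<U> assms by auto
  ultimately show ?thesis unfolding covered_by_def using \<U>(1) by blast
qed

lemma covered_by_Union:
  assumes "finite I" "\<And>i. i \<in> I \<Longrightarrow> covered_by (A i) (N i) r"
  shows "covered_by (\<Union>i\<in>I. A i) (\<Sum>i\<in>I. N i) r"
proof -
  have "\<forall>i\<in>I. \<exists>V. finite V \<and> A i \<subseteq> \<Union>V \<and> real (card V) \<le> N i \<and>
    (\<forall>U\<in>V. \<forall>x\<in>U. \<forall>y\<in>U. dist x y \<le> r)"
    using assms(2) unfolding covered_by_def by blast
  from bchoice[OF this] obtain V where V': "\<forall>i\<in>I. finite (V i) \<and> A i \<subseteq> \<Union>(V i) \<and>
    real (card (V i)) \<le> N i \<and> (\<forall>U\<in>V i. \<forall>x\<in>U. \<forall>y\<in>U. dist x y \<le> r)" by blast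
  then have V: "\<And>i. i \<in> I \<Longrightarrow> finite (V i)" "\<And>i. i \<in> I \<Longrightarrow> A i \<subseteq> \<Union>(V i)"
    "\<And>i. i \<in> I \<Longrightarrow> real (card (V i)) \<le> N i"
    "\<And>i U x y. i \<in> I \<Longrightarrow> U \<in> V i \<Longrightarrow> x \<in> U \<Longrightarrow> y \<in> U \<Longrightarrow> dist x y \<le> r"
    by blast+
  have "real (card (\<Union>i\<in>I. V i)) \<le> real (\<Sum>i\<in>I. card (V i))"
    using card_UN_le[OF assms(1), of V] by (simp only: of_nat_le_iff)
  also have "\<dots> \<le> (\<Sum>i\<in>I. N i)" using V(3) by (auto intro: sum_mono)
  finally have "real (card (\<Union>i\<in>I. V i)) \<le> (\<Sum>i\<in>I. N i)" .
  moreover have "finite (\<Union>i\<in>I. V i)" using assms(1) V(1) by simp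
  moreover have "(\<Union>i\<in>I. A i) \<subseteq> \<Union>(\<Union>i\<in>I. V i)"
  proof
    fix x assume "x \<in> (\<Union>i\<in>I. A i)"
    then obtain i where i: "i \<in> I" "x \<in> A i" by blast
    then obtain U where "U \<in> V i" "x \<in> U" using V(2)[OF i(1)] by blast
    then show "x \<in> \<Union>(\<Union>i\<in>I. V i)" using i(1) by blast
  qed
  moreover have "\<forall>U\<in>(\<Union>i\<in>I. V i). \<forall>x\<in>U. \<forall>y\<in>U. dist x y \<le> r"
    using V(4) by blast
  ultimately show ?thesis unfolding covered_by_def by blast
qed

lemma covered_by_image:
  assumes "covered_by A N r" "\<And>x y. x \<in> A \<Longrightarrow> y \<in> A \<Longrightarrow> dist (f x) (f y) \<le> dist x y"
  shows "covered_by (f ` A) N r"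
proof -
  obtain V where V: "finite V" "A \<subseteq> \<Union>V" "real (card V) \<le> N" "\<forall>U\<in>V. \<forall>x\<in>U. \<forall>y\<in>U. dist x y \<le> r"
    using assms(1) unfolding covered_by_def by auto
  have "card ((\<lambda>U. f ` (U \<inter> A)) ` V) \<le> card V" using V(1) by (rule card_image_le)
  then have *: "real (card ((\<lambda>U. f ` (U \<inter> A)) ` V)) \<le> N" using V(3) by linarith
  have "dist (f x) (f y) \<le> r" if "U \<in> V" "x \<in> U \<inter> A" "y \<in> U \<inter> A" for U x y
    using assms(2)[of x y] V(4) that by (meson IntE order_trans)
  then have "\<forall>W\<in>(\<lambda>U. f ` (U \<inter> A)) ` V. \<forall>x\<in>W. \<forall>y\<in>W. dist x y \<le> r" by blast
  moreover have "f ` A \<subseteq> \<Union>((\<lambda>U. f ` (U \<inter> A)) ` V)" using V(2) by blast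
  moreover have "finite ((\<lambda>U. f ` (U \<inter> A)) ` V)" using V(1) by simp
  ultimately show ?thesis unfolding covered_by_def using * by blast
qed

lemma packing_measure_le_premeasure: "packing_measure s A \<le> packing_premeasure s A"
proof -
  have e: "packing_premeasure s ({} :: 'a set) = 0"
  proof -
    have "ball_packings \<delta> ({} :: 'a set) = {{}}" for \<delta>
      by (auto simp: ball_packings_def disjoint_family_on_def)
    then show ?thesis by (simp add: packing_premeasure_def)
  qed
  define B where "B i = (if i = 0 then A else {})" for i :: nat
  have "packing_measure s A \<le> (\<Sum>i. packing_premeasure s (B i))"
    unfolding packing_measure_def by (rule INF_lower) (auto simp: B_def split: if_splits)
  also have "\<dots> = (\<Sum>i\<in>{0}. packing_premeasure s (B i))"
    by (rule suminf_finite) (auto simp: B_def e)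
  finally show ?thesis by (simp add: B_def)
qed

text \<open>A set of diameter at most \<open>C 2\<^bsup>-k\<^esup>\<close> contains at most one centre of a packing by balls of radius
  in \<open>(C 2\<^bsup>-k\<^esup>, 2 C 2\<^bsup>-k\<^esup>]\<close>.\<close>

lemma packing_measure_eq_0_if_box_counting_le:
  fixes A :: "'a::metric_space set" and s t :: real
  assumes "box_counting_le A s" and st: "0 \<le> s" "s < t"
  shows "packing_measure t A = 0"
proof -
  obtain C where C: "0 < C" and cov: "\<And>m::nat. covered_by A (C * 2 powr (real m * s)) (C * 2 powr - real m)"
    using assms(1) unfolding box_counting_le_def by blast
  \<comment> \<open>Level \<open>k\<close> holds at most \<open>C * 2 powr (k * s)\<close> balls of
    weight of order \<open>2 powr - (k * t)\<close>, so the levels are dominated by a geometric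
    series of ratio \<open>q\<close>.\<close>
  define q where "q = 2 powr - (t - s)"
  have q: "0 < q" "q < 1" using st by (auto simp: q_def powr_less_one)
  define D where "D = C * (4 * C) powr t"
  have D: "D > 0" using C by (simp add: D_def)
  have bound: "packing_premeasure t A \<le> ennreal (D / (1 - q) * q ^ k0)" for k0
  proof -
    \<comment> \<open>This scale forces all radii below \<open>C * 2 powr - k0\<close>, so only the
      tail of the series from \<open>k0\<close> on remains; at the end \<open>k0\<close> tends to
      infinity.\<close>
    define \<delta> where "\<delta> = 2 * (C * 2 powr - real k0)"
    have \<delta>: "\<delta> > 0" using C by (simp add: \<delta>_def)
    have "(\<Sum>(x, r) \<in> F. ennreal ((2 * r) powr t)) \<le> ennreal (D / (1 - q) * q ^ k0)"
      if F: "F \<in> ball_packings \<delta> A" for F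
    proof -
      have fin: "finite F" and FA: "\<And>x r. (x, r) \<in> F \<Longrightarrow> x \<in> A \<and> 0 < r \<and> 2 * r \<le> \<delta>"
        and dj: "disjoint_family_on (\<lambda>(x, r). cball x r) F"
        using F by (auto simp: ball_packings_def)
      \<comment> \<open>By minimality the radius lies between the scale
        \<open>C * 2 powr - lev p\<close> and twice that scale.\<close>
      define lev where "lev p = (LEAST k. C * 2 powr - real k < snd p)" for p :: "'a \<times> real"
      have lev: "C * 2 powr - real (lev p) < snd p \<and> snd p \<le> 2 * (C * 2 powr - real (lev p)) \<and> k0 \<le> lev p"
        if p: "p \<in> F" for p
      proof -
        have pp: "0 < snd p" "snd p \<le> C * 2 powr - real k0"
          using FA[of "fst p" "snd p"] p by (auto simp: \<delta>_def)
        obtain k where "(1/2) ^ k < snd p / C"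
          using real_arch_pow_inv[of "snd p / C" "1/2"] pp C by auto
        then have "C * 2 powr - real k < snd p"
          using C by (simp add: powr_minus powr_realpow field_simps power_divide)
        then have 1: "C * 2 powr - real (lev p) < snd p" unfolding lev_def by (rule LeastI)
        then have "2 powr - real (lev p) < 2 powr - real k0" using pp(2) C
          by (metis less_le_trans mult_less_cancel_left_pos)
        then have 2: "k0 < lev p" by simp
        then have "lev p - 1 < lev p" by simp
        then have "\<not> C * 2 powr - real (lev p - 1) < snd p" unfolding lev_def by (rule not_less_Least)
        moreover have "2 powr - real (lev p - 1) = 2 * 2 powr - real (lev p)"
          using 2 by (simp add: of_nat_diff powr_diff powr_minus field_simps)
        ultimately show ?thesis using 1 2 by auto
      qed
      have grp: "real (card {p \<in> F. lev p = k}) \<le> C * 2 powr (real k * s)" for k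
      proof -
        obtain V where V: "finite V" "A \<subseteq> \<Union>V" "real (card V) \<le> C * 2 powr (real k * s)"
          "\<forall>U\<in>V. \<forall>x\<in>U. \<forall>y\<in>U. dist x y \<le> C * 2 powr - real k"
          using cov[of k] unfolding covered_by_def by auto
        have "\<forall>p\<in>{p \<in> F. lev p = k}. \<exists>U\<in>V. fst p \<in> U"
          using V(2) FA by fastforce
        then have "\<exists>g. \<forall>p\<in>{p \<in> F. lev p = k}. g p \<in> V \<and> fst p \<in> g p"
          unfolding Bex_def by (rule bchoice)
        then obtain g where g: "\<And>p. p \<in> F \<Longrightarrow> lev p = k \<Longrightarrow> g p \<in> V \<and> fst p \<in> g p" by blast
        have "inj_on g {p \<in> F. lev p = k}"
        proof (rule inj_onI)
          fix p p' assume p: "p \<in> {p \<in> F. lev p = k}" "p' \<in> {p \<in> F. lev p = k}" "g p = g p'"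
          show "p = p'"
          proof (rule ccontr)
            assume "p \<noteq> p'"
            then have "cball (fst p) (snd p) \<inter> cball (fst p') (snd p') = {}"
              using disjoint_family_onD[OF dj, of p p'] p by (simp add: split_beta)
            moreover have "fst p' \<in> cball (fst p') (snd p')" using FA[of "fst p'" "snd p'"] p by auto
            ultimately have "fst p' \<notin> cball (fst p) (snd p)" by blast
            then have far: "dist (fst p) (fst p') > snd p" by simp
            have "g p \<in> V" "fst p \<in> g p" "fst p' \<in> g p" using g[of p] g[of p'] p by simp_all
            then have "dist (fst p) (fst p') \<le> C * 2 powr - real k" using V(4) by blast
            then show False using far lev[of p] p by simp
          qed
        qed
        then have "card {p \<in> F. lev p = k} \<le> card V"
          using g V(1) by (intro card_inj_on_le[of g]) auto
        then show ?thesis using V(3) by linarith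
      qed
      have term_le: "(2 * snd p) powr t \<le> (4 * C) powr t * 2 powr - (real (lev p) * t)" if "p \<in> F" for p
      proof -
        have "(2 * snd p) powr t \<le> (4 * C * 2 powr - real (lev p)) powr t"
          using lev[OF that] FA[of "fst p" "snd p"] that st by (intro powr_mono2) auto
        also have "\<dots> = (4 * C) powr t * 2 powr - (real (lev p) * t)"
          using C by (simp add: powr_mult powr_powr)
        finally show ?thesis .
      qed
      define n where "n = Max (insert k0 (lev ` F))"
      have levn: "lev p \<in> {k0..n}" if "p \<in> F" for p
        using lev[OF that] fin that unfolding n_def by auto
      have n: "k0 \<le> n" using fin unfolding n_def by simp
      have "(\<Sum>p\<in>F. (2 * snd p) powr t) = (\<Sum>k\<in>{k0..n}. \<Sum>p\<in>{p \<in> F. lev p = k}. (2 * snd p) powr t)"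
        by (rule sum.group[symmetric]) (use fin levn in auto)
      also have "\<dots> \<le> (\<Sum>k\<in>{k0..n}. D * q ^ k)"
      proof (rule sum_mono)
        fix k
        have "(\<Sum>p\<in>{p \<in> F. lev p = k}. (2 * snd p) powr t) \<le>
            (\<Sum>p\<in>{p \<in> F. lev p = k}. (4 * C) powr t * 2 powr - (real k * t))"
          using term_le by (intro sum_mono) auto
        also have "\<dots> = real (card {p \<in> F. lev p = k}) * ((4 * C) powr t * 2 powr - (real k * t))" by simp
        also have "\<dots> \<le> (C * 2 powr (real k * s)) * ((4 * C) powr t * 2 powr - (real k * t))"
          using grp by (intro mult_right_mono) auto
        also have "\<dots> = D * (2 powr (real k * s) * 2 powr - (real k * t))"
          by (simp add: D_def)
        also have "2 powr (real k * s) * 2 powr - (real k * t) = q ^ k"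
          by (simp add: q_def powr_add[symmetric] powr_power algebra_simps)
        finally show "(\<Sum>p\<in>{p \<in> F. lev p = k}. (2 * snd p) powr t) \<le> D * q ^ k" .
      qed
      also have "\<dots> = D * (\<Sum>k\<in>{k0..n}. q ^ k)" by (simp add: sum_distrib_left)
      also have "(\<Sum>k\<in>{k0..n}. q ^ k) = (q ^ k0 - q ^ Suc n) / (1 - q)"
        using q sum_gp_multiplied[OF n, of q] by (simp add: eq_divide_eq mult.commute)
      also have "D * ((q ^ k0 - q ^ Suc n) / (1 - q)) \<le> D * (q ^ k0 / (1 - q))"
        using q D by (intro mult_left_mono divide_right_mono) auto
      also have "\<dots> = D / (1 - q) * q ^ k0" by simp
      finally have "(\<Sum>p\<in>F. (2 * snd p) powr t) \<le> D / (1 - q) * q ^ k0" .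
      then have "ennreal (\<Sum>p\<in>F. (2 * snd p) powr t) \<le> ennreal (D / (1 - q) * q ^ k0)"
        by (rule ennreal_leI)
      then show ?thesis by (simp add: split_beta sum_ennreal)
    qed
    then have "(SUP F \<in> ball_packings \<delta> A. \<Sum>(x, r) \<in> F. ennreal ((2 * r) powr t)) \<le>
      ennreal (D / (1 - q) * q ^ k0)"
      by (intro SUP_least)
    then show ?thesis unfolding packing_premeasure_def using \<delta> by (intro INF_lower2[of \<delta>]) auto
  qed
  have "(\<lambda>k. ennreal (D / (1 - q) * q ^ k)) \<longlonglongrightarrow> ennreal (D / (1 - q) * 0)"
    using q by (intro tendsto_ennrealI tendsto_mult_left LIMSEQ_realpow_zero) auto
  then have "packing_premeasure t A \<le> ennreal (D / (1 - q) * 0)"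
    by (rule LIMSEQ_le_const) (use bound in auto)
  then show ?thesis using packing_measure_le_premeasure[of t A] by simp
qed

section \<open>The energy method with a Gaussian mixture\<close>

text \<open>For \<open>s > 0\<close> the terms with \<open>2 ^ n * u \<le> 1\<close> form a
  geometric sum of order \<open>u powr - s\<close> and the later ones decay rapidly. Each term is a
  Gaussian in \<open>u\<close>, so it splits over orthogonal coordinates. The series diverges at
  \<open>u = 0\<close>, which later excludes atoms.\<close>

definition energy_kernel :: "real \<Rightarrow> real \<Rightarrow> ennreal" where
  "energy_kernel s u = (\<Sum>n. ennreal (2 powr (real n * s) * exp (- (4 ^ n) * u\<^sup>2)))"

lemma energy_kernel_measurable [measurable]: "energy_kernel s \<in> borel_measurable borel"
proof -
  have "(\<lambda>u. \<Sum>n. ennreal (c n * exp (- k n * u\<^sup>2))) \<in> borel_measurable borel" for c k :: "nat \<Rightarrow> real"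
    by (rule borel_measurable_suminf_order) measurable
  from this[of "\<lambda>n. 2 powr (real n * s)" "\<lambda>n. 4 ^ n"] show ?thesis
    unfolding energy_kernel_def[abs_def] .
qed

lemma ennreal_term_le_suminf: "f n \<le> (\<Sum>n. f n :: ennreal)"
  using sum_le_suminf[of f "{n}"] by simp

text \<open>A single term is enough: choose \<open>n\<close> with \<open>2 ^ n * r\<close> between
  1/2 and 1. Its Gaussian factor is at least \<open>exp (-1)\<close> because
  \<open>u \<le> r\<close>, and its weight is at least \<open>2 powr (-s) * r powr (-s)\<close>. The
  case distinction on \<open>s\<close> mirrors \<open>diameter_power\<close>.\<close>

lemma energy_kernel_lower:
  assumes "0 \<le> u" "u \<le> r" "r \<le> 1" "0 \<le> s" "s = 0 \<or> 0 < r"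
  shows "ennreal (exp (-1) * 2 powr (-s)) \<le> ennreal (if s = 0 then 1 else r powr s) * energy_kernel s u"
proof -
  have T: "ennreal (2 powr (real n * s) * exp (- (4 ^ n) * u\<^sup>2)) \<le> energy_kernel s u" for n
    unfolding energy_kernel_def by (rule ennreal_term_le_suminf)
  show ?thesis
  proof (cases "s = 0")
    case True
    have "u\<^sup>2 \<le> 1" using assms by (simp add: power_le_one)
    then have "ennreal (exp (-1)) \<le> ennreal (exp (- u\<^sup>2))" by (intro ennreal_leI) simp
    also have "ennreal (exp (- u\<^sup>2)) \<le> energy_kernel s u" using T[of 0] by simp
    finally show ?thesis using True by simp
  next
    case False
    then have r: "0 < r" and s: "0 < s" using assms by auto
    define n where "n = nat \<lfloor>log 2 (1 / r)\<rfloor>"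
    have l0: "0 \<le> log 2 (1 / r)" using r assms by simp
    have n1: "real n \<le> log 2 (1 / r)" "log 2 (1 / r) \<le> real n + 1"
      using l0 unfolding n_def by linarith+
    have "2 powr real n \<le> 1 / r" using n1(1) r by (subst (asm) le_log_iff) auto
    then have up: "2 ^ n * r \<le> 1" using r by (simp add: powr_realpow field_simps)
    have "1 / r \<le> 2 powr (real n + 1)" using n1(2) r by (subst (asm) log_le_iff) auto
    then have lo: "1 / 2 \<le> 2 powr real n * r" using r by (simp add: powr_add field_simps)
    have "2 ^ n * u \<le> 2 ^ n * r" using assms by simp
    then have "2 ^ n * u \<le> 1" using up by linarith
    then have "(2 ^ n * u)\<^sup>2 \<le> 1" using assms(1) by (intro power_le_one) auto
    moreover have "(4::real) ^ n = (2 ^ n)\<^sup>2" by (simp add: power2_eq_square flip: power_mult_distrib)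
    ultimately have e: "(4 ^ n) * u\<^sup>2 \<le> 1" by (simp add: power_mult_distrib)
    have "2 powr (-s) = (1/2) powr s" by (simp add: powr_minus powr_divide inverse_eq_divide)
    also have "\<dots> \<le> (2 powr real n * r) powr s" using lo s by (intro powr_mono2) auto
    also have "\<dots> = r powr s * 2 powr (real n * s)" using r by (simp add: powr_mult powr_powr)
    finally have "exp (-1) * 2 powr (-s) \<le> exp (- (4 ^ n) * u\<^sup>2) * (r powr s * 2 powr (real n * s))"
      using e by (intro mult_mono) auto
    then have "ennreal (exp (-1) * 2 powr (-s)) \<le> ennreal (r powr s * (2 powr (real n * s) * exp (- (4 ^ n) * u\<^sup>2)))"
      by (intro ennreal_leI) (simp add: ac_simps)
    also have "\<dots> = ennreal (r powr s) * ennreal (2 powr (real n * s) * exp (- (4 ^ n) * u\<^sup>2))"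
      by (simp add: ennreal_mult)
    also have "\<dots> \<le> ennreal (r powr s) * energy_kernel s u" by (intro mult_left_mono T) auto
    finally show ?thesis using False by simp
  qed
qed

lemma energy_kernel_0: 
  assumes "0 \<le> s" shows "energy_kernel s 0 = \<top>"
proof (rule ccontr)
  assume "energy_kernel s 0 \<noteq> \<top>"
  then have "summable (\<lambda>n. 2 powr (real n * s))"
    unfolding energy_kernel_def using summable_suminf_not_top[of "\<lambda>n. 2 powr (real n * s)"] by simp
  then have "(\<lambda>n. 2 powr (real n * s)) \<longlonglongrightarrow> 0" by (rule summable_LIMSEQ_zero)
  then have "1 \<le> (0::real)" by (rule LIMSEQ_le_const) (use assms in \<open>auto intro!: exI[of _ 0] ge_one_powr_ge_zero\<close>)
  then show False by simp
qed

text \<open>Energy method. On the part \<open>S i\<close> of the parameter space mapped into \<open>U i\<close> the potential \<open>K\<close> is at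
  least \<open>c \<nu>(S i) / diameter_power s (U i)\<close>; a weighted AM-GM inequality then bounds \<open>\<nu>(S i)\<close> by the
  energy of \<open>S i\<close> plus a multiple of \<open>diameter_power s (U i)\<close>.\<close>

lemma hausdorff_measure_nonzero_energy:
  fixes f :: "'p \<Rightarrow> 'b::euclidean_space"
  assumes "finite_measure \<nu>" and f [measurable]: "f \<in> borel_measurable \<nu>"
    and pos: "emeasure \<nu> (space \<nu>) \<noteq> 0" and s: "0 \<le> s"
    and fin: "(\<integral>\<^sup>+x. \<integral>\<^sup>+y. energy_kernel s (dist (f x) (f y)) \<partial>\<nu> \<partial>\<nu>) < \<top>"
  shows "hausdorff_measure s (f ` space \<nu>) \<noteq> 0"
proof
  assume zero: "hausdorff_measure s (f ` space \<nu>) = 0"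
  interpret finite_measure \<nu> by fact
  define K where "K x = (\<integral>\<^sup>+y. energy_kernel s (dist (f x) (f y)) \<partial>\<nu>)" for x
  have [measurable]: "K \<in> borel_measurable \<nu>" unfolding K_def by measurable
  define I where "I = enn2real (\<integral>\<^sup>+x. K x \<partial>\<nu>)"
  have I: "(\<integral>\<^sup>+x. K x \<partial>\<nu>) = ennreal I" "0 \<le> I" using fin by (auto simp: I_def K_def)
  define c where "c = exp (-1) * 2 powr (-s)"
  have c: "c > 0" by (simp add: c_def)
  define T where "T = measure \<nu> (space \<nu>)"
  have T: "T > 0" using pos by (simp add: T_def emeasure_eq_measure zero_less_measure_iff)
  \<comment> \<open>With this weight the energies contribute at most \<open>T / 2\<close> in total,
    and a cover of weight below \<open>\<theta> * T / 2\<close> contributes at most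
    \<open>T / 4\<close>, which cannot add up to \<open>T\<close>.\<close>
  define \<theta> where "\<theta> = T * c / (I + 1)"
  have \<theta>: "\<theta> > 0" using T c I by (simp add: \<theta>_def)
  have "hausdorff_premeasure s 1 (f ` space \<nu>) = 0" using zero unfolding hausdorff_measure_eq_0_iff by simp
  then have "hausdorff_premeasure s 1 (f ` space \<nu>) < ennreal (\<theta> * T / 2)" using \<theta> T by simp
  then obtain U where U: "f ` space \<nu> \<subseteq> (\<Union>i::nat. U i)" "\<And>i. bounded (U i)" "\<And>i. diameter (U i) \<le> 1"
    "(\<Sum>i. ennreal (diameter_power s (U i))) < ennreal (\<theta> * T / 2)"
    by (rule hausdorff_premeasure_less_cover) blast
  define p where "p i = diameter_power s (U i)" for i
  have p0: "0 \<le> p i" for i by (simp add: p_def diameter_power_nonneg)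
  \<comment> \<open>The covering sets are arbitrary. Passing to closures makes the preimages
    measurable without changing diameters, and disjointing them lets masses and energies be
    summed.\<close>
  define S where "S = disjointed (\<lambda>i. f -` closure (U i) \<inter> space \<nu>)"
  have S0: "range (\<lambda>i. f -` closure (U i) \<inter> space \<nu>) \<subseteq> sets \<nu>" by (auto intro!: measurable_sets[OF f])
  have Ssets [measurable]: "S i \<in> sets \<nu>" for i
    using sets.range_disjointed_sets[OF S0] unfolding S_def by blast
  have Ssub: "S i \<subseteq> f -` closure (U i) \<inter> space \<nu>" for i unfolding S_def by (rule disjointed_subset)
  have Sdj: "disjoint_family S" unfolding S_def by (rule disjoint_family_disjointed)
  have SUn: "(\<Union>i. S i) = space \<nu>"
  proof -
    have "space \<nu> \<subseteq> (\<Union>i. f -` closure (U i) \<inter> space \<nu>)"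
    proof
      fix x assume x: "x \<in> space \<nu>"
      then obtain i where "f x \<in> U i" using U(1) by blast
      then have "f x \<in> closure (U i)" using closure_subset by blast
      then show "x \<in> (\<Union>i. f -` closure (U i) \<inter> space \<nu>)" using x by blast
    qed
    then show ?thesis unfolding S_def UN_disjointed_eq by blast
  qed
  define a where "a i = measure \<nu> (S i)" for i
  define k where "k i = (\<integral>\<^sup>+x. K x * indicator (S i) x \<partial>\<nu>)" for i
  have ksum: "(\<Sum>i. k i) = ennreal I"
  proof -
    have "(\<Sum>i. k i) = (\<Sum>i. emeasure (density \<nu> K) (S i))"
      unfolding k_def by (simp add: emeasure_density)
    also have "\<dots> = emeasure (density \<nu> K) (\<Union>i. S i)"
      by (rule suminf_emeasure) (use Sdj in auto)
    also have "\<dots> = ennreal I" unfolding SUn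
      by (subst emeasure_density) (auto simp: I(1)[symmetric] intro!: nn_integral_cong)
    finally show ?thesis .
  qed
  have kfin: "k i < \<top>" for i using ksum
    by (metis ennreal_less_top ennreal_suminf_lessD)
  have kpos: "k i = ennreal (enn2real (k i))" for i using kfin[of i] by simp
  have key: "a i \<le> (\<theta> / c * enn2real (k i) + p i / \<theta>) / 2" for i
  proof (cases "a i = 0")
    case True then show ?thesis using c \<theta> p0 by simp
  next
    case False
    then have a: "a i > 0" unfolding a_def by (simp add: zero_less_measure_iff)
    then have "S i \<noteq> {}" by (auto simp: a_def)
    then have Une: "U i \<noteq> {}" using Ssub[of i] by auto
    define r where "r = diameter (U i)"
    have r: "0 \<le> r" "r \<le> 1" using U(2,3) by (auto simp: r_def diameter_ge_0)
    have dle: "dist (f x) (f y) \<le> r" if "x \<in> S i" "y \<in> S i" for x y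
    proof -
      have "f x \<in> closure (U i)" "f y \<in> closure (U i)" using that Ssub by auto
      then have "dist (f x) (f y) \<le> diameter (closure (U i))"
        using U(2)[of i] by (intro diameter_bounded_bound) auto
      then show ?thesis using U(2) by (simp add: r_def diameter_closure)
    qed
    have iter: "k i \<ge> b * ennreal (a i) * ennreal (a i)"
      if b: "\<And>x y. x \<in> S i \<Longrightarrow> y \<in> S i \<Longrightarrow> b \<le> energy_kernel s (dist (f x) (f y))" for b
    proof -
      have "b * ennreal (a i) * indicator (S i) x \<le> K x * indicator (S i) x" for x
      proof (cases "x \<in> S i")
        case True
        have "b * ennreal (a i) = (\<integral>\<^sup>+y. b * indicator (S i) y \<partial>\<nu>)"
          by (subst nn_integral_cmult_indicator) (auto simp: a_def emeasure_eq_measure)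
        also have "\<dots> \<le> K x" unfolding K_def
          by (intro nn_integral_mono) (use b True in \<open>auto simp: indicator_def\<close>)
        finally show ?thesis using True by simp
      qed simp
      then have "(\<integral>\<^sup>+x. b * ennreal (a i) * indicator (S i) x \<partial>\<nu>) \<le> k i"
        unfolding k_def by (intro nn_integral_mono)
      then show ?thesis
        by (subst (asm) nn_integral_cmult_indicator) (auto simp: a_def emeasure_eq_measure)
    qed
    \<comment> \<open>A part of positive mass mapped into a set of diameter 0 would have infinite
      energy, as the kernel is infinite at 0.\<close>
    have r0: "s = 0 \<or> 0 < r"
    proof (rule ccontr)
      assume "\<not> ?thesis"
      then have "r = 0" using r by auto
      then have "\<top> \<le> energy_kernel s (dist (f x) (f y))" if "x \<in> S i" "y \<in> S i" for x y
        using dle[OF that] energy_kernel_0[OF s] by simp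
      from iter[OF this] have "k i = \<top>" using a by (simp add: ennreal_top_mult top_unique)
      then show False using kfin[of i] by simp
    qed
    have pr: "p i = (if s = 0 then 1 else r powr s)" using Une by (simp add: p_def diameter_power_def r_def)
    then have pp: "0 < p i" using r0 by auto
    have "ennreal (c / p i) \<le> energy_kernel s (dist (f x) (f y))" if "x \<in> S i" "y \<in> S i" for x y
    proof -
      have "ennreal c \<le> ennreal (p i) * energy_kernel s (dist (f x) (f y))"
        unfolding c_def pr by (rule energy_kernel_lower) (use dle[OF that] r s r0 in auto)
      then have "ennreal (1 / p i) * ennreal c \<le> ennreal (1 / p i) * (ennreal (p i) * energy_kernel s (dist (f x) (f y)))"
        by (rule mult_left_mono) simp
      also have "\<dots> = energy_kernel s (dist (f x) (f y))"
        using pp by (simp add: mult.assoc[symmetric] ennreal_mult[symmetric])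
      finally show ?thesis using pp c by (simp add: ennreal_mult[symmetric])
    qed
    from iter[OF this] have "ennreal (c / p i * a i * a i) \<le> ennreal (enn2real (k i))"
      using kpos[of i] a c pp by (simp add: ennreal_mult[symmetric])
    then have m: "c / p i * a i * a i \<le> enn2real (k i)" by simp
    have "0 \<le> (\<theta> * a i - p i)\<^sup>2 / (\<theta> * p i)" using \<theta> pp by simp
    also have "\<dots> = \<theta> / c * (c / p i * a i * a i) + p i / \<theta> - 2 * a i"
      using \<theta> pp c by (simp add: power2_eq_square field_simps)
    also have "\<dots> \<le> \<theta> / c * enn2real (k i) + p i / \<theta> - 2 * a i"
      using m \<theta> c by (intro diff_right_mono add_right_mono mult_left_mono) auto
    finally show ?thesis by simp
  qed
  have lin: "ennreal (A * x + B * y) = ennreal A * ennreal x + ennreal B * ennreal y"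
    if "0 \<le> A" "0 \<le> x" "0 \<le> B" "0 \<le> y" for A B x y
    using that by (simp add: ennreal_mult)
  have "ennreal T = emeasure \<nu> (\<Union>i. S i)" unfolding SUn T_def by (simp add: emeasure_eq_measure)
  also have "\<dots> = (\<Sum>i. emeasure \<nu> (S i))" by (rule suminf_emeasure[symmetric]) (use Sdj in auto)
  also have "\<dots> \<le> (\<Sum>i. ennreal (\<theta> / c / 2) * k i + ennreal (1 / \<theta> / 2) * ennreal (p i))"
  proof (intro suminf_le summableI)
    fix i
    have "emeasure \<nu> (S i) = ennreal (a i)" by (simp add: a_def emeasure_eq_measure)
    also have "\<dots> \<le> ennreal (\<theta> / c / 2 * enn2real (k i) + 1 / \<theta> / 2 * p i)"
      using key[of i] by (intro ennreal_leI) (simp add: field_simps)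
    also have "\<dots> = ennreal (\<theta> / c / 2) * k i + ennreal (1 / \<theta> / 2) * ennreal (p i)"
      using lin[of "\<theta> / c / 2" "enn2real (k i)" "1 / \<theta> / 2" "p i"] \<theta> c p0[of i] kpos[of i] by simp
    finally show "emeasure \<nu> (S i) \<le> ennreal (\<theta> / c / 2) * k i + ennreal (1 / \<theta> / 2) * ennreal (p i)" .
  qed
  also have "\<dots> = ennreal (\<theta> / c / 2) * (\<Sum>i. k i) + ennreal (1 / \<theta> / 2) * (\<Sum>i. ennreal (p i))"
    by (subst suminf_add[symmetric]) auto
  also have "\<dots> \<le> ennreal (\<theta> / c / 2) * ennreal I + ennreal (1 / \<theta> / 2) * ennreal (\<theta> * T / 2)"
    unfolding ksum using U(4) by (intro add_mono mult_left_mono) (auto simp: p_def)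
  also have "\<dots> = ennreal (\<theta> / c / 2 * I + 1 / \<theta> / 2 * (\<theta> * T / 2))"
    using lin[of "\<theta> / c / 2" I "1 / \<theta> / 2" "\<theta> * T / 2"] \<theta> c I T by simp
  finally have "T \<le> \<theta> / c / 2 * I + 1 / \<theta> / 2 * (\<theta> * T / 2)"
    using \<theta> c I T by (subst (asm) ennreal_le_iff) auto
  also have "1 / \<theta> / 2 * (\<theta> * T / 2) = T / 4" using \<theta> by (simp add: field_simps)
  also have "\<theta> / c / 2 * I = T / 2 * (I / (I + 1))" using c I by (simp add: \<theta>_def)
  also have "\<dots> \<le> T / 2 * 1" using T I by (intro mult_left_mono) auto
  finally show False using T by simp
qed

section \<open>Laplace transform of a stable subordinator\<close>

text \<open>Nonnegativity makes \<open>f\<close> monotone. Squeezing \<open>n * x\<close> between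
  consecutive integers gives \<open>n * \<bar>f x - x * f 1\<bar> \<le> f 1\<close> for all
  \<open>n\<close>, which forces equality.\<close>

lemma additive_nonneg_imp_linear:
  fixes f :: "real \<Rightarrow> real"
  assumes add: "\<And>x y. 0 \<le> x \<Longrightarrow> 0 \<le> y \<Longrightarrow> f (x + y) = f x + f y"
    and nn: "\<And>x. 0 \<le> x \<Longrightarrow> 0 \<le> f x" and x: "0 \<le> x"
  shows "f x = x * f 1"
proof -
  have mono: "f x \<le> f y" if "0 \<le> x" "x \<le> y" for x y
    using add[of x "y - x"] nn[of "y - x"] that by simp
  have mult: "f (real n * y) = real n * f y" if "0 \<le> y" for n y
  proof (induction n)
    case 0 then show ?case using add[of 0 0] by simp
  next
    case (Suc n) then show ?case using add[of "real n * y" y] that by (simp add: algebra_simps)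
  qed
  have bound: "real n * \<bar>f x - x * f 1\<bar> \<le> f 1" for n
  proof -
    define k where "k = nat \<lfloor>real n * x\<rfloor>"
    have "0 \<le> real n * x" using x by simp
    then have k: "real k \<le> real n * x" "real n * x \<le> real k + 1" unfolding k_def by linarith+
    have "real k * f 1 \<le> real n * f x"
      using mono[of "real k" "real n * x"] k mult[of 1 k] mult[OF x, of n] by simp
    moreover have "real n * f x \<le> (real k + 1) * f 1"
      using mono[of "real n * x" "real (Suc k)"] k x mult[of 1 "Suc k"] mult[OF x, of n]
      by (simp add: algebra_simps)
    moreover have "real k * f 1 \<le> (real n * x) * f 1" "(real n * x) * f 1 \<le> (real k + 1) * f 1"
      using k nn[of 1] by (auto intro!: mult_right_mono)
    ultimately have "\<bar>real n * f x - real n * x * f 1\<bar> \<le> f 1" by (simp add: algebra_simps abs_le_iff)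
    moreover have "\<bar>real n * f x - real n * x * f 1\<bar> = real n * \<bar>f x - x * f 1\<bar>"
      by (simp add: abs_mult mult.assoc flip: right_diff_distrib)
    ultimately show ?thesis by simp
  qed
  show ?thesis
  proof (rule ccontr)
    assume "f x \<noteq> x * f 1"
    then obtain n :: nat where "f 1 < real n * \<bar>f x - x * f 1\<bar>"
      using reals_Archimedean3[of "\<bar>f x - x * f 1\<bar>"] by auto
    then show False using bound[of n] by simp
  qed
qed

context prob_space
begin

lemma stable_subordinatorD:
  assumes "stable_subordinator \<beta> D"
  shows subordinator_measurable: "\<And>t. 0 \<le> t \<Longrightarrow> random_variable borel (D t)"
    and subordinator_AE: "AE \<omega> in M. D 0 \<omega> = 0 \<and> mono_on {0..} (\<lambda>t. D t \<omega>) \<and> cadlag (\<lambda>t. D t \<omega>)"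
    and subordinator_indep: "\<And>(n::nat) t. 0 \<le> t 0 \<Longrightarrow> (\<And>k. k < n \<Longrightarrow> t k \<le> t (Suc k)) \<Longrightarrow>
        indep_vars (\<lambda>_. borel) (\<lambda>k \<omega>. D (t (Suc k)) \<omega> - D (t k) \<omega>) {..<n}"
    and subordinator_stationary: "\<And>s h. 0 \<le> s \<Longrightarrow> 0 \<le> h \<Longrightarrow>
        distr M borel (\<lambda>\<omega>. D (s + h) \<omega> - D s \<omega>) = distr M borel (D h)"
  using assms unfolding stable_subordinator_def levy_process_def by auto

lemma subordinator_AE_nonneg:
  assumes D: "stable_subordinator \<beta> D" and "0 \<le> s" "s \<le> t"
  shows "AE \<omega> in M. 0 \<le> D s \<omega> \<and> D s \<omega> \<le> D t \<omega>"
  using subordinator_AE[OF D]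
proof eventually_elim
  case (elim \<omega>)
  then have m: "mono_on {0..} (\<lambda>t. D t \<omega>)" by simp
  have "D 0 \<omega> \<le> D s \<omega>" "D s \<omega> \<le> D t \<omega>"
    using mono_onD[OF m, of 0 s] mono_onD[OF m, of s t] assms by auto
  then show ?case using elim by simp
qed

lemma integrable_exp_neg:
  fixes X :: "'a \<Rightarrow> real"
  assumes [measurable]: "random_variable borel X" and "AE \<omega> in M. 0 \<le> X \<omega>" "0 \<le> l"
  shows "integrable M (\<lambda>\<omega>. exp (- l * X \<omega>))"
proof (rule integrable_const_bound[where B = 1])
  show "AE \<omega> in M. norm (exp (- l * X \<omega>)) \<le> 1"
    using assms(2) by eventually_elim (use assms(3) in simp)
qed measurable

text \<open>Both bounds prepare taking \<open>- ln\<close> of the transform: positivity makes the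
  logarithm meaningful, and the bound by 1 gives the nonnegativity that Cauchy's equation
  needs.\<close>

lemma laplace_bounds:
  fixes X :: "'a \<Rightarrow> real"
  assumes [measurable]: "random_variable borel X" and "AE \<omega> in M. 0 \<le> X \<omega>" "0 \<le> l"
  shows "0 < expectation (\<lambda>\<omega>. exp (- l * X \<omega>))" "expectation (\<lambda>\<omega>. exp (- l * X \<omega>)) \<le> 1"
proof -
  note int = integrable_exp_neg[OF assms]
  have nn: "0 \<le> expectation (\<lambda>\<omega>. exp (- l * X \<omega>))" by simp
  have "expectation (\<lambda>\<omega>. exp (- l * X \<omega>)) \<noteq> 0"
  proof
    assume "expectation (\<lambda>\<omega>. exp (- l * X \<omega>)) = 0"
    then have "AE \<omega> in M. exp (- l * X \<omega>) = 0"
      by (subst (asm) integral_nonneg_eq_0_iff_AE[OF int]) auto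
    then have "AE \<omega> in M. False" by simp
    then show False using emeasure_space_1 by (simp add: AE_False)
  qed
  with nn show "0 < expectation (\<lambda>\<omega>. exp (- l * X \<omega>))" by linarith
  have "expectation (\<lambda>\<omega>. exp (- l * X \<omega>)) \<le> expectation (\<lambda>\<omega>. 1)"
    using assms(2) by (intro integral_mono_AE int) (auto elim!: eventually_mono simp: assms(3))
  then show "expectation (\<lambda>\<omega>. exp (- l * X \<omega>)) \<le> 1" by (simp add: prob_space)
qed

lemma subordinator_laplace_mult:
  assumes D: "stable_subordinator \<beta> D" and s: "0 \<le> s" and h: "0 \<le> h" and l: "0 \<le> l"
  shows "expectation (\<lambda>\<omega>. exp (- l * D (s + h) \<omega>)) =
    expectation (\<lambda>\<omega>. exp (- l * D s \<omega>)) * expectation (\<lambda>\<omega>. exp (- l * D h \<omega>))"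
proof -
  note [measurable] = subordinator_measurable[OF D]
  \<comment> \<open>The partition 0, \<open>s\<close>, \<open>s + h\<close>; its two increments are
    the independent factors.\<close>
  define t :: "nat \<Rightarrow> real" where "t k = (if k = 0 then 0 else if k = 1 then s else s + h)" for k
  have "indep_vars (\<lambda>_. borel) (\<lambda>k \<omega>. D (t (Suc k)) \<omega> - D (t k) \<omega>) {..<2}"
    by (rule subordinator_indep[OF D]) (use s h in \<open>auto simp: t_def\<close>)
  then have ind: "indep_vars (\<lambda>_. borel) (\<lambda>k \<omega>. exp (- l * (D (t (Suc k)) \<omega> - D (t k) \<omega>))) {..<2}"
    by (rule indep_vars_compose2) auto
  have m [measurable]: "random_variable borel (D s)" "random_variable borel (D (s + h))"
    "random_variable borel (D 0)" "random_variable borel (D h)" using s h by auto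
  have int: "integrable M (\<lambda>\<omega>. exp (- l * (D (t (Suc k)) \<omega> - D (t k) \<omega>)))" if "k \<in> {..<2}" for k
  proof (rule integrable_exp_neg)
    show "random_variable borel (\<lambda>\<omega>. D (t (Suc k)) \<omega> - D (t k) \<omega>)"
      using ind that s h by (cases k) (auto simp: t_def)
    have "AE \<omega> in M. 0 \<le> D (t k) \<omega> \<and> D (t k) \<omega> \<le> D (t (Suc k)) \<omega>"
      by (rule subordinator_AE_nonneg[OF D]) (use s h in \<open>auto simp: t_def\<close>)
    then show "AE \<omega> in M. 0 \<le> D (t (Suc k)) \<omega> - D (t k) \<omega>" by eventually_elim simp
  qed (rule l)
  have "expectation (\<lambda>\<omega>. exp (- l * D (s + h) \<omega>)) =
    expectation (\<lambda>\<omega>. \<Prod>k<2. exp (- l * (D (t (Suc k)) \<omega> - D (t k) \<omega>)))"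
  proof (rule integral_cong_AE)
    show "AE \<omega> in M. exp (- l * D (s + h) \<omega>) = (\<Prod>k<2. exp (- l * (D (t (Suc k)) \<omega> - D (t k) \<omega>)))"
      using subordinator_AE[OF D]
      by eventually_elim (simp add: t_def numeral_2_eq_2 exp_add[symmetric] algebra_simps)
  qed (use ind in \<open>auto simp: numeral_2_eq_2 t_def\<close>)
  also have "\<dots> = (\<Prod>k<2. expectation (\<lambda>\<omega>. exp (- l * (D (t (Suc k)) \<omega> - D (t k) \<omega>))))"
    by (rule indep_vars_lebesgue_integral[OF _ ind int]) auto
  also have "\<dots> = expectation (\<lambda>\<omega>. exp (- l * (D s \<omega> - D 0 \<omega>))) * expectation (\<lambda>\<omega>. exp (- l * (D (s + h) \<omega> - D s \<omega>)))"
    by (simp add: t_def numeral_2_eq_2)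
  also have "expectation (\<lambda>\<omega>. exp (- l * (D s \<omega> - D 0 \<omega>))) = expectation (\<lambda>\<omega>. exp (- l * D s \<omega>))"
  proof (rule integral_cong_AE)
    show "AE \<omega> in M. exp (- l * (D s \<omega> - D 0 \<omega>)) = exp (- l * D s \<omega>)"
      using subordinator_AE[OF D] by eventually_elim simp
  qed auto
  also have "expectation (\<lambda>\<omega>. exp (- l * (D (s + h) \<omega> - D s \<omega>))) =
      (\<integral>x. exp (- l * x) \<partial>distr M borel (\<lambda>\<omega>. D (s + h) \<omega> - D s \<omega>))"
    by (subst integral_distr) auto
  also have "\<dots> = expectation (\<lambda>\<omega>. exp (- l * D h \<omega>))"
    unfolding subordinator_stationary[OF D s h] by (subst integral_distr) auto
  finally show ?thesis .
qed

text \<open>Both sides of the convolution identity are tested against \<open>exp (- x)\<close>.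
  Scaling of the law becomes scaling of the Laplace argument, and convolution becomes a
  product.\<close>

lemma subordinator_laplace_stable:
  assumes D: "stable_subordinator \<beta> D" and a: "0 < a" and b: "0 < b"
  defines "e \<equiv> (a powr \<beta> + b powr \<beta>) powr (1 / \<beta>)"
  shows "expectation (\<lambda>\<omega>. exp (- e * D 1 \<omega>)) =
    expectation (\<lambda>\<omega>. exp (- a * D 1 \<omega>)) * expectation (\<lambda>\<omega>. exp (- b * D 1 \<omega>))"
proof -
  have [measurable]: "random_variable borel (D 1)" by (rule subordinator_measurable[OF D]) simp
  have pos: "AE \<omega> in M. 0 \<le> D 1 \<omega>" using subordinator_AE_nonneg[OF D, of 1 1] by simp
  define \<mu> where "\<mu> = distr M borel (D 1)"
  interpret \<mu>: prob_space \<mu> unfolding \<mu>_def by (rule prob_space_distr) simp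
  have [measurable_cong, simp]: "sets \<mu> = sets borel" by (simp add: \<mu>_def)
  have eq: "distr \<mu> borel (\<lambda>x. a * x) \<star> distr \<mu> borel (\<lambda>x. b * x) = distr \<mu> borel (\<lambda>x. e * x)"
    using D a b unfolding stable_subordinator_def strictly_stable_law_def \<mu>_def e_def by blast
  have nn: "(\<integral>\<^sup>+x. ennreal (exp (- x)) \<partial>distr \<mu> borel (\<lambda>x. r * x)) =
      ennreal (expectation (\<lambda>\<omega>. exp (- r * D 1 \<omega>)))" if "0 \<le> r" for r
  proof -
    have "(\<integral>\<^sup>+x. ennreal (exp (- x)) \<partial>distr \<mu> borel (\<lambda>x. r * x)) = (\<integral>\<^sup>+x. ennreal (exp (- r * x)) \<partial>\<mu>)"
      by (subst nn_integral_distr) auto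
    also have "\<dots> = (\<integral>\<^sup>+\<omega>. ennreal (exp (- r * D 1 \<omega>)) \<partial>M)"
      unfolding \<mu>_def by (subst nn_integral_distr) auto
    also have "\<dots> = ennreal (expectation (\<lambda>\<omega>. exp (- r * D 1 \<omega>)))"
      by (rule nn_integral_eq_integral[OF integrable_exp_neg[OF _ pos that]]) auto
    finally show ?thesis .
  qed
  have pd: "prob_space (distr \<mu> borel (\<lambda>x. r * x))" for r
    by (rule \<mu>.prob_space_distr) measurable
  have "ennreal (expectation (\<lambda>\<omega>. exp (- e * D 1 \<omega>))) = (\<integral>\<^sup>+x. ennreal (exp (- x)) \<partial>distr \<mu> borel (\<lambda>x. e * x))"
    by (rule nn[symmetric]) (simp add: e_def)
  also have "\<dots> = (\<integral>\<^sup>+x. \<integral>\<^sup>+y. ennreal (exp (- (x + y))) \<partial>distr \<mu> borel (\<lambda>x. b * x) \<partial>distr \<mu> borel (\<lambda>x. a * x))"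
    unfolding eq[symmetric] by (subst nn_integral_convolution)
      (auto simp: prob_space.finite_measure[OF pd] prob_space_def pd)
  also have "\<dots> = (\<integral>\<^sup>+x. ennreal (exp (- x)) * (\<integral>\<^sup>+y. ennreal (exp (- y)) \<partial>distr \<mu> borel (\<lambda>x. b * x)) \<partial>distr \<mu> borel (\<lambda>x. a * x))"
    by (intro nn_integral_cong, subst nn_integral_cmult[symmetric])
       (auto simp: exp_add ennreal_mult exp_diff exp_minus divide_inverse)
  also have "\<dots> = (\<integral>\<^sup>+x. ennreal (exp (- x)) \<partial>distr \<mu> borel (\<lambda>x. a * x)) * (\<integral>\<^sup>+y. ennreal (exp (- y)) \<partial>distr \<mu> borel (\<lambda>x. b * x))"
    by (rule nn_integral_multc) auto
  also have "\<dots> = ennreal (expectation (\<lambda>\<omega>. exp (- a * D 1 \<omega>)) * expectation (\<lambda>\<omega>. exp (- b * D 1 \<omega>)))"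
    using a b by (simp only: nn less_imp_le ennreal_mult Bochner_Integration.integral_nonneg exp_ge_zero)
  finally show ?thesis
    by (subst (asm) ennreal_inj) (auto intro!: mult_nonneg_nonneg)
qed

text \<open>Cauchy's equation is solved twice: strict stability determines the dependence on
  \<open>l\<close> at time 1, and stationary independent increments determine the dependence on
  \<open>h\<close> for fixed \<open>l\<close>.\<close>

lemma stable_subordinator_laplace:
  assumes D: "stable_subordinator \<beta> D" and \<beta>: "0 < \<beta>"
  obtains c where "0 < c" "\<And>h l. 0 \<le> h \<Longrightarrow> 0 \<le> l \<Longrightarrow>
    expectation (\<lambda>\<omega>. exp (- l * D h \<omega>)) = exp (- c * h * l powr \<beta>)"
proof -
  define L where "L h l = expectation (\<lambda>\<omega>. exp (- l * D h \<omega>))" for h l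
  have L: "0 < L h l" "L h l \<le> 1" if "0 \<le> h" "0 \<le> l" for h l
  proof -
    have "AE \<omega> in M. 0 \<le> D h \<omega>" using subordinator_AE_nonneg[OF D, of h h] that by simp
    then show "0 < L h l" "L h l \<le> 1"
      unfolding L_def using subordinator_measurable[OF D that(1)] that(2)
      by (blast intro: laplace_bounds)+
  qed
  \<comment> \<open>Substituting \<open>u = l powr \<beta>\<close> turns the stable addition rule
    for scales into ordinary addition.\<close>
  define F where "F u = - ln (L 1 (u powr (1 / \<beta>)))" for u
  have "F u = u * F 1" if "0 \<le> u" for u
  proof (rule additive_nonneg_imp_linear[OF _ _ that])
    fix x y :: real assume xy: "0 \<le> x" "0 \<le> y"
    have L0: "L 1 0 = 1" by (simp add: L_def prob_space)
    show "F (x + y) = F x + F y"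
    proof (cases "x = 0 \<or> y = 0")
      case False
      then have "0 < x powr (1 / \<beta>)" "0 < y powr (1 / \<beta>)" using xy by auto
      from subordinator_laplace_stable[OF D this]
      have "L 1 ((x + y) powr (1 / \<beta>)) = L 1 (x powr (1 / \<beta>)) * L 1 (y powr (1 / \<beta>))"
        using xy \<beta> by (simp add: L_def powr_powr)
      then show ?thesis using L(1)[of 1 "x powr (1 / \<beta>)"] L(1)[of 1 "y powr (1 / \<beta>)"]
        by (simp add: F_def ln_mult)
    qed (auto simp: F_def L0)
  qed (use L[of 1] in \<open>simp add: F_def\<close>)
  then have F: "F u = u * F 1" if "0 \<le> u" for u using that by blast
  have L1: "L 1 l = exp (- (l powr \<beta> * F 1))" if "0 \<le> l" for l
  proof -
    have "ln (L 1 l) = - (l powr \<beta> * F 1)"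
      using F[of "l powr \<beta>"] that \<beta> by (simp add: F_def powr_powr)
    then show ?thesis using L(1)[of 1 l] that by (metis exp_ln zero_le_one)
  qed
  have main: "L h l = exp (- F 1 * h * l powr \<beta>)" if hl: "0 \<le> h" "0 \<le> l" for h l
  proof -
    define G where "G h = - ln (L h l)" for h
    have "G h = h * G 1"
    proof (rule additive_nonneg_imp_linear[OF _ _ hl(1)])
      fix x y :: real assume xy: "0 \<le> x" "0 \<le> y"
      have "L (x + y) l = L x l * L y l"
        unfolding L_def by (rule subordinator_laplace_mult[OF D xy hl(2)])
      then show "G (x + y) = G x + G y"
        using L(1)[of x l] L(1)[of y l] xy hl by (simp add: G_def ln_mult)
    qed (use L hl in \<open>simp add: G_def\<close>)
    moreover have "G 1 = l powr \<beta> * F 1" using L1[OF hl(2)] by (simp add: G_def)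
    ultimately have "G h = F 1 * h * l powr \<beta>" by simp
    then have "ln (L h l) = - F 1 * h * l powr \<beta>" by (simp add: G_def)
    then show ?thesis using L[OF hl] by (metis exp_ln)
  qed
  have "0 \<le> F 1" using L[of 1 1] by (simp add: F_def)
  \<comment> \<open>A vanishing constant would give \<open>E exp (- D n) = 1\<close>, hence
    \<open>D n = 0\<close> almost surely for all \<open>n\<close>; monotonicity extends this to all
    times, against nontriviality.\<close>
  moreover have "F 1 \<noteq> 0"
  proof
    assume "F 1 = 0"
    then have E1: "L (real n) 1 = 1" for n using main[of "real n" 1] by simp
    have "AE \<omega> in M. D (real n) \<omega> = 0" for n
    proof -
      have [measurable]: "random_variable borel (D (real n))" by (rule subordinator_measurable[OF D]) simp
      have pos: "AE \<omega> in M. 0 \<le> D (real n) \<omega>" using subordinator_AE_nonneg[OF D, of "real n" "real n"] by simp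
      have int: "integrable M (\<lambda>\<omega>. exp (- 1 * D (real n) \<omega>))" by (rule integrable_exp_neg) (use pos in auto)
      have int': "integrable M (\<lambda>\<omega>. 1 - exp (- 1 * D (real n) \<omega>))" using int by auto
      have "expectation (\<lambda>\<omega>. 1 - exp (- 1 * D (real n) \<omega>)) = 0"
        using int E1[of n] by (subst Bochner_Integration.integral_diff) (auto simp: L_def prob_space)
      then have "AE \<omega> in M. 1 - exp (- 1 * D (real n) \<omega>) = 0"
        by (subst (asm) integral_nonneg_eq_0_iff_AE[OF int']) (use pos in \<open>auto elim!: eventually_mono\<close>)
      then show ?thesis by eventually_elim simp
    qed
    then have "AE \<omega> in M. \<forall>n. D (real n) \<omega> = 0" by (subst AE_all_countable) blast
    then have "AE \<omega> in M. \<forall>t\<ge>0. D t \<omega> = 0"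
      using subordinator_AE[OF D]
    proof eventually_elim
      case (elim \<omega>)
      show ?case
      proof (intro allI impI)
        fix t :: real assume t: "0 \<le> t"
        obtain n where n: "t \<le> real n" using real_arch_simple by blast
        have "D 0 \<omega> \<le> D t \<omega>" "D t \<omega> \<le> D (real n) \<omega>"
          using mono_onD[of "{0..}" "\<lambda>t. D t \<omega>" 0 t] mono_onD[of "{0..}" "\<lambda>t. D t \<omega>" t "real n"]
            elim t n by auto
        then show "D t \<omega> = 0" using elim by simp
      qed
    qed
    then show False using D unfolding stable_subordinator_def by blast
  qed
  ultimately show ?thesis using that[of "F 1"] main unfolding L_def by auto
qed

section \<open>Small-value and tail estimates, regularity of subordinator paths\<close>

text \<open>Markov's inequality at \<open>l = 1 / \<epsilon>\<close>: below
  \<open>\<epsilon>\<close> the exponential is at least \<open>exp (-1)\<close>, and above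
  \<open>\<epsilon>\<close> its complement is at least \<open>1 - exp (-1)\<close>.\<close>

lemma prob_le_laplace:
  fixes X :: "'a \<Rightarrow> real"
  assumes [measurable]: "random_variable borel X" and "AE \<omega> in M. 0 \<le> X \<omega>" "0 < \<epsilon>"
  shows "prob {\<omega> \<in> space M. X \<omega> \<le> \<epsilon>} \<le> exp 1 * expectation (\<lambda>\<omega>. exp (- (1 / \<epsilon>) * X \<omega>))"
    and "prob {\<omega> \<in> space M. \<epsilon> < X \<omega>} * (1 - exp (-1)) \<le> 1 - expectation (\<lambda>\<omega>. exp (- (1 / \<epsilon>) * X \<omega>))"
proof -
  have int: "integrable M (\<lambda>\<omega>. exp (- (1 / \<epsilon>) * X \<omega>))"
    by (rule integrable_exp_neg) (use assms in auto)
  have "prob {\<omega> \<in> space M. X \<omega> \<le> \<epsilon>} = expectation (indicator {\<omega> \<in> space M. X \<omega> \<le> \<epsilon>})" by simp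
  also have "\<dots> \<le> expectation (\<lambda>\<omega>. exp 1 * exp (- (1 / \<epsilon>) * X \<omega>))"
  proof (rule integral_mono)
    show "integrable M (\<lambda>\<omega>. exp 1 * exp (- (1 / \<epsilon>) * X \<omega>))" using int by simp
    show "indicator {\<omega> \<in> space M. X \<omega> \<le> \<epsilon>} \<omega> \<le> exp 1 * exp (- (1 / \<epsilon>) * X \<omega>)" for \<omega>
      using assms(3) by (auto simp: indicator_def exp_add[symmetric])
  qed (auto simp: integrable_indicator_iff emeasure_eq_measure)
  finally show "prob {\<omega> \<in> space M. X \<omega> \<le> \<epsilon>} \<le> exp 1 * expectation (\<lambda>\<omega>. exp (- (1 / \<epsilon>) * X \<omega>))"
    by simp
  have "prob {\<omega> \<in> space M. \<epsilon> < X \<omega>} * (1 - exp (-1)) =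
      expectation (\<lambda>\<omega>. indicator {\<omega> \<in> space M. \<epsilon> < X \<omega>} \<omega> * (1 - exp (-1)))" by simp
  also have "\<dots> \<le> expectation (\<lambda>\<omega>. 1 - exp (- (1 / \<epsilon>) * X \<omega>))"
  proof (rule integral_mono_AE)
    show "AE \<omega> in M. indicator {\<omega> \<in> space M. \<epsilon> < X \<omega>} \<omega> * (1 - exp (-1)) \<le> 1 - exp (- (1 / \<epsilon>) * X \<omega>)"
      using assms(2) by eventually_elim (use assms(3) in \<open>auto simp: indicator_def\<close>)
  qed (use int in \<open>auto simp: integrable_indicator_iff emeasure_eq_measure\<close>)
  also have "\<dots> = 1 - expectation (\<lambda>\<omega>. exp (- (1 / \<epsilon>) * X \<omega>))"
    using int by (subst Bochner_Integration.integral_diff) (auto simp: prob_space)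
  finally show "prob {\<omega> \<in> space M. \<epsilon> < X \<omega>} * (1 - exp (-1)) \<le> 1 - expectation (\<lambda>\<omega>. exp (- (1 / \<epsilon>) * X \<omega>))" .
qed

lemma subordinator_increment_prob:
  assumes D: "stable_subordinator \<beta> D" and s: "0 \<le> s" and h: "0 \<le> h"
  shows "prob {\<omega> \<in> space M. D (s + h) \<omega> - D s \<omega> \<le> \<epsilon>} = prob {\<omega> \<in> space M. D h \<omega> \<le> \<epsilon>}"
proof -
  note [measurable] = subordinator_measurable[OF D, of s] subordinator_measurable[OF D, of h]
    subordinator_measurable[OF D, of "s + h"]
  have [measurable]: "random_variable borel (D s)" "random_variable borel (D h)"
    "random_variable borel (D (s + h))" using s h by auto
  have "measure (distr M borel (\<lambda>\<omega>. D (s + h) \<omega> - D s \<omega>)) {..\<epsilon>} = measure (distr M borel (D h)) {..\<epsilon>}"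
    by (simp add: subordinator_stationary[OF D s h])
  then show ?thesis
    by (subst (asm) measure_distr, simp, simp, subst (asm) measure_distr)
       (simp_all add: vimage_def Int_def conj_commute)
qed

lemma subordinator_small_prob:
  assumes D: "stable_subordinator \<beta> D" and h: "0 \<le> h" and e: "0 < \<epsilon>"
    and lap: "\<And>h l. 0 \<le> h \<Longrightarrow> 0 \<le> l \<Longrightarrow> expectation (\<lambda>\<omega>. exp (- l * D h \<omega>)) = exp (- c * h * l powr \<beta>)"
  shows "prob {\<omega> \<in> space M. D h \<omega> \<le> \<epsilon>} \<le> exp 1 * exp (- c * h * \<epsilon> powr - \<beta>)"
    and "prob {\<omega> \<in> space M. \<epsilon> < D h \<omega>} * (1 - exp (-1)) \<le> c * h * \<epsilon> powr - \<beta>"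
proof -
  note X = subordinator_measurable[OF D h]
  have pos: "AE \<omega> in M. 0 \<le> D h \<omega>" using subordinator_AE_nonneg[OF D, of h h] h by simp
  have eq: "expectation (\<lambda>\<omega>. exp (- (1 / \<epsilon>) * D h \<omega>)) = exp (- c * h * \<epsilon> powr - \<beta>)"
    using lap[OF h, of "1 / \<epsilon>"] e by (simp add: powr_divide powr_minus_divide)
  show "prob {\<omega> \<in> space M. D h \<omega> \<le> \<epsilon>} \<le> exp 1 * exp (- c * h * \<epsilon> powr - \<beta>)"
    using prob_le_laplace(1)[OF X pos e] unfolding eq .
  have "prob {\<omega> \<in> space M. \<epsilon> < D h \<omega>} * (1 - exp (-1)) \<le> 1 - exp (- c * h * \<epsilon> powr - \<beta>)"
    using prob_le_laplace(2)[OF X pos e] unfolding eq .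
  also have "\<dots> \<le> c * h * \<epsilon> powr - \<beta>"
    using exp_ge_add_one_self[of "- c * h * \<epsilon> powr - \<beta>"] by simp
  finally show "prob {\<omega> \<in> space M. \<epsilon> < D h \<omega>} * (1 - exp (-1)) \<le> c * h * \<epsilon> powr - \<beta>" .
qed

text \<open>A polynomial weakening of the exponential bound. It vanishes both as
  \<open>\<epsilon>\<close> tends to 0, giving strict increase, and as \<open>h\<close> tends to
  infinity, giving passage above level 1.\<close>

lemma subordinator_small_prob_powr:
  assumes D: "stable_subordinator \<beta> D" and h: "0 < h" and e: "0 < \<epsilon>" and c: "0 < c"
    and lap: "\<And>h l. 0 \<le> h \<Longrightarrow> 0 \<le> l \<Longrightarrow> expectation (\<lambda>\<omega>. exp (- l * D h \<omega>)) = exp (- c * h * l powr \<beta>)"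
  shows "prob {\<omega> \<in> space M. D h \<omega> \<le> \<epsilon>} \<le> exp 1 / (c * h) * \<epsilon> powr \<beta>"
proof -
  define y where "y = c * h * \<epsilon> powr - \<beta>"
  have y: "0 < y" using c h e by (simp add: y_def)
  have "prob {\<omega> \<in> space M. D h \<omega> \<le> \<epsilon>} \<le> exp 1 * exp (- y)"
    using subordinator_small_prob(1)[OF D _ e lap, of h] h by (simp add: y_def)
  also have "exp (- y) \<le> 1 / y"
  proof -
    have "y \<le> exp y" using exp_ge_add_one_self[of y] by linarith
    then show ?thesis using y by (simp add: exp_minus field_simps)
  qed
  also have "1 / y = 1 / (c * h) * \<epsilon> powr \<beta>" using e by (simp add: y_def powr_minus field_simps)
  finally show ?thesis by simp
qed

text \<open>Strict increase holds simultaneously for all rational pairs; between any two real times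
  lie two rationals, and monotonicity carries the strict inequality over. Passage above 1 ensures
  that the inverse is an infimum of a nonempty set on \<open>[0, 1]\<close>.\<close>

lemma subordinator_AE_regular:
  assumes D: "stable_subordinator \<beta> D" and \<beta>: "0 < \<beta>"
  shows "AE \<omega> in M. D 0 \<omega> = 0 \<and> strict_mono_on {0..} (\<lambda>t. D t \<omega>) \<and>
    (\<forall>t\<ge>0. ((\<lambda>t. D t \<omega>) \<longlongrightarrow> D t \<omega>) (at_right t)) \<and> (\<exists>n::nat. 1 < D (real n) \<omega>)"
proof -
  obtain c where c: "0 < c" and lap: "\<And>h l. 0 \<le> h \<Longrightarrow> 0 \<le> l \<Longrightarrow>
    expectation (\<lambda>\<omega>. exp (- l * D h \<omega>)) = exp (- c * h * l powr \<beta>)"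
    using stable_subordinator_laplace[OF D \<beta>] by blast
  note m = subordinator_measurable[OF D]
  have "AE \<omega> in M. D p \<omega> < D q \<omega>" if pq: "0 \<le> p" "p < q" for p q
  proof -
    have [measurable]: "random_variable borel (D p)" "random_variable borel (D q)" using m pq by auto
    have "prob {\<omega> \<in> space M. D q \<omega> - D p \<omega> \<le> 0} \<le> exp 1 / (c * (q - p)) * (1 / real (Suc n)) powr \<beta>" for n
    proof -
      have "prob {\<omega> \<in> space M. D q \<omega> - D p \<omega> \<le> 0} \<le> prob {\<omega> \<in> space M. D q \<omega> - D p \<omega> \<le> 1 / real (Suc n)}"
      proof (rule finite_measure_mono)
        have "0 \<le> 1 / real (Suc n)" by simp
        then have "x \<le> 0 \<Longrightarrow> x \<le> 1 / real (Suc n)" for x by (rule order_trans[rotated])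
        then show "{\<omega> \<in> space M. D q \<omega> - D p \<omega> \<le> 0} \<subseteq> {\<omega> \<in> space M. D q \<omega> - D p \<omega> \<le> 1 / real (Suc n)}"
          by blast
      qed measurable
      also have "\<dots> = prob {\<omega> \<in> space M. D (q - p) \<omega> \<le> 1 / real (Suc n)}"
        using subordinator_increment_prob[OF D, of p "q - p"] pq by simp
      also have "\<dots> \<le> exp 1 / (c * (q - p)) * (1 / real (Suc n)) powr \<beta>"
        by (rule subordinator_small_prob_powr[OF D _ _ c lap]) (use pq in auto)
      finally show ?thesis .
    qed
    moreover have "(\<lambda>n. exp 1 / (c * (q - p)) * (1 / real (Suc n)) powr \<beta>) \<longlonglongrightarrow> exp 1 / (c * (q - p)) * 0"
    proof (intro tendsto_mult_left)
      have "(\<lambda>n. real n powr - \<beta>) \<longlonglongrightarrow> 0"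
        by (rule tendsto_neg_powr) (use \<beta> filterlim_real_sequentially in auto)
      then have "(\<lambda>n. real (Suc n) powr - \<beta>) \<longlonglongrightarrow> 0" by (rule LIMSEQ_Suc)
      then show "(\<lambda>n. (1 / real (Suc n)) powr \<beta>) \<longlonglongrightarrow> 0"
        by (simp add: powr_divide powr_minus_divide)
    qed
    ultimately have "prob {\<omega> \<in> space M. D q \<omega> - D p \<omega> \<le> 0} \<le> exp 1 / (c * (q - p)) * 0"
      by (intro LIMSEQ_le_const) auto
    then have "prob {\<omega> \<in> space M. D q \<omega> - D p \<omega> \<le> 0} = 0" by (simp add: measure_le_0_iff)
    then have "AE \<omega> in M. \<not> (D q \<omega> - D p \<omega> \<le> 0)" by (subst (asm) prob_eq_0) auto
    then show ?thesis by eventually_elim simp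
  qed
  then have "AE \<omega> in M. 0 \<le> p \<and> p < q \<longrightarrow> D (real_of_rat p) \<omega> < D (real_of_rat q) \<omega>" for p q :: rat
    by (cases "0 \<le> p \<and> p < q") (auto simp: of_rat_less)
  then have rats: "AE \<omega> in M. \<forall>p q. 0 \<le> p \<and> p < q \<longrightarrow> D (real_of_rat p) \<omega> < D (real_of_rat q) \<omega>"
    by (simp only: AE_all_countable) blast
  have "AE \<omega> in M. \<exists>n::nat. 1 < D (real n) \<omega>"
  proof -
    have [measurable]: "random_variable borel (D (real n))" for n by (rule m) simp
    have "prob {\<omega> \<in> space M. \<forall>n::nat. D (real n) \<omega> \<le> 1} \<le> exp 1 / c * (1 / real (Suc n))" for n
    proof -
      have "prob {\<omega> \<in> space M. \<forall>n::nat. D (real n) \<omega> \<le> 1} \<le> prob {\<omega> \<in> space M. D (real (Suc n)) \<omega> \<le> 1}"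
        by (intro finite_measure_mono) (blast, measurable)
      also have "\<dots> \<le> exp 1 / (c * real (Suc n)) * 1 powr \<beta>"
        by (rule subordinator_small_prob_powr[OF D _ _ c lap]) auto
      finally show ?thesis by simp
    qed
    moreover have "(\<lambda>n. exp 1 / c * (1 / real (Suc n))) \<longlonglongrightarrow> exp 1 / c * 0"
      by (intro tendsto_mult_left) (simp add: LIMSEQ_inverse_real_of_nat flip: inverse_eq_divide del: of_nat_Suc)
    ultimately have "prob {\<omega> \<in> space M. \<forall>n::nat. D (real n) \<omega> \<le> 1} \<le> exp 1 / c * 0"
      by (intro LIMSEQ_le_const) auto
    then have "prob {\<omega> \<in> space M. \<forall>n::nat. D (real n) \<omega> \<le> 1} = 0" by (simp add: measure_le_0_iff)
    then have "AE \<omega> in M. \<not> (\<forall>n::nat. D (real n) \<omega> \<le> 1)" by (subst (asm) prob_eq_0) auto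
    then show ?thesis by eventually_elim (auto simp: not_le)
  qed
  then show ?thesis using subordinator_AE[OF D] rats
  proof eventually_elim
    case (elim \<omega>)
    have mo: "mono_on {0..} (\<lambda>t. D t \<omega>)" using elim by simp
    have "D s \<omega> < D t \<omega>" if st: "0 \<le> s" "s < t" for s t
    proof -
      obtain p where p: "s < real_of_rat p" "real_of_rat p < t" using of_rat_dense[OF st(2)] by blast
      obtain q where q: "real_of_rat p < real_of_rat q" "real_of_rat q < t" using of_rat_dense[OF p(2)] by blast
      have "0 < real_of_rat p" using p(1) st(1) by linarith
      then have pq: "0 \<le> p \<and> p < q" using q by (simp add: of_rat_less zero_less_of_rat_iff)
      then have "D (real_of_rat p) \<omega> < D (real_of_rat q) \<omega>" using elim by blast
      moreover have "D s \<omega> \<le> D (real_of_rat p) \<omega>" "D (real_of_rat q) \<omega> \<le> D t \<omega>"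
        using mono_onD[OF mo, of s "real_of_rat p"] mono_onD[OF mo, of "real_of_rat q" t] p q st pq by auto
      ultimately show ?thesis by linarith
    qed
    then have "strict_mono_on {0..} (\<lambda>t. D t \<omega>)" by (auto simp: strict_mono_on_def)
    then show ?case using elim unfolding cadlag_def by blast
  qed
qed

end

section \<open>Increments and Hoelder continuity of fractional Brownian motion\<close>

lemma nn_integral_exp_square_normal:
  fixes l \<sigma> :: real
  assumes \<sigma>: "0 < \<sigma>" and l: "0 < 1 + 2 * l * \<sigma>\<^sup>2"
  shows "(\<integral>\<^sup>+x. ennreal (exp (- l * x\<^sup>2)) \<partial>density lborel (\<lambda>x. ennreal (normal_density 0 \<sigma> x))) =
    ennreal (1 / sqrt (1 + 2 * l * \<sigma>\<^sup>2))"
proof -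
  define r where "r = sqrt (1 + 2 * l * \<sigma>\<^sup>2)"
  have r: "0 < r" "r\<^sup>2 = 1 + 2 * l * \<sigma>\<^sup>2" using l by (auto simp: r_def)
  define \<tau> where "\<tau> = \<sigma> / r"
  have \<tau>: "0 < \<tau>" using \<sigma> r by (simp add: \<tau>_def)
  have eq: "normal_density 0 \<sigma> x * exp (- l * x\<^sup>2) = 1 / r * normal_density 0 \<tau> x" for x
  proof -
    have "1 / sqrt (2 * pi * \<tau>\<^sup>2) = r / sqrt (2 * pi * \<sigma>\<^sup>2)"
      using \<sigma> r(1) by (simp add: \<tau>_def real_sqrt_mult power_divide real_sqrt_divide)
    moreover have "- x\<^sup>2 / (2 * \<sigma>\<^sup>2) + - l * x\<^sup>2 = - x\<^sup>2 / (2 * \<tau>\<^sup>2)"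
      using \<sigma> r by (simp add: \<tau>_def power_divide field_simps)
    ultimately show ?thesis using r by (simp add: normal_density_def exp_add[symmetric])
  qed
  have "(\<integral>\<^sup>+x. ennreal (exp (- l * x\<^sup>2)) \<partial>density lborel (\<lambda>x. ennreal (normal_density 0 \<sigma> x))) =
    (\<integral>\<^sup>+x. ennreal (normal_density 0 \<sigma> x * exp (- l * x\<^sup>2)) \<partial>lborel)"
    by (subst nn_integral_density) (auto simp: ennreal_mult intro!: nn_integral_cong)
  also have "\<dots> = (\<integral>\<^sup>+x. ennreal (1 / r) * ennreal (normal_density 0 \<tau> x) \<partial>lborel)"
    using r(1) by (intro nn_integral_cong, subst eq, subst ennreal_mult'[symmetric]) auto
  also have "\<dots> = ennreal (1 / r) * (\<integral>\<^sup>+x. ennreal (normal_density 0 \<tau> x) \<partial>lborel)"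
    by (rule nn_integral_cmult) simp
  also have "(\<integral>\<^sup>+x. ennreal (normal_density 0 \<tau> x) \<partial>lborel) = 1"
    using \<tau> by (subst nn_integral_eq_integral) auto
  finally show ?thesis by (simp add: r_def)
qed

context prob_space
begin

text \<open>A centred Gaussian law is determined by its variance; a positive second moment with mean
  0 excludes the Dirac laws.\<close>

lemma gaussian_law_moments:
  assumes [measurable]: "random_variable borel Z" and g: "gaussian_law (distr M borel Z)"
  shows "integrable M Z" "integrable M (\<lambda>\<omega>. (Z \<omega>)\<^sup>2)"
    "expectation Z = 0 \<Longrightarrow> 0 < \<sigma> \<Longrightarrow> expectation (\<lambda>\<omega>. (Z \<omega>)\<^sup>2) = \<sigma>\<^sup>2 \<Longrightarrow>
      distr M borel Z = density lborel (\<lambda>x. ennreal (normal_density 0 \<sigma> x))"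
proof -
  have "integrable M Z \<and> integrable M (\<lambda>\<omega>. (Z \<omega>)\<^sup>2) \<and>
    (expectation Z = 0 \<and> 0 < \<sigma> \<and> expectation (\<lambda>\<omega>. (Z \<omega>)\<^sup>2) = \<sigma>\<^sup>2 \<longrightarrow>
      distr M borel Z = density lborel (\<lambda>x. ennreal (normal_density 0 \<sigma> x)))"
    using g unfolding gaussian_law_def
  proof (elim disjE exE conjE)
    fix m s assume s: "0 < s" and eq: "distr M borel Z = density lborel (\<lambda>x. ennreal (normal_density m s x))"
    have D: "distributed M lborel Z (normal_density m s)"
      using eq by (simp add: distributed_def distr_cong[OF refl sets_lborel[symmetric] refl, symmetric] cong: distr_cong)
    have ex: "expectation Z = m" by (rule normal_distributed_expectation[OF s D])
    have var: "variance Z = s\<^sup>2" by (rule normal_distributed_variance[OF s D])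
    have i1: "integrable M (\<lambda>\<omega>. Z \<omega> - m)"
      using integrable_normal_moment[OF s, of m 1]
      by (subst distributed_integrable[OF D, symmetric]) auto
    have i2: "integrable M (\<lambda>\<omega>. (Z \<omega> - m)\<^sup>2)"
      using integrable_normal_moment[OF s, of m 2]
      by (subst distributed_integrable[OF D, symmetric, where g = "\<lambda>x. (x - m)\<^sup>2"]) auto
    have "integrable M (\<lambda>\<omega>. (Z \<omega> - m) + m)" using i1 by (intro Bochner_Integration.integrable_add) auto
    then have I1: "integrable M Z" by simp
    have "integrable M (\<lambda>\<omega>. (Z \<omega> - m)\<^sup>2 + 2 * m * Z \<omega> - m\<^sup>2)" using i2 I1 by auto
    moreover have "(\<lambda>\<omega>. (Z \<omega> - m)\<^sup>2 + 2 * m * Z \<omega> - m\<^sup>2) = (\<lambda>\<omega>. (Z \<omega>)\<^sup>2)"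
      by (auto simp: power2_eq_square algebra_simps)
    ultimately have I2: "integrable M (\<lambda>\<omega>. (Z \<omega>)\<^sup>2)" by simp
    have "s = \<sigma> \<and> m = 0" if "expectation Z = 0" "0 < \<sigma>" "expectation (\<lambda>\<omega>. (Z \<omega>)\<^sup>2) = \<sigma>\<^sup>2"
      using that var ex s by simp
    then show ?thesis using I1 I2 eq by auto
  next
    fix m assume eq: "distr M borel Z = return borel m"
    have "AE x in distr M borel Z. x = m" unfolding eq by (subst AE_return) auto
    then have ae: "AE \<omega> in M. Z \<omega> = m" by (subst (asm) AE_distr_iff) auto
    have c: "integrable M (\<lambda>_. m)" "integrable M (\<lambda>_. m\<^sup>2)" by auto
    have I: "integrable M Z" "integrable M (\<lambda>\<omega>. (Z \<omega>)\<^sup>2)"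
      by (rule integrable_cong_AE_imp[OF c(1)], simp, use ae in eventually_elim, simp)
         (rule integrable_cong_AE_imp[OF c(2)], simp, use ae in eventually_elim, simp)
    have "expectation Z = expectation (\<lambda>_. m)" using ae by (intro integral_cong_AE) auto
    moreover have "expectation (\<lambda>\<omega>. (Z \<omega>)\<^sup>2) = expectation (\<lambda>_. m\<^sup>2)"
      using ae by (intro integral_cong_AE) auto
    ultimately show ?thesis using I by (auto simp: prob_space)
  qed
  then show "integrable M Z" "integrable M (\<lambda>\<omega>. (Z \<omega>)\<^sup>2)"
    "expectation Z = 0 \<Longrightarrow> 0 < \<sigma> \<Longrightarrow> expectation (\<lambda>\<omega>. (Z \<omega>)\<^sup>2) = \<sigma>\<^sup>2 \<Longrightarrow>
      distr M borel Z = density lborel (\<lambda>x. ennreal (normal_density 0 \<sigma> x))" by auto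
qed

lemma fbm_measurable:
  assumes "fractional_brownian_motion H Y" "0 \<le> t"
  shows "random_variable borel (\<lambda>\<omega>. Y t \<omega> $ i)"
  using assms unfolding fractional_brownian_motion_def gaussian_process_def by auto

lemma fbm_increment_law:
  assumes Y: "fractional_brownian_motion H Y" and s: "0 \<le> s" and t: "0 \<le> t" and st: "s \<noteq> t"
  shows "distr M borel (\<lambda>\<omega>. Y s \<omega> $ i - Y t \<omega> $ i) =
    density lborel (\<lambda>x. ennreal (normal_density 0 (\<bar>s - t\<bar> powr H) x))"
proof -
  note m = fbm_measurable[OF Y]
  note [measurable] = m[OF s, of i] m[OF t, of i]
  have lin: "gaussian_law (distr M borel (\<lambda>\<omega>. \<Sum>r\<in>J. c r * Y r \<omega> $ i))" if "finite J" "J \<subseteq> {0..}" for J c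
    using Y that unfolding fractional_brownian_motion_def gaussian_process_def by blast
  have one: "gaussian_law (distr M borel (\<lambda>\<omega>. Y r \<omega> $ i))" if "0 \<le> r" for r
    using lin[of "{r}" "\<lambda>_. 1"] that by simp
  have diff: "gaussian_law (distr M borel (\<lambda>\<omega>. Y s \<omega> $ i - Y t \<omega> $ i))"
    using lin[of "{s, t}" "\<lambda>r. if r = s then 1 else -1"] s t st by simp
  have mean: "expectation (\<lambda>\<omega>. Y r \<omega> $ i) = 0" if "0 \<le> r" for r
    using Y that unfolding fractional_brownian_motion_def by blast
  have cov: "expectation (\<lambda>\<omega>. Y q \<omega> $ i * Y r \<omega> $ i) =
      (q powr (2 * H) + r powr (2 * H) - \<bar>q - r\<bar> powr (2 * H)) / 2" if "0 \<le> q" "0 \<le> r" for q r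
  proof -
    have "covariance (\<lambda>\<omega>. Y q \<omega> $ i) (\<lambda>\<omega>. Y r \<omega> $ i) =
      (q powr (2 * H) + r powr (2 * H) - \<bar>q - r\<bar> powr (2 * H)) / 2"
      using Y that unfolding fractional_brownian_motion_def by blast
    then show ?thesis by (simp add: covariance_def mean that)
  qed
  have I: "integrable M (\<lambda>\<omega>. Y r \<omega> $ i)" "integrable M (\<lambda>\<omega>. (Y r \<omega> $ i)\<^sup>2)" if "0 \<le> r" for r
    using gaussian_law_moments(1,2)[OF m[OF that] one[OF that]] .
  have mZ: "random_variable borel (\<lambda>\<omega>. Y s \<omega> $ i - Y t \<omega> $ i)" by measurable
  have E0: "expectation (\<lambda>\<omega>. Y s \<omega> $ i - Y t \<omega> $ i) = 0"
    using I(1) s t by (simp add: mean)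
  have iZ: "integrable M (\<lambda>\<omega>. (Y s \<omega> $ i - Y t \<omega> $ i)\<^sup>2)"
    by (rule gaussian_law_moments(2)[OF mZ diff])
  \<comment> \<open>Polarisation: the second moment of the increment is read off from the three
    covariances.\<close>
  have sq: "(\<lambda>\<omega>. Y s \<omega> $ i * Y t \<omega> $ i) =
      (\<lambda>\<omega>. ((Y s \<omega> $ i)\<^sup>2 + (Y t \<omega> $ i)\<^sup>2 - (Y s \<omega> $ i - Y t \<omega> $ i)\<^sup>2) / 2)"
    by (auto simp: power2_eq_square algebra_simps)
  have "expectation (\<lambda>\<omega>. Y s \<omega> $ i * Y t \<omega> $ i) = (expectation (\<lambda>\<omega>. (Y s \<omega> $ i)\<^sup>2) +
     expectation (\<lambda>\<omega>. (Y t \<omega> $ i)\<^sup>2) - expectation (\<lambda>\<omega>. (Y s \<omega> $ i - Y t \<omega> $ i)\<^sup>2)) / 2"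
    unfolding sq using I(2)[OF s] I(2)[OF t] iZ by simp
  then have "expectation (\<lambda>\<omega>. (Y s \<omega> $ i - Y t \<omega> $ i)\<^sup>2) = \<bar>s - t\<bar> powr (2 * H)"
    using cov[OF s t] cov[OF s s] cov[OF t t] by (simp add: power2_eq_square)
  also have "\<dots> = (\<bar>s - t\<bar> powr H)\<^sup>2" by (simp add: power2_eq_square powr_add[symmetric])
  finally show ?thesis using gaussian_law_moments(3)[OF mZ diff E0] st by simp
qed

lemma fbm_increment_exp_square:
  assumes Y: "fractional_brownian_motion H Y" and s: "0 \<le> s" and t: "0 \<le> t" and st: "s \<noteq> t"
    and l: "0 < 1 + 2 * l * \<bar>s - t\<bar> powr (2 * H)"
  shows "(\<integral>\<^sup>+\<omega>. ennreal (exp (- l * (Y s \<omega> $ i - Y t \<omega> $ i)\<^sup>2)) \<partial>M) =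
    ennreal (1 / sqrt (1 + 2 * l * \<bar>s - t\<bar> powr (2 * H)))"
proof -
  note [measurable] = fbm_measurable[OF Y s, of i] fbm_measurable[OF Y t, of i]
  have sq: "\<bar>s - t\<bar> powr (2 * H) = (\<bar>s - t\<bar> powr H)\<^sup>2" by (simp add: power2_eq_square powr_add[symmetric])
  have "(\<integral>\<^sup>+\<omega>. ennreal (exp (- l * (Y s \<omega> $ i - Y t \<omega> $ i)\<^sup>2)) \<partial>M) =
    (\<integral>\<^sup>+x. ennreal (exp (- l * x\<^sup>2)) \<partial>distr M borel (\<lambda>\<omega>. Y s \<omega> $ i - Y t \<omega> $ i))"
    by (subst nn_integral_distr) auto
  also have "\<dots> = ennreal (1 / sqrt (1 + 2 * l * \<bar>s - t\<bar> powr (2 * H)))"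
    unfolding fbm_increment_law[OF Y s t st] sq
    by (rule nn_integral_exp_square_normal) (use st l in \<open>auto simp: sq\<close>)
  finally show ?thesis .
qed

lemma fbm_increment_tail:
  assumes Y: "fractional_brownian_motion H Y" and s: "0 \<le> s" and t: "0 \<le> t" and st: "s \<noteq> t" and u: "0 \<le> u"
  shows "prob {\<omega> \<in> space M. u < \<bar>Y s \<omega> $ i - Y t \<omega> $ i\<bar>} \<le> sqrt 2 * exp (- u\<^sup>2 / (4 * \<bar>s - t\<bar> powr (2 * H)))"
proof -
  note [measurable] = fbm_measurable[OF Y s, of i] fbm_measurable[OF Y t, of i]
  \<comment> \<open>Chosen so that \<open>1 - 2 * l * variance\<close> is 1/2, which makes the
    exponential moment of the squared increment equal to \<open>sqrt 2\<close>.\<close>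
  define l where "l = 1 / (4 * \<bar>s - t\<bar> powr (2 * H))"
  have l: "0 < l" "1 + 2 * (- l) * \<bar>s - t\<bar> powr (2 * H) = 1 / 2" using st by (auto simp: l_def)
  define Z where "Z \<omega> = Y s \<omega> $ i - Y t \<omega> $ i" for \<omega>
  have [measurable]: "random_variable borel Z" unfolding Z_def by measurable
  have "ennreal (prob {\<omega> \<in> space M. u < \<bar>Z \<omega>\<bar>}) = (\<integral>\<^sup>+\<omega>. indicator {\<omega> \<in> space M. u < \<bar>Z \<omega>\<bar>} \<omega> \<partial>M)"
    by (simp add: emeasure_eq_measure)
  also have "\<dots> \<le> (\<integral>\<^sup>+\<omega>. ennreal (exp (- l * u\<^sup>2)) * ennreal (exp (l * (Z \<omega>)\<^sup>2)) \<partial>M)"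
  proof (rule nn_integral_mono)
    fix \<omega>
    have "1 \<le> exp (- l * u\<^sup>2) * exp (l * (Z \<omega>)\<^sup>2)" if "u < \<bar>Z \<omega>\<bar>"
    proof -
      have "u\<^sup>2 \<le> (Z \<omega>)\<^sup>2" using that u by (metis abs_of_nonneg abs_le_square_iff less_imp_le)
      then show ?thesis using l by (simp add: exp_add[symmetric])
    qed
    then show "indicator {\<omega> \<in> space M. u < \<bar>Z \<omega>\<bar>} \<omega> \<le> ennreal (exp (- l * u\<^sup>2)) * ennreal (exp (l * (Z \<omega>)\<^sup>2))"
      by (auto simp: indicator_def ennreal_mult[symmetric] intro: ennreal_leI[of 1, simplified])
  qed
  also have "\<dots> = ennreal (exp (- l * u\<^sup>2)) * (\<integral>\<^sup>+\<omega>. ennreal (exp (l * (Z \<omega>)\<^sup>2)) \<partial>M)"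
    by (rule nn_integral_cmult) measurable
  also have "(\<integral>\<^sup>+\<omega>. ennreal (exp (l * (Z \<omega>)\<^sup>2)) \<partial>M) = ennreal (sqrt 2)"
  proof -
    have pre: "0 < 1 + 2 * (- l) * \<bar>s - t\<bar> powr (2 * H)" by (simp only: l(2))
    have "(\<integral>\<^sup>+\<omega>. ennreal (exp (l * (Z \<omega>)\<^sup>2)) \<partial>M) = ennreal (1 / sqrt (1 / 2))"
      using fbm_increment_exp_square[OF Y s t st pre, of i] by (simp only: l(2) Z_def minus_minus)
    then show ?thesis by (simp add: real_sqrt_divide)
  qed
  finally have "ennreal (prob {\<omega> \<in> space M. u < \<bar>Z \<omega>\<bar>}) \<le> ennreal (sqrt 2 * exp (- l * u\<^sup>2))"
    by (simp add: ennreal_mult mult.commute)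
  then show ?thesis by (simp add: Z_def l_def)
qed

text \<open>The squared norm is a sum over coordinates and the coordinate processes are independent,
  so the expectation is a product of equal one-dimensional Gaussian integrals.\<close>

lemma fbm_increment_exp_norm_square:
  fixes Y :: "real \<Rightarrow> 'a \<Rightarrow> real ^ 'n"
  assumes Y: "fractional_brownian_motion H Y" and s: "0 \<le> s" and t: "0 \<le> t" and st: "s \<noteq> t" and l: "0 \<le> l"
  shows "(\<integral>\<^sup>+\<omega>. ennreal (exp (- l * (dist (Y s \<omega>) (Y t \<omega>))\<^sup>2)) \<partial>M) =
    ennreal ((1 + 2 * l * \<bar>s - t\<bar> powr (2 * H)) powr (- real CARD('n) / 2))"
proof -
  define p where "p = 1 + 2 * l * \<bar>s - t\<bar> powr (2 * H)"
  have p: "0 < p" using l by (simp add: p_def add_pos_nonneg)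
  have "indep_vars (\<lambda>_. path_space) (\<lambda>i. process_path (\<lambda>t \<omega>. Y t \<omega> $ i)) UNIV"
    using Y unfolding fractional_brownian_motion_def by blast
  then have "indep_vars (\<lambda>_. borel) (\<lambda>i \<omega>. ennreal (exp (- l * (process_path (\<lambda>t \<omega>. Y t \<omega> $ i) \<omega> s -
      process_path (\<lambda>t \<omega>. Y t \<omega> $ i) \<omega> t)\<^sup>2))) UNIV"
  proof (rule indep_vars_compose2)
    have [measurable]: "(\<lambda>f. f s) \<in> borel_measurable (path_space :: (real \<Rightarrow> real) measure)"
      "(\<lambda>f. f t) \<in> borel_measurable (path_space :: (real \<Rightarrow> real) measure)"
      using s t by (auto intro: measurable_component_singleton)
    show "(\<lambda>f. ennreal (exp (- l * (f s - f t)\<^sup>2))) \<in> borel_measurable (path_space :: (real \<Rightarrow> real) measure)"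
      by measurable
  qed
  then have ind: "indep_vars (\<lambda>_. borel) (\<lambda>i \<omega>. ennreal (exp (- l * (Y s \<omega> $ i - Y t \<omega> $ i)\<^sup>2))) UNIV"
    using s t by (simp add: process_path_def)
  have "(\<integral>\<^sup>+\<omega>. ennreal (exp (- l * (dist (Y s \<omega>) (Y t \<omega>))\<^sup>2)) \<partial>M) =
    (\<integral>\<^sup>+\<omega>. (\<Prod>i\<in>UNIV. ennreal (exp (- l * (Y s \<omega> $ i - Y t \<omega> $ i)\<^sup>2))) \<partial>M)"
  proof (rule nn_integral_cong)
    fix \<omega>
    have "(dist (Y s \<omega>) (Y t \<omega>))\<^sup>2 = (\<Sum>i\<in>UNIV. (Y s \<omega> $ i - Y t \<omega> $ i)\<^sup>2)"
      by (simp add: dist_vec_def L2_set_def sum_nonneg dist_real_def)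
    then show "ennreal (exp (- l * (dist (Y s \<omega>) (Y t \<omega>))\<^sup>2)) =
        (\<Prod>i\<in>UNIV. ennreal (exp (- l * (Y s \<omega> $ i - Y t \<omega> $ i)\<^sup>2)))"
      by (simp add: prod_ennreal exp_sum[symmetric] sum_distrib_left)
  qed
  also have "\<dots> = (\<Prod>i\<in>(UNIV::'n set). \<integral>\<^sup>+\<omega>. ennreal (exp (- l * (Y s \<omega> $ i - Y t \<omega> $ i)\<^sup>2)) \<partial>M)"
    by (rule indep_vars_nn_integral[OF _ ind]) auto
  also have "\<dots> = (\<Prod>i\<in>(UNIV::'n set). ennreal (1 / sqrt p))"
    using p unfolding p_def by (intro prod.cong refl fbm_increment_exp_square[OF Y s t st])
  also have "\<dots> = ennreal ((1 / sqrt p) ^ CARD('n))" using p by (simp add: ennreal_power)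
  also have "(1 / sqrt p) ^ CARD('n) = p powr (- real CARD('n) / 2)"
    using p by (simp add: powr_half_sqrt[symmetric] powr_minus_divide[symmetric] powr_power)
  finally show ?thesis by (simp add: p_def)
qed

end

section \<open>Hoelder continuity by dyadic chaining\<close>

lemma nat_floor_bounds: "0 \<le> x \<Longrightarrow> real (nat \<lfloor>x\<rfloor>) \<le> x \<and> x < real (nat \<lfloor>x\<rfloor>) + 1" for x :: real
  by linarith

lemma floor_dyadic_bounds:
  fixes t :: real
  assumes "0 \<le> t"
  defines "k m \<equiv> nat \<lfloor>t * 2 ^ m\<rfloor>"
  shows "real (k m) / 2 ^ m \<le> t" "t < (real (k m) + 1) / 2 ^ m"
proof -
  have "0 \<le> t * 2 ^ m" using assms by simp
  then have "real (k m) \<le> t * 2 ^ m" "t * 2 ^ m < real (k m) + 1" unfolding k_def by linarith+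
  then show "real (k m) / 2 ^ m \<le> t" "t < (real (k m) + 1) / 2 ^ m" by (simp_all add: field_simps)
qed

text \<open>Rounds \<open>d\<close> up to a dyadic scale; going back from the scale to
  \<open>d\<close> costs at most the factor \<open>2 powr \<gamma>\<close>.\<close>

lemma powr_dyadic_scale:
  fixes d \<gamma> :: real
  assumes "0 < d" "d \<le> 2 powr - real n0" "0 \<le> \<gamma>"
  obtains n where "n0 \<le> n" "d \<le> 2 powr - real n" "2 powr - (real n * \<gamma>) \<le> 2 powr \<gamma> * d powr \<gamma>"
proof -
  define n where "n = nat \<lfloor>- log 2 d\<rfloor>"
  have "log 2 d \<le> - real n0" using assms(1,2) by (simp add: log_le_iff)
  then have n: "n0 \<le> n" "real n \<le> - log 2 d" "- log 2 d \<le> real n + 1" unfolding n_def by linarith+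
  have "d = 2 powr (log 2 d)" using assms by simp
  also have "\<dots> \<le> 2 powr - real n" using n by (intro powr_mono) auto
  finally have 1: "d \<le> 2 powr - real n" .
  have "2 powr - (real n * \<gamma>) = 2 powr \<gamma> * (2 powr (- (real n + 1))) powr \<gamma>"
    by (simp add: powr_powr powr_add[symmetric] algebra_simps)
  also have "2 powr (- (real n + 1)) \<le> 2 powr (log 2 d)" using n by (intro powr_mono) auto
  then have "(2 powr (- (real n + 1))) powr \<gamma> \<le> d powr \<gamma>" using assms by (intro powr_mono2) auto
  then have "2 powr \<gamma> * (2 powr (- (real n + 1))) powr \<gamma> \<le> 2 powr \<gamma> * d powr \<gamma>" by simp
  finally show ?thesis using that[OF n(1) 1] by simp
qed

text \<open>Chaining: the dyadic approximations \<open>a t m\<close> of \<open>t\<close> from below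
  move by 0 or by one dyadic step when \<open>m\<close> grows, so by continuity \<open>y t\<close>
  differs from its value at level \<open>n\<close> by a geometric tail. Two points at distance at
  most \<open>2 powr - n\<close> have equal or adjacent approximations at level
  \<open>n\<close>.\<close>

lemma hoelder_of_dyadic_increments:
  fixes y :: "real \<Rightarrow> 'b::real_normed_vector"
  assumes cont: "continuous_on {0..} y" and \<gamma>: "0 < \<gamma>" and B: "0 \<le> B"
    and inc: "\<And>n k. n0 \<le> n \<Longrightarrow> k < K * 2 ^ n \<Longrightarrow>
      norm (y ((real k + 1) / 2 ^ n) - y (real k / 2 ^ n)) \<le> B * 2 powr - (real n * \<gamma>)"
  obtains C where "0 < C" "\<And>s t. 0 \<le> s \<Longrightarrow> s < real K \<Longrightarrow> 0 \<le> t \<Longrightarrow> t < real K \<Longrightarrow>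
    \<bar>s - t\<bar> \<le> 2 powr - real n0 \<Longrightarrow> norm (y s - y t) \<le> C * \<bar>s - t\<bar> powr \<gamma>"
proof -
  define q where "q = 2 powr - \<gamma>"
  have q: "0 < q" "q < 1" using \<gamma> by (auto simp: q_def powr_less_one)
  have qn: "2 powr - (real n * \<gamma>) = q ^ n" for n by (simp add: q_def powr_power)
  define C1 where "C1 = B / (1 - q)"
  have C1: "0 \<le> C1" using B q by (simp add: C1_def)
  define a where "a t m = real (nat \<lfloor>t * 2 ^ m\<rfloor>) / 2 ^ m" for t :: real and m
  have kK: "nat \<lfloor>t * 2 ^ m\<rfloor> < K * 2 ^ m" if "0 \<le> t" "t < real K" for t m
  proof -
    have "real (nat \<lfloor>t * 2 ^ m\<rfloor>) \<le> t * 2 ^ m" using that by (intro of_nat_floor) simp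
    also have "\<dots> < real K * 2 ^ m" using that by simp
    also have "\<dots> = real (K * 2 ^ m)" by simp
    finally show ?thesis by (simp only: of_nat_less_iff)
  qed
  have step: "norm (y (a t (Suc m)) - y (a t m)) \<le> B * q ^ Suc m" if t: "0 \<le> t" "t < real K" and m: "n0 \<le> m" for t m
  proof -
    define k where "k = nat \<lfloor>t * 2 ^ m\<rfloor>"
    define k' where "k' = nat \<lfloor>t * 2 ^ Suc m\<rfloor>"
    have "real k \<le> t * 2 ^ m" "t * 2 ^ m < real k + 1" "real k' \<le> t * 2 ^ Suc m" "t * 2 ^ Suc m < real k' + 1"
      using t nat_floor_bounds[of "t * 2 ^ m"] nat_floor_bounds[of "t * 2 ^ Suc m"]
      unfolding k_def k'_def by (simp_all del: power_Suc)
    then have "real k' < 2 * real k + 2" "2 * real k < real k' + 1" by (simp_all add: algebra_simps)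
    then have "k' < 2 * k + 2" "2 * k < k' + 1" by linarith+
    then consider "k' = 2 * k" | "k' = Suc (2 * k)" by linarith
    then show ?thesis
    proof cases
      case 1
      then have "a t (Suc m) = a t m" by (simp add: a_def k_def[symmetric] k'_def[symmetric] del: power_Suc) (simp add: field_simps)
      then show ?thesis using B q by simp
    next
      case 2
      then have e: "a t (Suc m) = (real (2 * k) + 1) / 2 ^ Suc m" "a t m = real (2 * k) / 2 ^ Suc m"
        unfolding a_def k_def[symmetric] k'_def[symmetric] by (simp_all add: field_simps)
      have "2 * k < K * 2 ^ Suc m" using kK[OF t, of "Suc m"] 2 unfolding k'_def[symmetric] by linarith
      from inc[OF _ this] m show ?thesis unfolding e qn by simp
    qed
  qed
  have tail: "norm (y t - y (a t n)) \<le> C1 * q ^ n" if t: "0 \<le> t" "t < real K" and n: "n0 \<le> n" for t n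
  proof -
    have part: "norm (y (a t (n + j)) - y (a t n)) \<le> B * (\<Sum>i<j. q ^ Suc (n + i))" for j
    proof (induction j)
      case (Suc j)
      have "norm (y (a t (n + Suc j)) - y (a t n)) \<le>
          norm (y (a t (Suc (n + j))) - y (a t (n + j))) + norm (y (a t (n + j)) - y (a t n))"
        using norm_triangle_ineq[of "y (a t (Suc (n + j))) - y (a t (n + j))" "y (a t (n + j)) - y (a t n)"] by simp
      also have "\<dots> \<le> B * q ^ Suc (n + j) + B * (\<Sum>i<j. q ^ Suc (n + i))"
        using Suc step[OF t, of "n + j"] n by simp
      finally show ?case by (simp add: algebra_simps)
    qed simp
    have geo: "(\<Sum>i<j. q ^ Suc (n + i)) \<le> q ^ n / (1 - q)" for j
    proof -
      have "(\<Sum>i<j. q ^ Suc (n + i)) = q ^ Suc n * (\<Sum>i<j. q ^ i)"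
        by (simp add: sum_distrib_left power_add mult.assoc)
      also have "(\<Sum>i<j. q ^ i) = (1 - q ^ j) / (1 - q)" using q by (simp add: sum_gp_strict)
      also have "q ^ Suc n * ((1 - q ^ j) / (1 - q)) \<le> q ^ n * (1 / (1 - q))"
        using q by (intro mult_mono divide_right_mono) (auto simp: mult_le_cancel_right1 power_le_one)
      finally show ?thesis by simp
    qed
    have part2: "norm (y (a t (n + j)) - y (a t n)) \<le> C1 * q ^ n" for j
      using order_trans[OF part mult_left_mono[OF geo B]] by (simp add: C1_def)
    have at: "(\<lambda>j. a t (n + j)) \<longlonglongrightarrow> t"
    proof (rule tendsto_sandwich[of "\<lambda>j. t - (1/2) ^ (n + j)" _ _ "\<lambda>_. t"])
      have "t - (1/2) ^ m \<le> a t m \<and> a t m \<le> t" for m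
        using floor_dyadic_bounds[OF t(1), of m] by (simp add: a_def power_divide add_divide_distrib)
      then show "\<forall>\<^sub>F j in sequentially. t - (1/2) ^ (n + j) \<le> a t (n + j)"
        "\<forall>\<^sub>F j in sequentially. a t (n + j) \<le> t" by auto
      have "(\<lambda>j. (1/2::real) ^ (n + j)) \<longlonglongrightarrow> 0"
        using LIMSEQ_ignore_initial_segment[OF LIMSEQ_realpow_zero[of "1/2::real"], of n] by (simp add: add.commute)
      then have "(\<lambda>j. t - (1/2) ^ (n + j)) \<longlonglongrightarrow> t - 0" by (intro tendsto_diff tendsto_const)
      then show "(\<lambda>j. t - (1/2) ^ (n + j)) \<longlonglongrightarrow> t" by simp
    qed auto
    have "(\<lambda>j. y (a t (n + j))) \<longlonglongrightarrow> y t"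
      by (rule continuous_on_tendsto_compose[OF cont at]) (use t in \<open>auto simp: a_def\<close>)
    then have "(\<lambda>j. norm (y (a t (n + j)) - y (a t n))) \<longlonglongrightarrow> norm (y t - y (a t n))"
      by (intro tendsto_norm tendsto_diff tendsto_const)
    then show ?thesis by (rule LIMSEQ_le_const2) (use part2 in auto)
  qed
  have main: "norm (y s - y t) \<le> (2 * C1 + B) * q ^ n"
    if s: "0 \<le> s" "s \<le> t" and t: "t < real K" and n: "n0 \<le> n" and d: "t - s \<le> 2 powr - real n" for s t n
  proof -
    have t0: "0 \<le> t" using s by simp
    define k where "k = nat \<lfloor>s * 2 ^ n\<rfloor>"
    define k' where "k' = nat \<lfloor>t * 2 ^ n\<rfloor>"
    have "s * 2 ^ n \<le> t * 2 ^ n" using s by simp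
    moreover have "(t - s) * 2 ^ n \<le> 1"
      using mult_right_mono[OF d, of "2 ^ n"] by (simp add: powr_minus powr_realpow)
    moreover have "0 \<le> s * 2 ^ n" using s by simp
    moreover have "real (nat \<lfloor>x\<rfloor>) < real (nat \<lfloor>z\<rfloor>) + 1 \<and> real (nat \<lfloor>z\<rfloor>) < real (nat \<lfloor>x\<rfloor>) + 2"
      if "0 \<le> x" "x \<le> z" "z - x \<le> 1" for x z :: real using that by linarith
    ultimately have "real k < real k' + 1" "real k' < real k + 2"
      unfolding k_def k'_def left_diff_distrib by blast+
    then consider "k' = k" | "k' = Suc k" by linarith
    then have "norm (y (a s n) - y (a t n)) \<le> B * q ^ n"
    proof cases
      case 1 then show ?thesis using B q by (simp add: a_def k_def k'_def)
    next
      case 2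
      then have "k < K * 2 ^ n" using kK[OF t0 t, of n] unfolding k'_def[symmetric] by linarith
      from inc[OF n this] 2 show ?thesis
        unfolding a_def k_def[symmetric] k'_def[symmetric] qn by (simp add: norm_minus_commute add.commute)
    qed
    moreover have "norm (y s - y (a s n)) \<le> C1 * q ^ n" "norm (y t - y (a t n)) \<le> C1 * q ^ n"
      using tail[of s n] tail[of t n] s t n by auto
    moreover have "norm (y s - y t) \<le> norm (y s - y (a s n)) + norm (y (a s n) - y (a t n)) + norm (y t - y (a t n))"
      using norm_triangle_ineq[of "y s - y (a s n)" "y (a s n) - y (a t n)"]
        norm_triangle_ineq4[of "y s - y (a t n)" "y t - y (a t n)"] by simp
    ultimately show ?thesis by (simp add: algebra_simps)
  qed
  \<comment> \<open>The summand 1 keeps \<open>C\<close> positive when \<open>B = 0\<close>.\<close>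
  define C where "C = (2 * C1 + B) * 2 powr \<gamma> + 1"
  have C: "0 < C" using C1 B by (auto simp: C_def intro: add_nonneg_pos)
  have hold: "norm (y s - y t) \<le> C * \<bar>s - t\<bar> powr \<gamma>"
    if st: "0 \<le> s" "s \<le> t" "t < real K" and d: "\<bar>s - t\<bar> \<le> 2 powr - real n0" for s t
  proof (cases "s = t")
    case False
    obtain n where n: "n0 \<le> n" "t - s \<le> 2 powr - real n" "2 powr - (real n * \<gamma>) \<le> 2 powr \<gamma> * (t - s) powr \<gamma>"
      using powr_dyadic_scale[of "t - s" n0 \<gamma>] st d False \<gamma> by auto
    have "norm (y s - y t) \<le> (2 * C1 + B) * q ^ n" by (rule main) (use st n in auto)
    also have "\<dots> \<le> (2 * C1 + B) * (2 powr \<gamma> * (t - s) powr \<gamma>)"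
      using n(3) C1 B unfolding qn by (intro mult_left_mono) auto
    also have "\<dots> \<le> C * (t - s) powr \<gamma>" by (simp add: C_def distrib_right)
    finally show ?thesis using st by (simp add: abs_minus_commute)
  qed simp
  show ?thesis
  proof (rule that[OF C])
    fix s t assume st: "0 \<le> s" "s < real K" "0 \<le> t" "t < real K" "\<bar>s - t\<bar> \<le> 2 powr - real n0"
    show "norm (y s - y t) \<le> C * \<bar>s - t\<bar> powr \<gamma>"
      using hold[of s t] hold[of t s] st by (cases "s \<le> t") (auto simp: norm_minus_commute abs_minus_commute)
  qed
qed

text \<open>One term \<open>v ^ m / fact m\<close> of the exponential series, with
  \<open>m \<ge> p / b\<close>, already dominates the required power. It turns stretched exponential
  tails into summable ones.\<close>

lemma exp_neg_powr_bound:
  fixes a b p :: real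
  assumes "0 < a" "0 < b"
  obtains C where "0 < C" "\<And>n::nat. exp (- a * 2 powr (real n * b)) \<le> C * 2 powr - (real n * p)"
proof -
  define m where "m = nat \<lceil>p / b\<rceil>"
  have m: "p \<le> b * real m"
  proof -
    have "p / b \<le> real m" unfolding m_def by linarith
    then show ?thesis using assms by (simp add: field_simps)
  qed
  show ?thesis
  proof (rule that[of "fact m / a ^ m"])
    show "0 < fact m / a ^ m" using assms by simp
    fix n :: nat
    define v where "v = a * 2 powr (real n * b)"
    have v: "0 < v" using assms by (simp add: v_def)
    have "v ^ m / fact m \<le> exp v"
    proof -
      have s: "(\<lambda>k. inverse (fact k) *\<^sub>R v ^ k) sums exp v" by (rule exp_converges)
      have "sum (\<lambda>k. inverse (fact k) *\<^sub>R v ^ k) {m} \<le> exp v"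
        unfolding sums_unique[OF s] by (rule sum_le_suminf[OF sums_summable[OF s]]) (use v in auto)
      then show ?thesis by (simp add: field_simps)
    qed
    then have "exp (- v) \<le> fact m / v ^ m" using v by (simp add: exp_minus field_simps)
    also have "\<dots> = fact m / a ^ m * 2 powr - (real n * b * real m)"
      using assms by (simp add: v_def power_mult_distrib powr_power powr_minus field_simps)
    also have "\<dots> \<le> fact m / a ^ m * 2 powr - (real n * p)"
      using assms m by (intro mult_left_mono powr_mono) (auto simp: mult.assoc intro: mult_left_mono)
    finally show "exp (- a * 2 powr (real n * b)) \<le> fact m / a ^ m * 2 powr - (real n * p)" by (simp add: v_def)
  qed
qed

context prob_space
begin

text \<open>At level \<open>n\<close> the threshold \<open>2 powr - (n * \<gamma>)\<close> exceeds
  the standard deviation \<open>2 powr - (n * H)\<close> by a growing factor, so the Gaussian tails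
  survive the union over all dyadic increments and Borel-Cantelli applies.\<close>

lemma fbm_AE_hoelder:
  fixes Y :: "real \<Rightarrow> 'a \<Rightarrow> real ^ 'n"
  assumes Y: "fractional_brownian_motion H Y" and \<gamma>: "0 < \<gamma>" "\<gamma> < H"
  shows "AE \<omega> in M. \<exists>C n0. 0 < C \<and> (\<forall>s t. 0 \<le> s \<longrightarrow> s < real K \<longrightarrow> 0 \<le> t \<longrightarrow> t < real K \<longrightarrow>
    \<bar>s - t\<bar> \<le> 2 powr - real (n0::nat) \<longrightarrow> norm (Y s \<omega> - Y t \<omega>) \<le> C * \<bar>s - t\<bar> powr \<gamma>)"
proof -
  define inc where "inc n k i \<omega> = Y ((real k + 1) / 2 ^ n) \<omega> $ i - Y (real k / 2 ^ n) \<omega> $ i"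
    for n k :: nat and i \<omega>
  have [measurable]: "random_variable borel (inc n k i)" for n k i
    unfolding inc_def by (intro borel_measurable_diff fbm_measurable[OF Y]) auto
  define A where "A n = (\<Union>p\<in>{..<K * 2 ^ n} \<times> (UNIV::'n set).
    {\<omega> \<in> space M. 2 powr - (real n * \<gamma>) < \<bar>inc n (fst p) (snd p) \<omega>\<bar>})" for n
  have [measurable]: "A n \<in> events" for n unfolding A_def by (intro sets.finite_UN) auto
  \<comment> \<open>The exponent 2 pays for the \<open>K * 2 ^ n\<close> increments of level
    \<open>n\<close> and leaves the summable factor \<open>(1/2) ^ n\<close>.\<close>
  obtain C where C: "0 < C" "\<And>n::nat. exp (- (1/4) * 2 powr (real n * (2 * (H - \<gamma>)))) \<le> C * 2 powr - (real n * 2)"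
    using exp_neg_powr_bound[of "1/4" "2 * (H - \<gamma>)" 2] \<gamma> by auto
  define R where "R = real CARD('n) * real K * (sqrt 2 * C)"
  have one: "prob {\<omega> \<in> space M. 2 powr - (real n * \<gamma>) < \<bar>inc n k i \<omega>\<bar>} \<le> sqrt 2 * (C * 2 powr - (real n * 2))" for n k i
  proof -
    have d: "\<bar>(real k + 1) / 2 ^ n - real k / 2 ^ n\<bar> = 2 powr - real n"
      by (simp add: diff_divide_distrib[symmetric] powr_minus powr_realpow inverse_eq_divide)
    have "prob {\<omega> \<in> space M. 2 powr - (real n * \<gamma>) < \<bar>inc n k i \<omega>\<bar>} \<le>
      sqrt 2 * exp (- (2 powr - (real n * \<gamma>))\<^sup>2 / (4 * \<bar>(real k + 1) / 2 ^ n - real k / 2 ^ n\<bar> powr (2 * H)))"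
      unfolding inc_def by (rule fbm_increment_tail[OF Y]) (auto simp: field_simps)
    also have "- (2 powr - (real n * \<gamma>))\<^sup>2 / (4 * \<bar>(real k + 1) / 2 ^ n - real k / 2 ^ n\<bar> powr (2 * H)) =
        - (1/4) * 2 powr (real n * (2 * (H - \<gamma>)))"
      unfolding d by (simp add: powr_powr power2_eq_square powr_add[symmetric] powr_diff[symmetric] algebra_simps)
    also have "sqrt 2 * exp (- (1/4) * 2 powr (real n * (2 * (H - \<gamma>)))) \<le> sqrt 2 * (C * 2 powr - (real n * 2))"
      by (intro mult_left_mono C) auto
    finally show ?thesis .
  qed
  have PA: "prob (A n) \<le> R * (1/2) ^ n" for n
  proof -
    have "prob (A n) \<le> (\<Sum>p\<in>{..<K * 2 ^ n} \<times> (UNIV::'n set). prob {\<omega> \<in> space M. 2 powr - (real n * \<gamma>) < \<bar>inc n (fst p) (snd p) \<omega>\<bar>})"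
      unfolding A_def by (intro finite_measure_subadditive_finite) auto
    also have "\<dots> \<le> (\<Sum>p\<in>{..<K * 2 ^ n} \<times> (UNIV::'n set). sqrt 2 * (C * 2 powr - (real n * 2)))"
      by (intro sum_mono one)
    also have "\<dots> = R * (2 ^ n * 2 powr - (real n * 2))" by (simp add: R_def)
    also have "2 ^ n * 2 powr - (real n * 2) = (1/2) ^ n"
    proof -
      have "(2::real) ^ n * 2 powr - (real n * 2) = 2 powr - real n"
        by (simp add: powr_realpow[symmetric] powr_add[symmetric])
      then show ?thesis by (simp add: powr_minus powr_realpow power_divide inverse_eq_divide)
    qed
    finally show ?thesis .
  qed
  have "summable (\<lambda>n. R * (1/2) ^ n)" by (intro summable_mult summable_geometric) auto
  then have "summable (\<lambda>n. prob (A n))"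
    by (rule summable_comparison_test') (use PA in auto)
  then have "AE \<omega> in M. eventually (\<lambda>n. \<omega> \<in> space M - A n) sequentially"
    by (intro borel_cantelli_AE1) (auto simp: emeasure_eq_measure)
  moreover have "AE \<omega> in M. continuous_on {0..} (\<lambda>t. Y t \<omega>)"
    using Y unfolding fractional_brownian_motion_def by blast
  ultimately show ?thesis
  proof eventually_elim
    case (elim \<omega>)
    then obtain n0 where n0: "\<And>n. n0 \<le> n \<Longrightarrow> \<omega> \<in> space M - A n" unfolding eventually_sequentially by blast
    have "norm (Y ((real k + 1) / 2 ^ n) \<omega> - Y (real k / 2 ^ n) \<omega>) \<le> real CARD('n) * 2 powr - (real n * \<gamma>)"
      if n: "n0 \<le> n" and k: "k < K * 2 ^ n" for n k
    proof -
      have "\<bar>(Y ((real k + 1) / 2 ^ n) \<omega> - Y (real k / 2 ^ n) \<omega>) $ i\<bar> \<le> 2 powr - (real n * \<gamma>)" for i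
        using n0[OF n] k unfolding A_def inc_def by (fastforce simp: not_less)
      then have "(\<Sum>i\<in>UNIV. \<bar>(Y ((real k + 1) / 2 ^ n) \<omega> - Y (real k / 2 ^ n) \<omega>) $ i\<bar>) \<le>
          (\<Sum>i\<in>(UNIV::'n set). 2 powr - (real n * \<gamma>))" by (rule sum_mono)
      then show ?thesis using norm_le_l1_cart[of "Y ((real k + 1) / 2 ^ n) \<omega> - Y (real k / 2 ^ n) \<omega>"] by simp
    qed
    from hoelder_of_dyadic_increments[where K = K, OF elim(2) \<gamma>(1) _ this]
    obtain C where "0 < C" "\<And>s t. 0 \<le> s \<Longrightarrow> s < real K \<Longrightarrow> 0 \<le> t \<Longrightarrow> t < real K \<Longrightarrow>
      \<bar>s - t\<bar> \<le> 2 powr - real n0 \<Longrightarrow> norm (Y s \<omega> - Y t \<omega>) \<le> C * \<bar>s - t\<bar> powr \<gamma>"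
      by auto
    then show ?case by blast
  qed
qed

end

section \<open>Energy estimates and lower bounds\<close>

text \<open>The points on either side of \<open>x\<close> contribute at most the integral of
  \<open>u powr - \<theta>\<close> over \<open>[0, 1]\<close>, which is
  \<open>1 / (1 - \<theta>)\<close>.\<close>

lemma nn_integral_powr_dist_le:
  fixes \<theta> x :: real
  assumes "\<theta> < 1"
  shows "(\<integral>\<^sup>+y. ennreal (\<bar>x - y\<bar> powr - \<theta>) * indicator {0..1} y \<partial>lborel) * indicator {0..1} x \<le> ennreal (2 / (1 - \<theta>))"
proof (cases "x \<in> {0..1}")
  case True
  define h where "h u = ennreal (\<bar>u\<bar> powr - \<theta>) * indicator {0..1} u" for u :: real
  have [measurable]: "h \<in> borel_measurable borel" unfolding h_def by measurable
  have "((\<lambda>u. u powr - \<theta>) has_integral (1 powr (- \<theta> + 1) / (- \<theta> + 1))) {0..1::real}"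
    by (rule has_integral_powr_from_0) (use assms in auto)
  then have hi: "((\<lambda>u. if u \<in> {0..1} then u powr - \<theta> else 0) has_integral (1 / (1 - \<theta>))) UNIV"
    unfolding has_integral_restrict_UNIV by simp
  have "(\<integral>\<^sup>+u. h u \<partial>lborel) = (\<integral>\<^sup>+u. ennreal (if u \<in> {0..1} then u powr - \<theta> else 0) \<partial>lborel)"
    by (intro nn_integral_cong) (auto simp: h_def indicator_def)
  also have "\<dots> = ennreal (1 / (1 - \<theta>))"
  proof (rule nn_integral_has_integral_lborel[OF _ _ hi])
    show "(\<lambda>u::real. if u \<in> {0..1} then u powr - \<theta> else 0) \<in> borel_measurable borel"
      by (rule measurable_If_set) auto
  qed auto
  finally have H: "(\<integral>\<^sup>+u. h u \<partial>lborel) = ennreal (1 / (1 - \<theta>))" .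
  have A: "(\<integral>\<^sup>+y. h (x - y) \<partial>lborel) = (\<integral>\<^sup>+u. h u \<partial>lborel)"
    using nn_integral_real_affine[of h "-1" x] by simp
  have B: "(\<integral>\<^sup>+y. h (y - x) \<partial>lborel) = (\<integral>\<^sup>+u. h u \<partial>lborel)"
    using nn_integral_real_affine[of h 1 "- x"] by simp
  have "(\<integral>\<^sup>+y. ennreal (\<bar>x - y\<bar> powr - \<theta>) * indicator {0..1} y \<partial>lborel) \<le> (\<integral>\<^sup>+y. h (x - y) + h (y - x) \<partial>lborel)"
  proof (rule nn_integral_mono)
    fix y
    show "ennreal (\<bar>x - y\<bar> powr - \<theta>) * indicator {0..1} y \<le> h (x - y) + h (y - x)"
    proof (cases "y \<in> {0..1}")
      case yin: True
      have "ennreal (\<bar>x - y\<bar> powr - \<theta>) = h (x - y) \<or> ennreal (\<bar>x - y\<bar> powr - \<theta>) = h (y - x)"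
        using yin True by (cases "y \<le> x") (auto simp: h_def indicator_def abs_minus_commute)
      then show ?thesis using yin by (auto simp: add_increasing add_increasing2)
    qed simp
  qed
  also have "\<dots> = (\<integral>\<^sup>+y. h (x - y) \<partial>lborel) + (\<integral>\<^sup>+y. h (y - x) \<partial>lborel)"
    by (rule nn_integral_add) measurable
  also have "\<dots> = ennreal (2 / (1 - \<theta>))"
    unfolding A B H using assms by (simp add: ennreal_plus[symmetric] del: ennreal_plus)
  finally show ?thesis using True by simp
qed simp

context prob_space
begin

text \<open>Fubini needs measurability in time and chance together, whereas the hypotheses concern
  fixed times. Right-continuous paths are limits of step functions in time, which are jointly
  measurable.\<close>

lemma jointly_measurable_modification:
  fixes f :: "real \<Rightarrow> 'a \<Rightarrow> 'b::{banach, second_countable_topology}"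
  assumes m: "\<And>x. 0 \<le> x \<Longrightarrow> random_variable borel (f x)"
    and rc: "AE \<omega> in M. \<forall>x\<ge>0. ((\<lambda>x. f x \<omega>) \<longlongrightarrow> f x \<omega>) (at_right x)"
  obtains g where "case_prod g \<in> borel_measurable (borel \<Otimes>\<^sub>M M)" "AE \<omega> in M. \<forall>x\<ge>0. g x \<omega> = f x \<omega>"
proof -
  define k where "k n x = nat \<lfloor>x * 2 ^ n\<rfloor>" for n and x :: real
  \<comment> \<open>Rounding up strictly keeps the approximating times to the right of
    \<open>x\<close>, so right continuity alone yields the limit.\<close>
  define a where "a n x = (real (k n x) + 1) / 2 ^ n" for n x
  define F where "F n p = f (a n (fst p)) (snd p)" for n and p :: "real \<times> 'a"
  have [measurable]: "F n \<in> borel_measurable (borel \<Otimes>\<^sub>M M)" for n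
  proof -
    have [measurable]: "random_variable borel (f ((real i + 1) / 2 ^ n))" for i by (rule m) simp
    have "(\<lambda>p. f ((real (k n (fst p)) + 1) / 2 ^ n) (snd p)) \<in> borel_measurable (borel \<Otimes>\<^sub>M M)"
    proof (rule measurable_compose_countable[where f = "\<lambda>i p. f ((real i + 1) / 2 ^ n) (snd p)"])
      show "(\<lambda>p. f ((real i + 1) / 2 ^ n) (snd p)) \<in> borel_measurable (borel \<Otimes>\<^sub>M M)" for i :: nat
        by measurable
      show "(\<lambda>p. k n (fst p)) \<in> measurable (borel \<Otimes>\<^sub>M M) (count_space UNIV)"
        unfolding k_def by measurable
    qed
    then show ?thesis by (simp add: F_def[abs_def] a_def)
  qed
  define g where "g x \<omega> = lim (\<lambda>n. F n (x, \<omega>))" for x \<omega>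
  have "(\<lambda>p. lim (\<lambda>n. F n p)) \<in> borel_measurable (borel \<Otimes>\<^sub>M M)" by measurable
  then have "case_prod g \<in> borel_measurable (borel \<Otimes>\<^sub>M M)" by (simp add: g_def split_beta')
  moreover have "AE \<omega> in M. \<forall>x\<ge>0. g x \<omega> = f x \<omega>"
    using rc
  proof eventually_elim
    case (elim \<omega>)
    show ?case
    proof (intro allI impI)
      fix x :: real assume x: "0 \<le> x"
      have ax: "x < a n x" "a n x \<le> x + (1/2) ^ n" for n
        using floor_dyadic_bounds[OF x, of n] by (auto simp: a_def k_def add_divide_distrib power_divide)
      have lim_a: "(\<lambda>n. a n x) \<longlonglongrightarrow> x"
      proof (rule tendsto_sandwich[of "\<lambda>_. x" _ _ "\<lambda>n. x + (1/2) ^ n"])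
        have "(\<lambda>n. x + (1/2) ^ n) \<longlonglongrightarrow> x + 0"
          by (intro tendsto_add tendsto_const LIMSEQ_realpow_zero) auto
        then show "(\<lambda>n. x + (1/2) ^ n) \<longlonglongrightarrow> x" by simp
      qed (use ax(2) less_imp_le[OF ax(1)] in auto)
      have fl: "filterlim (\<lambda>n. a n x) (at_right x) sequentially"
        using lim_a ax(1) less_imp_neq[OF ax(1), symmetric] by (simp add: filterlim_at)
      have "((\<lambda>x. f x \<omega>) \<longlongrightarrow> f x \<omega>) (at_right x)" using elim x by simp
      from filterlim_compose[OF this fl] have "(\<lambda>n. f (a n x) \<omega>) \<longlonglongrightarrow> f x \<omega>" .
      then show "g x \<omega> = f x \<omega>" unfolding g_def F_def by (simp add: limI)
    qed
  qed
  ultimately show ?thesis by (rule that)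
qed

text \<open>Bounds the expected energy of Lebesgue measure on \<open>[0, 1]\<close>: the gap
  \<open>s < s'\<close> makes the sum over the kernel scales geometric, and
  \<open>\<theta> < 1\<close> makes the singularity in time integrable. The energy on
  \<open>[0, T]\<close> is at most that on \<open>[0, 1]\<close>, so one null set serves every
  \<open>T\<close>; the interval eventually used is random.\<close>

lemma AE_hausdorff_measure_image_nonzero:
  fixes f :: "real \<Rightarrow> 'a \<Rightarrow> 'b::euclidean_space"
  assumes m: "\<And>x. 0 \<le> x \<Longrightarrow> random_variable borel (f x)"
    and rc: "AE \<omega> in M. \<forall>x\<ge>0. ((\<lambda>x. f x \<omega>) \<longlongrightarrow> f x \<omega>) (at_right x)"
    and s: "0 \<le> s" "s < s'" and \<theta>: "\<theta> < 1" and C: "0 \<le> C"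
    and bound: "\<And>n x y. 0 \<le> x \<Longrightarrow> x < y \<Longrightarrow> y \<le> 1 \<Longrightarrow>
      (\<integral>\<^sup>+\<omega>. ennreal (exp (- (4 ^ n) * (dist (f x \<omega>) (f y \<omega>))\<^sup>2)) \<partial>M) \<le>
      ennreal (C * 2 powr - (real n * s') * (y - x) powr - \<theta>)"
  shows "AE \<omega> in M. \<forall>T. 0 < T \<and> T \<le> 1 \<longrightarrow> hausdorff_measure s ((\<lambda>x. f x \<omega>) ` {0..T}) \<noteq> 0"
proof -
  obtain g where g [measurable]: "case_prod g \<in> borel_measurable (borel \<Otimes>\<^sub>M M)"
    and gf: "AE \<omega> in M. \<forall>x\<ge>0. g x \<omega> = f x \<omega>"
    using jointly_measurable_modification[OF m rc] by blast
  define q where "q = 2 powr - (s' - s)"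
  have q: "0 < q" "q < 1" using s by (auto simp: q_def powr_less_one)
  define A where "A = C / (1 - q)"
  have A: "0 \<le> A" using C q by (simp add: A_def)
  have sym: "(\<integral>\<^sup>+\<omega>. ennreal (exp (- (4 ^ n) * (dist (f x \<omega>) (f y \<omega>))\<^sup>2)) \<partial>M) \<le>
      ennreal (C * 2 powr - (real n * s') * \<bar>x - y\<bar> powr - \<theta>)"
    if "x \<in> {0..1}" "y \<in> {0..1}" "x \<noteq> y" for n x y
    using bound[of x y n] bound[of y x n] that by (cases "x < y") (auto simp: dist_commute)
  have kb: "(\<integral>\<^sup>+\<omega>. energy_kernel s (dist (g x \<omega>) (g y \<omega>)) \<partial>M) \<le> ennreal A * ennreal (\<bar>x - y\<bar> powr - \<theta>)"
    if xy: "x \<in> {0..1}" "y \<in> {0..1}" "x \<noteq> y" for x y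
  proof -
    have [measurable]: "random_variable borel (f x)" "random_variable borel (f y)" using m xy by auto
    have "(\<integral>\<^sup>+\<omega>. energy_kernel s (dist (g x \<omega>) (g y \<omega>)) \<partial>M) = (\<integral>\<^sup>+\<omega>. energy_kernel s (dist (f x \<omega>) (f y \<omega>)) \<partial>M)"
      by (rule nn_integral_cong_AE) (use gf in eventually_elim, use xy in auto)
    also have "\<dots> = (\<Sum>n. \<integral>\<^sup>+\<omega>. ennreal (2 powr (real n * s) * exp (- (4 ^ n) * (dist (f x \<omega>) (f y \<omega>))\<^sup>2)) \<partial>M)"
      unfolding energy_kernel_def by (rule nn_integral_suminf) measurable
    also have "\<dots> \<le> (\<Sum>n. ennreal (C * \<bar>x - y\<bar> powr - \<theta> * q ^ n))"
    proof (intro suminf_le summableI)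
      fix n
      have "(\<integral>\<^sup>+\<omega>. ennreal (2 powr (real n * s) * exp (- (4 ^ n) * (dist (f x \<omega>) (f y \<omega>))\<^sup>2)) \<partial>M) =
        ennreal (2 powr (real n * s)) * (\<integral>\<^sup>+\<omega>. ennreal (exp (- (4 ^ n) * (dist (f x \<omega>) (f y \<omega>))\<^sup>2)) \<partial>M)"
        by (simp add: ennreal_mult nn_integral_cmult)
      also have "\<dots> \<le> ennreal (2 powr (real n * s)) * ennreal (C * 2 powr - (real n * s') * \<bar>x - y\<bar> powr - \<theta>)"
        by (intro mult_left_mono sym xy) auto
      also have "\<dots> = ennreal (C * \<bar>x - y\<bar> powr - \<theta> * (2 powr (real n * s) * 2 powr - (real n * s')))"
        using C by (simp add: ennreal_mult[symmetric] mult_ac)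
      also have "2 powr (real n * s) * 2 powr - (real n * s') = q ^ n"
        by (simp add: q_def powr_add[symmetric] powr_power algebra_simps)
      finally show "(\<integral>\<^sup>+\<omega>. ennreal (2 powr (real n * s) * exp (- (4 ^ n) * (dist (f x \<omega>) (f y \<omega>))\<^sup>2)) \<partial>M) \<le>
          ennreal (C * \<bar>x - y\<bar> powr - \<theta> * q ^ n)" .
    qed
    also have "\<dots> = ennreal (C * \<bar>x - y\<bar> powr - \<theta> * (1 / (1 - q)))"
      by (rule suminf_ennreal_eq[OF _ sums_mult[OF geometric_sums]]) (use q C in auto)
    also have "\<dots> = ennreal A * ennreal (\<bar>x - y\<bar> powr - \<theta>)"
      using A by (simp add: ennreal_mult[symmetric] A_def)
    finally show ?thesis .
  qed
  interpret P: pair_sigma_finite lborel M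
    by (intro pair_sigma_finite.intro lborel.sigma_finite_measure_axioms sigma_finite_measure_axioms)
  define J where "J \<omega> = (\<integral>\<^sup>+x. \<integral>\<^sup>+y. energy_kernel s (dist (g x \<omega>) (g y \<omega>)) * indicator {0..1} y * indicator {0..1} x \<partial>lborel \<partial>lborel)" for \<omega>
  have gm [measurable (raw)]: "(\<lambda>z. g (u z) (v z)) \<in> borel_measurable N"
    if [measurable]: "u \<in> borel_measurable N" "v \<in> measurable N M" for u v and N :: "'c measure"
  proof -
    have "(\<lambda>z. (u z, v z)) \<in> measurable N (borel \<Otimes>\<^sub>M M)" by measurable
    from measurable_compose[OF this g] show ?thesis by simp
  qed
  have Jm [measurable]: "J \<in> borel_measurable M" unfolding J_def by measurable
  have "(\<integral>\<^sup>+\<omega>. J \<omega> \<partial>M) = (\<integral>\<^sup>+x. \<integral>\<^sup>+\<omega>. \<integral>\<^sup>+y. energy_kernel s (dist (g x \<omega>) (g y \<omega>)) * indicator {0..1} y * indicator {0..1} x \<partial>lborel \<partial>M \<partial>lborel)"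
    unfolding J_def by (rule P.Fubini') measurable
  also have "\<dots> = (\<integral>\<^sup>+x. \<integral>\<^sup>+y. \<integral>\<^sup>+\<omega>. energy_kernel s (dist (g x \<omega>) (g y \<omega>)) * indicator {0..1} y * indicator {0..1} x \<partial>M \<partial>lborel \<partial>lborel)"
    by (intro nn_integral_cong P.Fubini') measurable
  also have "\<dots> \<le> (\<integral>\<^sup>+x. ennreal A * ennreal (2 / (1 - \<theta>)) * indicator {0..1::real} x \<partial>lborel)"
  proof (rule nn_integral_mono)
    fix x :: real
    show "(\<integral>\<^sup>+y. \<integral>\<^sup>+\<omega>. energy_kernel s (dist (g x \<omega>) (g y \<omega>)) * indicator {0..1} y * indicator {0..1} x \<partial>M \<partial>lborel)
        \<le> ennreal A * ennreal (2 / (1 - \<theta>)) * indicator {0..1} x"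
    proof (cases "x \<in> {0..1}")
      case True
      have "(\<integral>\<^sup>+y. \<integral>\<^sup>+\<omega>. energy_kernel s (dist (g x \<omega>) (g y \<omega>)) * indicator {0..1} y * indicator {0..1} x \<partial>M \<partial>lborel)
        \<le> (\<integral>\<^sup>+y. ennreal A * (ennreal (\<bar>x - y\<bar> powr - \<theta>) * indicator {0..1} y) \<partial>lborel)"
      proof (rule nn_integral_mono_AE)
        \<comment> \<open>On the diagonal the kernel is infinite and \<open>kb\<close> gives
          nothing, but a single point \<open>y = x\<close> is Lebesgue null.\<close>
        show "AE y in lborel. (\<integral>\<^sup>+\<omega>. energy_kernel s (dist (g x \<omega>) (g y \<omega>)) * indicator {0..1} y * indicator {0..1} x \<partial>M)
          \<le> ennreal A * (ennreal (\<bar>x - y\<bar> powr - \<theta>) * indicator {0..1} y)"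
          using AE_lborel_singleton[of x]
        proof eventually_elim
          case (elim y)
          show ?case
          proof (cases "y \<in> {0..1}")
            case yin: True
            show ?thesis using kb[OF True yin] elim True yin by simp
          qed simp
        qed
      qed
      also have "\<dots> = ennreal A * (\<integral>\<^sup>+y. ennreal (\<bar>x - y\<bar> powr - \<theta>) * indicator {0..1} y \<partial>lborel)"
        by (rule nn_integral_cmult) measurable
      also have "\<dots> \<le> ennreal A * ennreal (2 / (1 - \<theta>))"
        using nn_integral_powr_dist_le[OF \<theta>, of x] True by (intro mult_left_mono) auto
      finally show ?thesis using True by simp
    qed simp
  qed
  also have "\<dots> < \<top>" using A \<theta> by (subst nn_integral_cmult_indicator) (auto simp: ennreal_mult_less_top)
  finally have "AE \<omega> in M. J \<omega> \<noteq> \<infinity>" by (intro nn_integral_PInf_AE) auto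
  with gf AE_space show ?thesis
  proof eventually_elim
    case (elim \<omega>)
    have \<omega>: "\<omega> \<in> space M" by fact
    have [measurable]: "(\<lambda>x. g x \<omega>) \<in> borel_measurable borel"
      using measurable_compose[OF measurable_Pair2'[OF \<omega>] g] by simp
    show ?case
    proof (intro allI impI)
      fix T :: real assume T: "0 < T \<and> T \<le> 1"
      define \<nu> where "\<nu> = restrict_space lborel {0..T}"
      have sp: "space \<nu> = {0..T}" by (simp add: \<nu>_def)
      have em: "emeasure \<nu> (space \<nu>) = ennreal T"
        unfolding sp unfolding \<nu>_def using T by (subst emeasure_restrict_space) auto
      have "hausdorff_measure s ((\<lambda>x. g x \<omega>) ` space \<nu>) \<noteq> 0"
      proof (rule hausdorff_measure_nonzero_energy)
        show "finite_measure \<nu>" by (rule finite_measureI) (simp add: em)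
        show "(\<lambda>x. g x \<omega>) \<in> borel_measurable \<nu>"
          unfolding \<nu>_def by (rule measurable_restrict_space1) simp
        show "emeasure \<nu> (space \<nu>) \<noteq> 0" using T by (simp add: em)
        have "(\<integral>\<^sup>+x. \<integral>\<^sup>+y. energy_kernel s (dist (g x \<omega>) (g y \<omega>)) \<partial>\<nu> \<partial>\<nu>) =
          (\<integral>\<^sup>+x. (\<integral>\<^sup>+y. energy_kernel s (dist (g x \<omega>) (g y \<omega>)) * indicator {0..T} y \<partial>lborel) * indicator {0..T} x \<partial>lborel)"
          unfolding \<nu>_def by (simp add: nn_integral_restrict_space)
        also have "\<dots> \<le> J \<omega>" unfolding J_def
        proof (rule nn_integral_mono)
          fix x :: real
          have "(\<integral>\<^sup>+y. energy_kernel s (dist (g x \<omega>) (g y \<omega>)) * indicator {0..T} y \<partial>lborel) * indicator {0..T} x =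
            (\<integral>\<^sup>+y. energy_kernel s (dist (g x \<omega>) (g y \<omega>)) * indicator {0..T} y * indicator {0..T} x \<partial>lborel)"
            by (rule nn_integral_multc[symmetric]) measurable
          also have "\<dots> \<le> (\<integral>\<^sup>+y. energy_kernel s (dist (g x \<omega>) (g y \<omega>)) * indicator {0..1} y * indicator {0..1} x \<partial>lborel)"
            using T by (intro nn_integral_mono) (auto simp: indicator_def)
          finally show "(\<integral>\<^sup>+y. energy_kernel s (dist (g x \<omega>) (g y \<omega>)) * indicator {0..T} y \<partial>lborel) * indicator {0..T} x
            \<le> (\<integral>\<^sup>+y. energy_kernel s (dist (g x \<omega>) (g y \<omega>)) * indicator {0..1} y * indicator {0..1} x \<partial>lborel)" .
        qed
        also have "\<dots> < \<top>" using elim by (simp add: less_top)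
        finally show "(\<integral>\<^sup>+x. \<integral>\<^sup>+y. energy_kernel s (dist (g x \<omega>) (g y \<omega>)) \<partial>\<nu> \<partial>\<nu>) < \<top>" .
      qed (rule s)
      moreover have "(\<lambda>x. g x \<omega>) ` space \<nu> = (\<lambda>x. f x \<omega>) ` {0..T}"
        unfolding sp using elim by (intro image_cong) auto
      ultimately show "hausdorff_measure s ((\<lambda>x. f x \<omega>) ` {0..T}) \<noteq> 0" by simp
    qed
  qed
qed

end

section \<open>Kernel bounds for the increments of Y and D\<close>

text \<open>Lowers the decay exponent: for \<open>v \<ge> 1\<close> the stronger decay
  \<open>v powr - d\<close> is available, and for \<open>v < 1\<close> the left side is at most 1
  while the right side is at least 1.\<close>

lemma one_plus_powr_le:
  fixes v p d :: real
  assumes "0 < v" "0 \<le> p" "p \<le> d"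
  shows "(1 + 2 * v\<^sup>2) powr (- d / 2) \<le> v powr - p"
proof (cases "1 \<le> v")
  case True
  have "(1 + 2 * v\<^sup>2) powr (- d / 2) \<le> (v\<^sup>2) powr (- d / 2)"
    using assms by (intro powr_mono2') auto
  also have "\<dots> = v powr - d" using assms by (simp add: powr_powr flip: powr_numeral)
  also have "\<dots> \<le> v powr - p" using True assms by (intro powr_mono) auto
  finally show ?thesis .
next
  case False
  have "(1 + 2 * v\<^sup>2) powr (- d / 2) \<le> (1 + 2 * v\<^sup>2) powr 0"
    using assms by (intro powr_mono) auto
  also have "\<dots> \<le> 1" by (simp add: add_pos_nonneg)
  also have "1 \<le> v powr - p" 
  proof -
    have "v powr p \<le> 1" using False assms by (intro powr_le1) auto
    then show ?thesis using assms by (simp add: powr_minus one_le_inverse_iff)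
  qed
  finally show ?thesis .
qed

lemma exp_neg_le_powr:
  fixes v q :: real
  assumes "0 < v" "0 < q" "q \<le> 1"
  shows "exp (- v) \<le> v powr - q"
proof -
  have "v powr q \<le> exp v"
  proof (cases "1 \<le> v")
    case True
    then have "v powr q \<le> v powr 1" using assms by (intro powr_mono) auto
    also have "\<dots> = v" using assms by simp
    also have "v \<le> exp v" using exp_ge_add_one_self[of v] by linarith
    finally show ?thesis .
  next
    case False
    then have "v powr q \<le> 1" using assms by (intro powr_le1) auto
    also have "1 \<le> exp v" using assms by simp
    finally show ?thesis .
  qed
  then show ?thesis using assms by (simp add: exp_minus powr_minus le_imp_inverse_le)
qed

lemma dist_le_fst_snd_square: "(dist x y)\<^sup>2 = (dist (fst x) (fst y))\<^sup>2 + (dist (snd x) (snd y))\<^sup>2"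
  by (cases x, cases y) (simp add: dist_Pair_Pair)

context prob_space
begin

lemma fbm_vec_measurable:
  fixes Y :: "real \<Rightarrow> 'a \<Rightarrow> real ^ 'n"
  assumes "fractional_brownian_motion H Y" "0 \<le> t"
  shows "random_variable borel (Y t)"
  using borel_measurable_euclidean_space[of "Y t" M] fbm_measurable[OF assms]
  by (auto simp: Basis_vec_def inner_axis)

lemma fbm_AE_right_continuous:
  assumes "fractional_brownian_motion H Y"
  shows "AE \<omega> in M. \<forall>x\<ge>0. ((\<lambda>x. Y x \<omega>) \<longlongrightarrow> Y x \<omega>) (at_right x)"
proof -
  have "AE \<omega> in M. continuous_on {0..} (\<lambda>t. Y t \<omega>)"
    using assms unfolding fractional_brownian_motion_def by blast
  then show ?thesis
  proof eventually_elim
    case (elim \<omega>)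
    show ?case
    proof (intro allI impI)
      fix x :: real assume x: "0 \<le> x"
      have "((\<lambda>x. Y x \<omega>) \<longlongrightarrow> Y x \<omega>) (at x within {0..})"
        using elim x unfolding continuous_on_def by auto
      then show "((\<lambda>x. Y x \<omega>) \<longlongrightarrow> Y x \<omega>) (at_right x)"
        by (rule tendsto_within_subset) (use x in auto)
    qed
  qed
qed

text \<open>The quantity \<open>v\<close> compares the standard deviation of the increment with the
  kernel width \<open>2 powr - n\<close>. The exponent \<open>p\<close> is free: the range takes
  \<open>p < 1 / H\<close> to keep the time singularity integrable, the graph with
  \<open>H d < 1\<close> takes \<open>p = d\<close>.\<close>

lemma fbm_increment_kernel_bound:
  fixes Y :: "real \<Rightarrow> 'a \<Rightarrow> real ^ 'n"
  assumes Y: "fractional_brownian_motion H Y" and xy: "0 \<le> x" "x < y" and p: "0 \<le> p" "p \<le> real CARD('n)"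
  shows "(\<integral>\<^sup>+\<omega>. ennreal (exp (- (4 ^ n) * (dist (Y x \<omega>) (Y y \<omega>))\<^sup>2)) \<partial>M) \<le>
    ennreal (2 powr - (real n * p) * (y - x) powr - (H * p))"
proof -
  define v where "v = 2 ^ n * (y - x) powr H"
  have v: "0 < v" using xy by (simp add: v_def)
  have v2: "4 ^ n * (y - x) powr (2 * H) = v\<^sup>2"
  proof -
    have "(4::real) ^ n = (2 ^ n)\<^sup>2" by (simp add: power2_eq_square flip: power_mult_distrib)
    then show ?thesis
      by (simp add: v_def power_mult_distrib) (simp add: power2_eq_square powr_add[symmetric])
  qed
  have "(\<integral>\<^sup>+\<omega>. ennreal (exp (- (4 ^ n) * (dist (Y x \<omega>) (Y y \<omega>))\<^sup>2)) \<partial>M) =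
      ennreal ((1 + 2 * 4 ^ n * \<bar>x - y\<bar> powr (2 * H)) powr (- real CARD('n) / 2))"
    by (rule fbm_increment_exp_norm_square[OF Y]) (use xy in auto)
  also have "1 + 2 * 4 ^ n * \<bar>x - y\<bar> powr (2 * H) = 1 + 2 * v\<^sup>2"
    using xy v2 by (simp add: abs_minus_commute[of x y] mult.assoc)
  also have "ennreal ((1 + 2 * v\<^sup>2) powr (- real CARD('n) / 2)) \<le> ennreal (v powr - p)"
    by (intro ennreal_leI one_plus_powr_le v p)
  also have "v powr - p = 2 powr - (real n * p) * (y - x) powr - (H * p)"
    using xy by (simp add: v_def powr_mult powr_powr powr_realpow[symmetric])
  finally show ?thesis .
qed

lemma AE_fbm_image_hausdorff_measure:
  fixes Y :: "real \<Rightarrow> 'a \<Rightarrow> real ^ 'n"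
  assumes Y: "fractional_brownian_motion H Y" and H: "0 < H" and s: "0 \<le> s" "s < min (real CARD('n)) (1 / H)"
  shows "AE \<omega> in M. \<forall>T. 0 < T \<and> T \<le> 1 \<longrightarrow> hausdorff_measure s ((\<lambda>x. Y x \<omega>) ` {0..T}) \<noteq> 0"
proof -
  \<comment> \<open>A point strictly between: \<open>s < p\<close> gives convergence over the scales
    and \<open>p < 1 / H\<close> gives \<open>H * p < 1\<close>.\<close>
  define p where "p = (s + min (real CARD('n)) (1 / H)) / 2"
  have p: "s < p" "p < real CARD('n)" "p < 1 / H" using s by (auto simp: p_def min_def field_simps)
  show ?thesis
  proof (rule AE_hausdorff_measure_image_nonzero)
    show "random_variable borel (Y x)" if "0 \<le> x" for x by (rule fbm_vec_measurable[OF Y that])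
    show "AE \<omega> in M. \<forall>x\<ge>0. ((\<lambda>x. Y x \<omega>) \<longlongrightarrow> Y x \<omega>) (at_right x)" by (rule fbm_AE_right_continuous[OF Y])
    show "0 \<le> s" "s < p" by (fact s p)+
    show "H * p < 1" using p H by (simp add: field_simps)
    show "(0::real) \<le> 1" by simp
    show "(\<integral>\<^sup>+\<omega>. ennreal (exp (- (4 ^ n) * (dist (Y x \<omega>) (Y y \<omega>))\<^sup>2)) \<partial>M) \<le>
        ennreal (1 * 2 powr - (real n * p) * (y - x) powr - (H * p))"
      if "0 \<le> x" "x < y" "y \<le> 1" for n x y
      using fbm_increment_kernel_bound[OF Y that(1,2), of p n] p s by simp
  qed
qed

text \<open>The two paths may take values in different types, so independence is first passed on to
  the real variables \<open>u\<close> and \<open>v\<close> of the paths, whose preimages lie in the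
  path sigma-algebras.\<close>

lemma indep_processes_expectation_mult:
  fixes Y :: "real \<Rightarrow> 'a \<Rightarrow> 'b::topological_space" and D :: "real \<Rightarrow> 'a \<Rightarrow> 'c::topological_space"
  assumes ind: "indep_processes Y D"
    and u: "u \<in> borel_measurable path_space" "\<And>f. 0 \<le> u f \<and> u f \<le> (1::real)"
    and v: "v \<in> borel_measurable path_space" "\<And>f. 0 \<le> v f \<and> v f \<le> (1::real)"
  shows "expectation (\<lambda>\<omega>. u (process_path Y \<omega>) * v (process_path D \<omega>)) =
    expectation (\<lambda>\<omega>. u (process_path Y \<omega>)) * expectation (\<lambda>\<omega>. v (process_path D \<omega>))"
proof -
  have mY: "random_variable path_space (process_path Y)" and mD: "random_variable path_space (process_path D)"
    and iset: "indep_set {process_path Y -` A \<inter> space M | A. A \<in> sets path_space}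
               {process_path D -` A \<inter> space M | A. A \<in> sets path_space}"
    using ind unfolding indep_processes_def by auto
  define U where "U \<omega> = u (process_path Y \<omega>)" for \<omega>
  define V where "V \<omega> = v (process_path D \<omega>)" for \<omega>
  have [measurable]: "random_variable borel U" unfolding U_def by (rule measurable_compose[OF mY u(1)])
  have [measurable]: "random_variable borel V" unfolding V_def by (rule measurable_compose[OF mD v(1)])
  have sub: "\<exists>B. W -` A \<inter> space M = Z -` B \<inter> space M \<and> B \<in> sets N"
    if "A \<in> sets borel" "w \<in> borel_measurable N" "Z \<in> measurable M N" "W = (\<lambda>\<omega>. w (Z \<omega>))"
    for A w and Z :: "'a \<Rightarrow> 'd" and N :: "'d measure" and W :: "'a \<Rightarrow> real"
    using that measurable_space[OF that(3)]
    by (intro exI[of _ "w -` A \<inter> space N"]) (auto intro: measurable_sets)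
  have "{U -` A \<inter> space M | A. A \<in> sets borel} \<subseteq> {process_path Y -` A \<inter> space M | A. A \<in> sets path_space}"
    using sub[OF _ u(1) mY, of _ U] unfolding U_def[abs_def] by blast
  moreover have "{V -` A \<inter> space M | A. A \<in> sets borel} \<subseteq> {process_path D -` A \<inter> space M | A. A \<in> sets path_space}"
    using sub[OF _ v(1) mD, of _ V] unfolding V_def[abs_def] by blast
  ultimately have "indep_set {U -` A \<inter> space M | A. A \<in> sets borel} {V -` A \<inter> space M | A. A \<in> sets borel}"
    using iset unfolding indep_sets2_eq by (meson subset_iff)
  then have "indep_set (sigma_sets (space M) {U -` A \<inter> space M | A. A \<in> sets borel})
      (sigma_sets (space M) {V -` A \<inter> space M | A. A \<in> sets borel})"
  proof (rule indep_set_sigma_sets)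
    have "Int_stable {W -` A \<inter> space M | A. A \<in> sets borel}" for W :: "'a \<Rightarrow> real"
      unfolding Int_stable_def by (safe, rule_tac x = "A \<inter> Aa" in exI, auto)
    then show "Int_stable {U -` A \<inter> space M | A. A \<in> sets borel}" "Int_stable {V -` A \<inter> space M | A. A \<in> sets borel}"
      by blast+
  qed
  then have "indep_var borel U borel V" by (simp add: indep_var_eq)
  moreover have "integrable M U" "integrable M V"
    using u(2) v(2) by (auto intro!: integrable_const_bound[where B = 1] simp: U_def V_def)
  ultimately have "expectation (\<lambda>\<omega>. U \<omega> * V \<omega>) = expectation U * expectation V"
    by (rule indep_var_lebesgue_integral)
  then show ?thesis by (simp add: U_def[abs_def] V_def[abs_def])
qed

text \<open>The inequality \<open>- a^2 \<le> 1 - a\<close> replaces the Gaussian by an exponential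
  at the cost of \<open>exp 1\<close>, after which the Laplace transform of the increment at
  \<open>2 ^ n\<close> is explicit.\<close>

lemma subordinator_increment_kernel_bound:
  assumes D: "stable_subordinator \<beta> D" and c: "0 < c"
    and lap: "\<And>h l. 0 \<le> h \<Longrightarrow> 0 \<le> l \<Longrightarrow> expectation (\<lambda>\<omega>. exp (- l * D h \<omega>)) = exp (- c * h * l powr \<beta>)"
    and xy: "0 \<le> x" "x < y" and q: "0 < q" "q \<le> 1"
  shows "expectation (\<lambda>\<omega>. exp (- (4 ^ n) * (dist (D x \<omega>) (D y \<omega>))\<^sup>2)) \<le>
    exp 1 * c powr - q * 2 powr - (real n * (\<beta> * q)) * (y - x) powr - q"
proof -
  have [measurable]: "random_variable borel (D x)" "random_variable borel (D y)" "random_variable borel (D (y - x))"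
    using subordinator_measurable[OF D] xy by auto
  have pos: "AE \<omega> in M. 0 \<le> D y \<omega> - D x \<omega>"
    using subordinator_AE_nonneg[OF D, of x y] xy by (auto elim: eventually_mono)
  define v where "v = c * (y - x) * (2 ^ n) powr \<beta>"
  have v: "0 < v" using c xy by (simp add: v_def)
  have "expectation (\<lambda>\<omega>. exp (- (4 ^ n) * (dist (D x \<omega>) (D y \<omega>))\<^sup>2)) \<le>
      expectation (\<lambda>\<omega>. exp 1 * exp (- (2 ^ n) * (D y \<omega> - D x \<omega>)))"
  proof (rule integral_mono)
    show "integrable M (\<lambda>\<omega>. exp (- (4 ^ n) * (dist (D x \<omega>) (D y \<omega>))\<^sup>2))"
      by (rule integrable_const_bound[where B = 1]) auto
    have "integrable M (\<lambda>\<omega>. exp (- (2 ^ n) * (D y \<omega> - D x \<omega>)))"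
      by (rule integrable_exp_neg) (use pos in auto)
    then show "integrable M (\<lambda>\<omega>. exp 1 * exp (- (2 ^ n) * (D y \<omega> - D x \<omega>)))" by simp
    fix \<omega>
    define a where "a = 2 ^ n * (D y \<omega> - D x \<omega>)"
    have "(4::real) ^ n = (2 ^ n)\<^sup>2" by (simp add: power2_eq_square flip: power_mult_distrib)
    then have a2: "(4 ^ n) * (dist (D x \<omega>) (D y \<omega>))\<^sup>2 = a\<^sup>2"
      by (simp add: a_def dist_real_def power_mult_distrib power2_commute)
    have "0 \<le> (a - 1/2)\<^sup>2" by simp
    then have "- a\<^sup>2 \<le> 1 - a" by (simp add: power2_eq_square algebra_simps)
    then show "exp (- (4 ^ n) * (dist (D x \<omega>) (D y \<omega>))\<^sup>2) \<le> exp 1 * exp (- (2 ^ n) * (D y \<omega> - D x \<omega>))"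
      using a2 by (simp add: exp_add[symmetric] a_def)
  qed
  also have "\<dots> = exp 1 * (\<integral>z. exp (- (2 ^ n) * z) \<partial>distr M borel (\<lambda>\<omega>. D (x + (y - x)) \<omega> - D x \<omega>))"
    by (subst integral_distr) auto
  also have "\<dots> = exp 1 * expectation (\<lambda>\<omega>. exp (- (2 ^ n) * D (y - x) \<omega>))"
    using xy by (subst subordinator_stationary[OF D], simp, simp, subst integral_distr) auto
  also have "\<dots> = exp 1 * exp (- v)"
    using lap[of "y - x" "2 ^ n"] xy by (simp add: v_def)
  also have "\<dots> \<le> exp 1 * v powr - q" by (intro mult_left_mono exp_neg_le_powr v q) simp
  also have "v powr - q = c powr - q * 2 powr - (real n * (\<beta> * q)) * (y - x) powr - q"
    using c xy by (simp add: v_def powr_mult powr_powr powr_realpow[symmetric] mult.assoc)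
  finally show ?thesis by simp
qed

text \<open>The kernel factorises into a part from \<open>Y\<close> with exponents \<open>d\<close>
  in scale and \<open>H d\<close> in time, and a part from \<open>D\<close> with exponents
  \<open>\<beta> q\<close> and \<open>q\<close>. Integrability asks for \<open>H d + q < 1\<close>;
  as \<open>q\<close> tends to \<open>1 - H d\<close>, the scale exponent
  \<open>d + \<beta> q\<close> tends to \<open>\<beta> + (1 - H \<beta>) d\<close>.\<close>

lemma AE_graph_image_hausdorff_measure:
  fixes Y :: "real \<Rightarrow> 'a \<Rightarrow> real ^ 'n"
  assumes Y: "fractional_brownian_motion H Y" and D: "stable_subordinator \<beta> D" and ind: "indep_processes Y D"
    and H: "0 < H" "H * real CARD('n) < 1" and \<beta>: "0 < \<beta>"
    and s: "0 \<le> s" "s < \<beta> + (1 - H * \<beta>) * real CARD('n)"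
  shows "AE \<omega> in M. \<forall>T. 0 < T \<and> T \<le> 1 \<longrightarrow> hausdorff_measure s ((\<lambda>x. (D x \<omega>, Y x \<omega>)) ` {0..T}) \<noteq> 0"
proof -
  define d where "d = real CARD('n)"
  have d: "0 < d" by (simp add: d_def)
  obtain c where c: "0 < c" and lap: "\<And>h l. 0 \<le> h \<Longrightarrow> 0 \<le> l \<Longrightarrow>
    expectation (\<lambda>\<omega>. exp (- l * D h \<omega>)) = exp (- c * h * l powr \<beta>)"
    using stable_subordinator_laplace[OF D \<beta>] by blast
  \<comment> \<open>The least nonnegative \<open>q\<close> with
    \<open>s \<le> d + \<beta> * q\<close>; the midpoint between it and \<open>1 - H * d\<close>
    then satisfies both constraints strictly.\<close>
  define q0 where "q0 = max 0 ((s - d) / \<beta>)"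
  have "(s - d) / \<beta> < 1 - H * d"
  proof -
    have "s - d < (1 - H * d) * \<beta>" using s unfolding d_def[symmetric] by (simp add: algebra_simps)
    then show ?thesis using \<beta> by (simp only: pos_divide_less_eq)
  qed
  then have q0: "q0 < 1 - H * d" "0 \<le> q0" "s \<le> d + \<beta> * q0"
    using H \<beta> by (auto simp: q0_def d_def max_def field_simps)
  define q where "q = (q0 + (1 - H * d)) / 2"
  have q: "q0 < q" "0 < q" "q < 1 - H * d" using q0 by (auto simp: q_def)
  have q1: "q \<le> 1" using q H d by (smt (verit) mult_pos_pos)
  have sq: "s < d + \<beta> * q" using q0 q \<beta> by (smt (verit) mult_strict_left_mono)
  define C where "C = exp 1 * c powr - q"
  have C: "0 \<le> C" by (simp add: C_def)
  show ?thesis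
  proof (rule AE_hausdorff_measure_image_nonzero[where f = "\<lambda>x \<omega>. (D x \<omega>, Y x \<omega>)"])
    show "random_variable borel (\<lambda>\<omega>. (D x \<omega>, Y x \<omega>))" if "0 \<le> x" for x
      using fbm_vec_measurable[OF Y that] subordinator_measurable[OF D that] by (rule borel_measurable_Pair[rotated])
    show "AE \<omega> in M. \<forall>x\<ge>0. ((\<lambda>x. (D x \<omega>, Y x \<omega>)) \<longlongrightarrow> (D x \<omega>, Y x \<omega>)) (at_right x)"
      using fbm_AE_right_continuous[OF Y] subordinator_AE_regular[OF D \<beta>]
      by eventually_elim (auto intro!: tendsto_Pair)
    show "0 \<le> s" "s < d + \<beta> * q" by (fact s sq)+
    show "H * d + q < 1" using q by simp
    show "0 \<le> C" by fact
    fix n :: nat and x y :: real assume xy: "0 \<le> x" "x < y" "y \<le> 1"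
    define u where "u f = exp (- (4 ^ n) * (dist (f x) (f y))\<^sup>2)" for f :: "real \<Rightarrow> real ^ 'n"
    define v where "v f = exp (- (4 ^ n) * (dist (f x) (f y))\<^sup>2)" for f :: "real \<Rightarrow> real"
    have [measurable]: "random_variable borel (Y x)" "random_variable borel (Y y)" 
      "random_variable borel (D x)" "random_variable borel (D y)"
      using fbm_vec_measurable[OF Y] subordinator_measurable[OF D] xy by auto
    have mult: "expectation (\<lambda>\<omega>. u (process_path Y \<omega>) * v (process_path D \<omega>)) =
      expectation (\<lambda>\<omega>. u (process_path Y \<omega>)) * expectation (\<lambda>\<omega>. v (process_path D \<omega>))"
    proof (rule indep_processes_expectation_mult[OF ind])
      have "(\<lambda>f. f x) \<in> borel_measurable (path_space :: (real \<Rightarrow> real ^ 'n) measure)"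
        "(\<lambda>f. f y) \<in> borel_measurable (path_space :: (real \<Rightarrow> real ^ 'n) measure)"
        "(\<lambda>f. f x) \<in> borel_measurable (path_space :: (real \<Rightarrow> real) measure)"
        "(\<lambda>f. f y) \<in> borel_measurable (path_space :: (real \<Rightarrow> real) measure)"
        using xy by (auto intro: measurable_component_singleton)
      then show "u \<in> borel_measurable path_space" "v \<in> borel_measurable path_space"
        unfolding u_def[abs_def] v_def[abs_def] by measurable
    qed (auto simp: u_def v_def)
    have pY: "u (process_path Y \<omega>) = exp (- (4 ^ n) * (dist (Y x \<omega>) (Y y \<omega>))\<^sup>2)" for \<omega>
      using xy by (simp add: u_def process_path_def)
    have pD: "v (process_path D \<omega>) = exp (- (4 ^ n) * (dist (D x \<omega>) (D y \<omega>))\<^sup>2)" for \<omega>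
      using xy by (simp add: v_def process_path_def)
    have EY: "expectation (\<lambda>\<omega>. u (process_path Y \<omega>)) \<le> 2 powr - (real n * d) * (y - x) powr - (H * d)"
    proof -
      have "ennreal (expectation (\<lambda>\<omega>. u (process_path Y \<omega>))) = (\<integral>\<^sup>+\<omega>. ennreal (u (process_path Y \<omega>)) \<partial>M)"
        unfolding pY by (rule nn_integral_eq_integral[symmetric]) (auto intro!: integrable_const_bound[where B = 1])
      also have "\<dots> \<le> ennreal (2 powr - (real n * d) * (y - x) powr - (H * d))"
        unfolding pY using fbm_increment_kernel_bound[OF Y xy(1,2), of d n] by (simp add: d_def)
      finally show ?thesis by (subst (asm) ennreal_le_iff) auto
    qed
    have ED: "expectation (\<lambda>\<omega>. v (process_path D \<omega>)) \<le> C * 2 powr - (real n * (\<beta> * q)) * (y - x) powr - q"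
      unfolding pD C_def by (rule subordinator_increment_kernel_bound[OF D c lap xy(1,2) q(2) q1])
    have "(\<integral>\<^sup>+\<omega>. ennreal (exp (- (4 ^ n) * (dist (D x \<omega>, Y x \<omega>) (D y \<omega>, Y y \<omega>))\<^sup>2)) \<partial>M) =
        (\<integral>\<^sup>+\<omega>. ennreal (u (process_path Y \<omega>) * v (process_path D \<omega>)) \<partial>M)"
      unfolding pY pD dist_le_fst_snd_square[of "(_, _)"]
      by (intro nn_integral_cong) (simp add: exp_add[symmetric] algebra_simps)
    also have "\<dots> = ennreal (expectation (\<lambda>\<omega>. u (process_path Y \<omega>) * v (process_path D \<omega>)))"
      unfolding pY pD by (rule nn_integral_eq_integral)
        (auto intro!: integrable_const_bound[where B = 1] AE_I2 mult_le_one simp: abs_mult)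
    also have "\<dots> \<le> ennreal ((2 powr - (real n * d) * (y - x) powr - (H * d)) *
        (C * 2 powr - (real n * (\<beta> * q)) * (y - x) powr - q))"
      unfolding mult using EY ED C by (intro ennreal_leI mult_mono) (auto simp: pY pD)
    also have "(2 powr - (real n * d) * (y - x) powr - (H * d)) * (C * 2 powr - (real n * (\<beta> * q)) * (y - x) powr - q) =
        C * 2 powr - (real n * (d + \<beta> * q)) * (y - x) powr - (H * d + q)"
      by (simp add: powr_add powr_diff powr_minus distrib_left field_simps)
    finally show "(\<integral>\<^sup>+\<omega>. ennreal (exp (- (4 ^ n) * (dist (D x \<omega>, Y x \<omega>) (D y \<omega>, Y y \<omega>))\<^sup>2)) \<partial>M) \<le>
        ennreal (C * 2 powr - (real n * (d + \<beta> * q)) * (y - x) powr - (H * d + q))" .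
  qed
qed

end

section \<open>Covers of the graph\<close>

lemma dyadic_close:
  fixes u v :: real
  assumes "nat \<lfloor>u * 2 ^ k\<rfloor> = nat \<lfloor>v * 2 ^ k\<rfloor>" "0 \<le> u" "0 \<le> v"
  shows "\<bar>u - v\<bar> \<le> 2 powr - real k"
proof -
  have "real (nat \<lfloor>u * 2 ^ k\<rfloor>) / 2 ^ k \<le> u" "u < (real (nat \<lfloor>u * 2 ^ k\<rfloor>) + 1) / 2 ^ k"
    "real (nat \<lfloor>u * 2 ^ k\<rfloor>) / 2 ^ k \<le> v" "v < (real (nat \<lfloor>u * 2 ^ k\<rfloor>) + 1) / 2 ^ k"
    using floor_dyadic_bounds[of u k] floor_dyadic_bounds[of v k] assms by auto
  then have "\<bar>u - v\<bar> \<le> 1 / 2 ^ k" by (simp only: add_divide_distrib abs_le_iff) linarith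
  then show ?thesis by (simp add: powr_minus powr_realpow inverse_eq_divide)
qed

lemma nat_floor_dyadic_le:
  fixes t :: real
  assumes "0 \<le> t" "t \<le> 1"
  shows "nat \<lfloor>t * 2 ^ m\<rfloor> \<le> 2 ^ m"
proof -
  have "t * 2 ^ m \<le> 2 ^ m" using assms by (simp add: mult_left_le_one_le)
  then have "\<lfloor>t * 2 ^ m\<rfloor> \<le> \<lfloor>real (2 ^ m)\<rfloor>" by (intro floor_mono) simp
  then show ?thesis unfolding floor_of_nat by (simp add: nat_le_iff)
qed

lemma covered_by_single:
  assumes "\<And>x y. x \<in> A \<Longrightarrow> y \<in> A \<Longrightarrow> dist x y \<le> r"
  shows "covered_by A 1 r"
  unfolding covered_by_def by (rule exI[of _ "{A}"]) (use assms in auto)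

lemma covered_by_fibres:
  assumes fin: "finite I" and ind: "\<And>x. x \<in> A \<Longrightarrow> g x \<in> I"
    and close: "\<And>x y. x \<in> A \<Longrightarrow> y \<in> A \<Longrightarrow> g x = g y \<Longrightarrow> dist x y \<le> r"
  shows "covered_by A (real (card I)) r"
proof -
  have "covered_by (\<Union>i\<in>I. {x \<in> A. g x = i}) (\<Sum>i\<in>I. 1) r"
    by (rule covered_by_Union[OF fin], rule covered_by_single) (use close in auto)
  then show ?thesis by (rule covered_by_mono) (use ind in auto)
qed

text \<open>For the finitely many coarse scales the cover of scale \<open>m0\<close> is reused, and
  its extra cardinality is absorbed by enlarging the constant by
  \<open>2 powr (m0 * s)\<close>.\<close>

lemma box_counting_leI:
  assumes "0 < C" "0 \<le> s" and ev: "\<And>m. m0 \<le> m \<Longrightarrow> covered_by A (C * 2 powr (real m * s)) (C * 2 powr - real m)"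
  shows "box_counting_le A s"
  unfolding box_counting_le_def
proof (intro exI conjI allI)
  have ge: "1 \<le> 2 powr (real m0 * s)" using assms by (intro ge_one_powr_ge_zero) auto
  show "0 < C * 2 powr (real m0 * s)" using assms by simp
  fix m :: nat
  show "covered_by A (C * 2 powr (real m0 * s) * 2 powr (real m * s)) (C * 2 powr (real m0 * s) * 2 powr - real m)"
  proof (rule covered_by_mono[OF ev[of "max m m0"] order_refl])
    show "C * 2 powr (real (max m m0) * s) \<le> C * 2 powr (real m0 * s) * 2 powr (real m * s)"
    proof -
      have "real (max m m0) * s \<le> (real m0 + real m) * s" using assms by (intro mult_right_mono) auto
      then have "2 powr (real (max m m0) * s) \<le> 2 powr (real m0 * s) * 2 powr (real m * s)"
        by (simp add: powr_add[symmetric] distrib_right)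
      then show ?thesis using assms by (simp add: mult.assoc)
    qed
    have "2 powr - real (max m m0) \<le> 1 * 2 powr - real m" by simp
    also have "\<dots> \<le> 2 powr (real m0 * s) * 2 powr - real m" using ge by (intro mult_right_mono) auto
    finally show "C * 2 powr - real (max m m0) \<le> C * 2 powr (real m0 * s) * 2 powr - real m"
      using assms by (simp add: mult.assoc)
  qed simp
qed

lemma box_counting_le_mono:
  assumes "box_counting_le A s" "s \<le> t"
  shows "box_counting_le A t"
proof -
  obtain C where C: "0 < C" "\<And>m::nat. covered_by A (C * 2 powr (real m * s)) (C * 2 powr - real m)"
    using assms(1) unfolding box_counting_le_def by blast
  have "covered_by A (C * 2 powr (real m * t)) (C * 2 powr - real m)" for m
    by (rule covered_by_mono[OF C(2)[of m]]) (use C(1) assms(2) in \<open>auto intro: mult_left_mono\<close>)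
  then show ?thesis using C(1) unfolding box_counting_le_def by blast
qed

lemma box_counting_le_image:
  assumes "box_counting_le A s" "\<And>x y. dist (f x) (f y) \<le> dist x y"
  shows "box_counting_le (f ` A) s"
  using assms covered_by_image unfolding box_counting_le_def by meson

text \<open>The sets are grid cubes of side \<open>\<epsilon>\<close>, indexed by integer parts
  relative to \<open>a\<close>; the dimension factor in the size comes from bounding the norm by the
  sum of the coordinates.\<close>

lemma covered_by_cubes:
  fixes V :: "(real ^ 'n) set"
  assumes V: "\<And>v i. v \<in> V \<Longrightarrow> \<bar>v $ i - a $ i\<bar> \<le> \<rho>" and e: "0 < \<epsilon>" and \<rho>: "0 \<le> \<rho>"
  shows "covered_by V ((2 * \<rho> / \<epsilon> + 2) ^ CARD('n)) (real CARD('n) * \<epsilon>)"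
proof -
  define g where "g v = (\<lambda>i. \<lfloor>(v $ i - a $ i) / \<epsilon>\<rfloor>)" for v :: "real ^ 'n"
  define S where "S = {\<lfloor>- (\<rho> / \<epsilon>)\<rfloor>..\<lfloor>\<rho> / \<epsilon>\<rfloor>}"
  define I where "I = (PiE UNIV (\<lambda>_. S) :: ('n \<Rightarrow> int) set)"
  have "covered_by V (real (card I)) (real CARD('n) * \<epsilon>)"
  proof (rule covered_by_fibres)
    show "finite I" unfolding I_def S_def by (intro finite_PiE) auto
    fix v assume v: "v \<in> V"
    have "g v i \<in> S" for i
    proof -
      have "- \<rho> \<le> v $ i - a $ i" "v $ i - a $ i \<le> \<rho>" using V[OF v, of i] by auto
      then have "- \<rho> / \<epsilon> \<le> (v $ i - a $ i) / \<epsilon>" "(v $ i - a $ i) / \<epsilon> \<le> \<rho> / \<epsilon>"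
        using e by (auto intro!: divide_right_mono simp del: divide_minus_left)
      then have "- (\<rho> / \<epsilon>) \<le> (v $ i - a $ i) / \<epsilon>" "(v $ i - a $ i) / \<epsilon> \<le> \<rho> / \<epsilon>" by simp_all
      then show ?thesis unfolding g_def S_def by (auto intro: floor_mono)
    qed
    then show "g v \<in> I" unfolding I_def by (auto simp: PiE_UNIV_domain)
  next
    fix v w assume eq: "g v = g w"
    have "\<bar>(v - w) $ i\<bar> \<le> \<epsilon>" for i
    proof -
      have "\<lfloor>(v $ i - a $ i) / \<epsilon>\<rfloor> = \<lfloor>(w $ i - a $ i) / \<epsilon>\<rfloor>" using eq unfolding g_def by meson
      then have "\<bar>(v $ i - a $ i) / \<epsilon> - (w $ i - a $ i) / \<epsilon>\<bar> \<le> 1" by linarith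
      moreover have "(v $ i - a $ i) / \<epsilon> - (w $ i - a $ i) / \<epsilon> = (v - w) $ i / \<epsilon>" by (simp add: diff_divide_distrib)
      ultimately show ?thesis using e by (simp add: abs_divide)
    qed
    then have "(\<Sum>i\<in>UNIV. \<bar>(v - w) $ i\<bar>) \<le> (\<Sum>i\<in>(UNIV :: 'n set). \<epsilon>)" by (rule sum_mono)
    then show "dist v w \<le> real CARD('n) * \<epsilon>"
      using norm_le_l1_cart[of "v - w"] by (simp add: dist_norm)
  qed
  then show ?thesis
  proof (rule covered_by_mono)
    have r: "0 \<le> \<rho> / \<epsilon>" using e \<rho> by simp
    have "real (nat (\<lfloor>x\<rfloor> - \<lfloor>- x\<rfloor> + 1)) \<le> 2 * x + 2" if "0 \<le> x" for x :: real using that by linarith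
    from this[OF r] have "real (card S) \<le> 2 * \<rho> / \<epsilon> + 2" unfolding S_def card_atLeastAtMost_int by simp
    then have "real (card S) ^ CARD('n) \<le> (2 * \<rho> / \<epsilon> + 2) ^ CARD('n)" by (intro power_mono) auto
    then show "real (card I) \<le> (2 * \<rho> / \<epsilon> + 2) ^ CARD('n)"
      unfolding I_def by (simp add: card_PiE)
  qed auto
qed

lemma covered_by_snd:
  fixes A :: "('a::metric_space \<times> 'b::metric_space) set"
  assumes "covered_by (snd ` A) N r" "\<And>x y. x \<in> A \<Longrightarrow> y \<in> A \<Longrightarrow> dist (fst x) (fst y) \<le> \<epsilon>"
  shows "covered_by A N (\<epsilon> + r)"
proof -
  obtain V where V: "finite V" "snd ` A \<subseteq> \<Union>V" "real (card V) \<le> N" "\<forall>U\<in>V. \<forall>x\<in>U. \<forall>y\<in>U. dist x y \<le> r"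
    using assms(1) unfolding covered_by_def by blast
  define W where "W = (\<lambda>U. {x \<in> A. snd x \<in> U}) ` V"
  have "real (card W) \<le> N" using card_image_le[OF V(1), of "\<lambda>U. {x \<in> A. snd x \<in> U}"] V(3) unfolding W_def by linarith
  moreover have "A \<subseteq> \<Union>W" using V(2) unfolding W_def by auto
  moreover have "\<forall>U\<in>W. \<forall>x\<in>U. \<forall>y\<in>U. dist x y \<le> \<epsilon> + r"
  proof (intro ballI)
    fix U x y assume U: "U \<in> W" "x \<in> U" "y \<in> U"
    then obtain U' where U': "U' \<in> V" "x \<in> A" "y \<in> A" "snd x \<in> U'" "snd y \<in> U'" unfolding W_def by blast
    have "dist x y \<le> dist (fst x) (fst y) + dist (snd x) (snd y)"
      unfolding dist_prod_def by (rule sqrt_sum_squares_le_sum) auto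
    moreover have "dist (snd x) (snd y) \<le> r" using V(4) U' by blast
    ultimately show "dist x y \<le> \<epsilon> + r" using assms(2)[of x y] U' by linarith
  qed
  ultimately show ?thesis unfolding covered_by_def using V(1) by (intro exI[of _ W]) (auto simp: W_def)
qed

lemma bounded_box_counting_le:
  fixes A :: "(real ^ 'n) set"
  assumes "bounded A"
  shows "box_counting_le A (real CARD('n))"
proof -
  obtain R where R: "0 < R" "\<And>x. x \<in> A \<Longrightarrow> norm x \<le> R" using assms unfolding bounded_pos by blast
  define C where "C = (2 * R + 2) ^ CARD('n) + real CARD('n)"
  have "covered_by A (C * 2 powr (real m * real CARD('n))) (C * 2 powr - real m)" for m
  proof -
    have "covered_by A ((2 * R / 2 powr - real m + 2) ^ CARD('n)) (real CARD('n) * 2 powr - real m)"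
      by (rule covered_by_cubes[where a = 0]) (use R component_le_norm_cart in \<open>auto intro: order_trans\<close>)
    then show ?thesis
    proof (rule covered_by_mono)
      have "2 * R / 2 powr - real m + 2 \<le> (2 * R + 2) * 2 ^ m"
        using R by (simp add: powr_minus powr_realpow field_simps)
      then have "(2 * R / 2 powr - real m + 2) ^ CARD('n) \<le> ((2 * R + 2) * 2 ^ m) ^ CARD('n)"
        using R by (intro power_mono) auto
      also have "\<dots> = (2 * R + 2) ^ CARD('n) * 2 powr (real m * real CARD('n))"
        by (simp add: power_mult_distrib powr_realpow[symmetric] powr_powr)
      also have "\<dots> \<le> C * 2 powr (real m * real CARD('n))"
        by (intro mult_right_mono) (auto simp: C_def)
      finally show "(2 * R / 2 powr - real m + 2) ^ CARD('n) \<le> C * 2 powr (real m * real CARD('n))" .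
      show "real CARD('n) * 2 powr - real m \<le> C * 2 powr - real m"
        using R by (intro mult_right_mono) (auto simp: C_def)
    qed simp
  qed
  moreover have "0 < C" using R by (simp add: C_def add_pos_nonneg)
  ultimately show ?thesis unfolding box_counting_le_def by blast
qed

section \<open>Deterministic covers of the graph over an inverse path\<close>

text \<open>Only dyadic arguments are tested, which leaves countably many events per count; they
  suffice because any growth of the inverse passes over a dyadic point. The index
  \<open>2 ^ m\<close> is included for the endpoint \<open>t = 1\<close>.\<close>

definition hit_intervals :: "(real \<Rightarrow> real) \<Rightarrow> nat \<Rightarrow> nat \<Rightarrow> nat set" where
  "hit_intervals d K m = {j. j \<le> 2 ^ m \<and> (\<exists>l k. k \<le> K * 2 ^ l \<and> nat \<lfloor>d (real k / 2 ^ l) * 2 ^ m\<rfloor> = j)}"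

text \<open>Collects what is used of a single path of \<open>D\<close> and its inverse, free of
  probability. \<open>K\<close> is a time by which level 1 has been passed, so it bounds the inverse
  on \<open>[0, 1]\<close>.\<close>

locale inverse_path =
  fixes d e :: "real \<Rightarrow> real" and K :: nat
  assumes d0: "d 0 = 0" and strict: "strict_mono_on {0..} d" and dK: "1 < d (real K)"
    and e_def: "\<And>t. 0 \<le> t \<Longrightarrow> t \<le> 1 \<Longrightarrow> e t = Inf {x. 0 \<le> x \<and> t < d x}"
begin

lemma d_less: "0 \<le> x \<Longrightarrow> x < y \<Longrightarrow> d x < d y"
  using strict_mono_onD[OF strict, of x y] by auto

lemma d_mono: "0 \<le> x \<Longrightarrow> x \<le> y \<Longrightarrow> d x \<le> d y"
  using d_less[of x y] by (cases "x = y") auto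

lemma e_le: "0 \<le> t \<Longrightarrow> t \<le> 1 \<Longrightarrow> 0 \<le> x \<Longrightarrow> t < d x \<Longrightarrow> e t \<le> x"
  unfolding e_def by (intro cInf_lower bdd_belowI[of _ 0]) auto

lemma e_nonneg: "0 \<le> t \<Longrightarrow> t \<le> 1 \<Longrightarrow> 0 \<le> e t"
  unfolding e_def using dK by (intro cInf_greatest) (auto intro!: exI[of _ "real K"])

lemma e_le_K: "0 \<le> t \<Longrightarrow> t \<le> 1 \<Longrightarrow> e t \<le> real K"
  using dK by (intro e_le) auto

lemma e_less_imp: 
  assumes "0 \<le> t" "t \<le> 1" "e t < x" shows "t < d x"
proof -
  have ne: "{x. 0 \<le> x \<and> t < d x} \<noteq> {}" using dK assms by (auto intro!: exI[of _ "real K"])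
  obtain z where "0 \<le> z" "t < d z" "z < x"
    using cInf_lessD[OF ne, of x] assms unfolding e_def[OF assms(1,2)] by auto
  then show ?thesis using d_mono[of z x] by linarith
qed

lemma e_mono: 
  assumes "0 \<le> s" "s \<le> t" "t \<le> 1" shows "e s \<le> e t"
proof (rule dense_ge)
  fix x assume "e t < x"
  then show "e s \<le> x" using e_less_imp[of t x] e_nonneg[of t] assms by (intro e_le) auto
qed

text \<open>Strict increase of \<open>d\<close> excludes flat pieces, across which the inverse would
  jump. It is what places the points \<open>(d x, y x)\<close> on the graph of \<open>y\<close>
  composed with \<open>e\<close>.\<close>

lemma e_d: 
  assumes "0 \<le> x" "d x \<le> 1" shows "e (d x) = x"
proof (rule antisym)
  have dx: "0 \<le> d x" using d_mono[of 0 x] assms d0 by simp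
  show "e (d x) \<le> x"
  proof (rule dense_ge)
    fix z assume "x < z" then show "e (d x) \<le> z" using assms dx d_less[of x z] by (intro e_le) auto
  qed
  show "x \<le> e (d x)"
  proof (rule ccontr)
    assume "\<not> x \<le> e (d x)"
    then show False using e_less_imp[of "d x" x] assms dx by auto
  qed
qed

text \<open>Both \<open>\<lfloor>2\<^sup>m t\<rfloor>\<close> and \<open>\<lfloor>2\<^sup>n e t\<rfloor>\<close> are nondecreasing in \<open>t\<close>, so their sum determines both of them.\<close>

lemma graph_covered_by_staircase:
  fixes y :: "real \<Rightarrow> 'b::metric_space"
  assumes C: "0 < C" and \<gamma>: "0 < \<gamma>" "\<gamma> < 1"
    and hoelder: "\<And>s t. 0 \<le> s \<Longrightarrow> s < real K + 1 \<Longrightarrow> 0 \<le> t \<Longrightarrow> t < real K + 1 \<Longrightarrow>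
      \<bar>s - t\<bar> \<le> 2 powr - real n0 \<Longrightarrow> dist (y s) (y t) \<le> C * \<bar>s - t\<bar> powr \<gamma>"
    and m: "n0 \<le> m"
  shows "covered_by ((\<lambda>t. (t, y (e t))) ` {0..1})
    ((2 * real K + 2 + C) * 2 powr (real m * (1 / \<gamma>))) ((2 * real K + 2 + C) * 2 powr - real m)"
proof -
  \<comment> \<open>The spatial scale at which the Hoelder modulus drops to order
    \<open>2 powr - m\<close>: \<open>n * \<gamma> \<ge> m\<close>. Rounding up costs at most a
    factor 2 in the number of steps.\<close>
  define n where "n = nat \<lceil>real m / \<gamma>\<rceil>"
  have n: "real m / \<gamma> \<le> real n" "real n \<le> real m / \<gamma> + 1"
    using \<gamma> unfolding n_def by (auto simp: of_nat_ceiling)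
  have "real m \<le> real m / \<gamma>" using \<gamma> by (simp add: pos_le_divide_eq mult_left_le)
  then have mn: "m \<le> n" using n by linarith
  define a where "a t = nat \<lfloor>t * 2 ^ m\<rfloor>" for t :: real
  define b where "b t = nat \<lfloor>e t * 2 ^ n\<rfloor>" for t
  have mono: "a s \<le> a t" "b s \<le> b t" if "0 \<le> s" "s \<le> t" "t \<le> 1" for s t
    using e_mono[OF that] that unfolding a_def b_def by (auto intro!: nat_mono floor_mono mult_right_mono)
  have same: "a s = a t \<and> b s = b t" if "s \<in> {0..1}" "t \<in> {0..1}" "a s + b s = a t + b t" for s t
    using mono[of s t] mono[of t s] that by (cases "s \<le> t") auto
  have "covered_by ((\<lambda>t. (t, y (e t))) ` {0..1}) (real (card {..2 ^ m + K * 2 ^ n})) (2 powr - real m + C * 2 powr - real m)"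
  proof (rule covered_by_fibres[where g = "\<lambda>p. a (fst p) + b (fst p)"])
    fix p assume "p \<in> (\<lambda>t. (t, y (e t))) ` {0..1}"
    then obtain t where t: "t \<in> {0..1}" "p = (t, y (e t))" by blast
    have "a t \<le> 2 ^ m" unfolding a_def using t by (intro nat_floor_dyadic_le) auto
    moreover have "b t \<le> K * 2 ^ n"
    proof -
      have "\<lfloor>e t * 2 ^ n\<rfloor> \<le> \<lfloor>real (K * 2 ^ n)\<rfloor>"
        using t e_le_K[of t] by (intro floor_mono) simp
      then show ?thesis unfolding b_def floor_of_nat by linarith
    qed
    ultimately show "a (fst p) + b (fst p) \<in> {..2 ^ m + K * 2 ^ n}" using t by simp
  next
    fix p q assume "p \<in> (\<lambda>t. (t, y (e t))) ` {0..1}" "q \<in> (\<lambda>t. (t, y (e t))) ` {0..1}"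
      and eq: "a (fst p) + b (fst p) = a (fst q) + b (fst q)"
    then obtain s t where st: "s \<in> {0..1}" "p = (s, y (e s))" "t \<in> {0..1}" "q = (t, y (e t))" by blast
    then have ab: "a s = a t" "b s = b t" using same[of s t] eq by auto
    have 1: "\<bar>s - t\<bar> \<le> 2 powr - real m"
      using dyadic_close[of s m t] ab st unfolding a_def by simp
    have 2: "\<bar>e s - e t\<bar> \<le> 2 powr - real n"
      using dyadic_close[of "e s" n "e t"] ab st e_nonneg unfolding b_def by simp
    also have "\<dots> \<le> 2 powr - real n0" using mn m by simp
    finally have "dist (y (e s)) (y (e t)) \<le> C * \<bar>e s - e t\<bar> powr \<gamma>"
      using st e_nonneg e_le_K[of s] e_le_K[of t] by (intro hoelder) auto
    also have "\<dots> \<le> C * (2 powr - real n) powr \<gamma>"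
      using 2 C \<gamma> by (intro mult_left_mono powr_mono2) auto
    also have "\<dots> \<le> C * 2 powr - real m"
    proof -
      have "real m \<le> real n * \<gamma>" using n(1) \<gamma> by (simp add: field_simps)
      then show ?thesis using C by (simp add: powr_powr)
    qed
    finally have "dist (y (e s)) (y (e t)) \<le> C * 2 powr - real m" .
    moreover have "dist p q \<le> dist s t + dist (y (e s)) (y (e t))"
      unfolding st dist_prod_def fst_conv snd_conv by (rule sqrt_sum_squares_le_sum) auto
    ultimately show "dist p q \<le> 2 powr - real m + C * 2 powr - real m"
      using 1 by (simp add: dist_real_def)
  qed simp
  then show ?thesis
  proof (rule covered_by_mono)
    have "2 ^ m \<le> 2 powr (real m / \<gamma>)"
      using \<open>real m \<le> real m / \<gamma>\<close> by (simp add: powr_realpow[symmetric])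
    moreover have "2 ^ n \<le> 2 * 2 powr (real m / \<gamma>)"
    proof -
      have "2 powr real n \<le> 2 powr (real m / \<gamma> + 1)" using n by simp
      then show ?thesis by (simp add: powr_realpow powr_add mult.commute)
    qed
    then have "real K * 2 ^ n \<le> real K * (2 * 2 powr (real m / \<gamma>))" by (intro mult_left_mono) auto
    moreover have "1 \<le> 2 powr (real m / \<gamma>)" using \<gamma> by (intro ge_one_powr_ge_zero) auto
    moreover have "0 \<le> C * 2 powr (real m / \<gamma>)" using C by simp
    ultimately show "real (card {..2 ^ m + K * 2 ^ n}) \<le> (2 * real K + 2 + C) * 2 powr (real m * (1 / \<gamma>))"
      by (simp add: algebra_simps)
    show "2 powr - real m + C * 2 powr - real m \<le> (2 * real K + 2 + C) * 2 powr - real m"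
      by (simp add: algebra_simps)
  qed simp
qed

text \<open>If \<open>e s < e t\<close>, some dyadic \<open>x\<close> lies strictly between; the
  inverse relation gives \<open>s < d x \<le> t\<close>, so \<open>d\<close> visits the interval
  containing both times.\<close>

lemma e_const_if_not_hit:
  assumes s: "s \<in> {0..1}" and t: "t \<in> {0..1}" and j: "nat \<lfloor>s * 2 ^ m\<rfloor> = j" "nat \<lfloor>t * 2 ^ m\<rfloor> = j"
    and nh: "j \<notin> hit_intervals d K m"
  shows "e s = e t"
proof -
  have *: False if st: "s \<in> {0..1}" "t \<in> {0..1}" "nat \<lfloor>s * 2 ^ m\<rfloor> = j" "nat \<lfloor>t * 2 ^ m\<rfloor> = j" "e s < e t" for s t
  proof -
    have sl: "s \<le> t" using e_mono[of t s] st by (cases "s \<le> t") auto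
    obtain l where l: "(1/2) ^ l < e t - e s"
      using real_arch_pow_inv[of "e t - e s" "1/2"] st by auto
    define k where "k = Suc (nat \<lfloor>e s * 2 ^ l\<rfloor>)"
    define x where "x = real k / 2 ^ l"
    have es: "0 \<le> e s" "0 \<le> e t" "e t \<le> real K" using e_nonneg e_le_K st by auto
    have x: "e s < x" "x < e t"
      using floor_dyadic_bounds[OF es(1), of l] l by (auto simp: x_def k_def add_divide_distrib power_divide)
    have "x < real K" using x es by linarith
    then have "real k < real (K * 2 ^ l)" unfolding x_def by (simp add: pos_divide_less_eq)
    then have kK: "k \<le> K * 2 ^ l" by linarith
    have "s < d x" using e_less_imp[of s x] st x by auto
    moreover have "d x \<le> t" using e_le[of t x] st x es by (cases "t < d x") auto
    ultimately have "nat \<lfloor>s * 2 ^ m\<rfloor> \<le> nat \<lfloor>d x * 2 ^ m\<rfloor>" "nat \<lfloor>d x * 2 ^ m\<rfloor> \<le> nat \<lfloor>t * 2 ^ m\<rfloor>"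
      by (auto intro!: nat_mono floor_mono mult_right_mono)
    then have hj: "nat \<lfloor>d x * 2 ^ m\<rfloor> = j" using st by simp
    have "j \<le> 2 ^ m" using nat_floor_dyadic_le[of t m] st by simp
    then have "j \<in> hit_intervals d K m" unfolding hit_intervals_def using kK hj unfolding x_def by blast
    then show False using nh by blast
  qed
  show ?thesis using *[of s t] *[of t s] assms by (cases "e s < e t"; cases "e t < e s") auto
qed

text \<open>Over an interval that is not hit, \<open>e\<close> is constant and one set suffices.
  Over a hit interval the path stays within \<open>\<rho>\<close> of one of its values and needs
  about \<open>(\<rho> / \<epsilon>) ^ d\<close> cubes of side \<open>\<epsilon>\<close>. The sum is
  of order \<open>2 powr m + 2 powr (m * (b + d * (1 - b' * \<gamma>)))\<close>, and
  \<open>\<sigma> \<ge> 1\<close> absorbs the first summand; \<open>b' * \<gamma> < 1\<close>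
  absorbs the additive 2 in the cube count.\<close>

lemma graph_covered_by_hits:
  fixes y :: "real \<Rightarrow> real ^ 'n"
  assumes C: "0 < C" and \<gamma>: "0 < \<gamma>"
    and hoelder: "\<And>s t. 0 \<le> s \<Longrightarrow> s < real K + 1 \<Longrightarrow> 0 \<le> t \<Longrightarrow> t < real K + 1 \<Longrightarrow>
      \<bar>s - t\<bar> \<le> 2 powr - real n0 \<Longrightarrow> norm (y s - y t) \<le> C * \<bar>s - t\<bar> powr \<gamma>"
    and b': "0 < b'" "b' * \<gamma> < 1" and m: "real n0 \<le> real m * b'"
    and einc: "\<And>s t. s \<in> {0..1} \<Longrightarrow> t \<in> {0..1} \<Longrightarrow> nat \<lfloor>s * 2 ^ m\<rfloor> = nat \<lfloor>t * 2 ^ m\<rfloor> \<Longrightarrow>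
      \<bar>e s - e t\<bar> \<le> 2 powr - (real m * b')"
    and hits: "real (card (hit_intervals d K m)) \<le> 2 powr (real m * b)"
    and \<sigma>: "1 \<le> \<sigma>" "b + real CARD('n) * (1 - b' * \<gamma>) \<le> \<sigma>"
  defines "C' \<equiv> 2 + (2 * C + 2) ^ CARD('n) + 1 + real CARD('n)"
  shows "covered_by ((\<lambda>t. (t, y (e t))) ` {0..1}) (C' * 2 powr (real m * \<sigma>)) (C' * 2 powr - real m)"
proof -
  define J where "J j = {t \<in> {0..1::real}. nat \<lfloor>t * 2 ^ m\<rfloor> = j}" for j
  define \<rho> where "\<rho> = C * 2 powr - (real m * b' * \<gamma>)"
  define \<epsilon> where "\<epsilon> = 2 powr - real m"
  have \<epsilon>: "0 < \<epsilon>" by (simp add: \<epsilon>_def)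
  define G where "G j = (\<lambda>t. (t, y (e t))) ` J j" for j
  define N where "N j = (if j \<in> hit_intervals d K m then (2 * \<rho> / \<epsilon> + 2) ^ CARD('n) else 1)" for j
  have \<rho>0: "0 \<le> \<rho>" using C by (simp add: \<rho>_def)
  have Jd: "\<bar>s - t\<bar> \<le> \<epsilon>" if "s \<in> J j" "t \<in> J j" for s t j
    unfolding \<epsilon>_def by (rule dyadic_close) (use that in \<open>auto simp: J_def\<close>)
  have cov: "covered_by (G j) (N j) (\<epsilon> + real CARD('n) * \<epsilon>)" for j
  proof (cases "j \<in> hit_intervals d K m")
    case False
    have "covered_by (G j) 1 \<epsilon>"
    proof (rule covered_by_single)
      fix p q assume "p \<in> G j" "q \<in> G j"
      then obtain s t where st: "s \<in> J j" "t \<in> J j" "p = (s, y (e s))" "q = (t, y (e t))" unfolding G_def by blast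
      have "e s = e t" using e_const_if_not_hit[of s t m j] False st unfolding J_def by auto
      then show "dist p q \<le> \<epsilon>" using Jd[OF st(1,2)] st by (simp add: dist_Pair_Pair dist_real_def)
    qed
    then show ?thesis by (rule covered_by_mono) (use False \<epsilon> in \<open>auto simp: N_def\<close>)
  next
    case True
    show ?thesis
    proof (rule covered_by_snd)
      have dy: "norm (y (e s) - y (e t)) \<le> \<rho>" if "s \<in> J j" "t \<in> J j" for s t
      proof -
        have st: "s \<in> {0..1}" "t \<in> {0..1}" using that by (auto simp: J_def)
        have 1: "\<bar>e s - e t\<bar> \<le> 2 powr - (real m * b')" using einc[OF st] that by (simp add: J_def)
        also have "\<dots> \<le> 2 powr - real n0" using m by simp
        finally have "norm (y (e s) - y (e t)) \<le> C * \<bar>e s - e t\<bar> powr \<gamma>"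
          using st e_nonneg e_le_K[of s] e_le_K[of t] by (intro hoelder) auto
        also have "\<dots> \<le> C * (2 powr - (real m * b')) powr \<gamma>"
          using 1 C \<gamma> by (intro mult_left_mono powr_mono2) auto
        also have "\<dots> = \<rho>" by (simp add: \<rho>_def powr_powr)
        finally show ?thesis .
      qed
      show "covered_by (snd ` G j) (N j) (real CARD('n) * \<epsilon>)"
      proof (cases "J j = {}")
        case True
        then show ?thesis using \<rho>0 \<epsilon> unfolding covered_by_def N_def G_def by (intro exI[of _ "{}"]) auto
      next
        case False
        then obtain t0 where t0: "t0 \<in> J j" by blast
        have "covered_by (snd ` G j) ((2 * \<rho> / \<epsilon> + 2) ^ CARD('n)) (real CARD('n) * \<epsilon>)"
        proof (rule covered_by_cubes[where a = "y (e t0)"])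
          fix v i assume "v \<in> snd ` G j"
          then obtain t where t: "t \<in> J j" "v = y (e t)" unfolding G_def by auto
          then show "\<bar>v $ i - y (e t0) $ i\<bar> \<le> \<rho>"
            using dy[OF t(1) t0] component_le_norm_cart[of "y (e t) - y (e t0)" i] by simp
        qed (use \<rho>0 \<epsilon> in auto)
        then show ?thesis using \<open>j \<in> hit_intervals d K m\<close> by (simp add: N_def)
      qed
      show "dist (fst p) (fst q) \<le> \<epsilon>" if "p \<in> G j" "q \<in> G j" for p q
        using that Jd unfolding G_def by (auto simp: dist_real_def)
    qed
  qed
  have "covered_by (\<Union>j\<in>{..2 ^ m}. G j) (\<Sum>j\<in>{..2 ^ m}. N j) (\<epsilon> + real CARD('n) * \<epsilon>)"
    by (rule covered_by_Union) (use cov in auto)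
  then show ?thesis
  proof (rule covered_by_mono)
    show "(\<lambda>t. (t, y (e t))) ` {0..1} \<subseteq> (\<Union>j\<in>{..2 ^ m}. G j)"
    proof
      fix p assume "p \<in> (\<lambda>t. (t, y (e t))) ` {0..1}"
      then obtain t where t: "t \<in> {0..1}" "p = (t, y (e t))" by blast
      have "nat \<lfloor>t * 2 ^ m\<rfloor> \<in> {..2 ^ m}" using nat_floor_dyadic_le[of t m] t by simp
      moreover have "p \<in> G (nat \<lfloor>t * 2 ^ m\<rfloor>)" using t by (auto simp: G_def J_def)
      ultimately show "p \<in> (\<Union>j\<in>{..2 ^ m}. G j)" by blast
    qed
    have base: "2 * \<rho> / \<epsilon> + 2 \<le> (2 * C + 2) * 2 powr (real m * (1 - b' * \<gamma>))"
    proof -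
      have "2 powr - (real m * b' * \<gamma>) / 2 powr - real m = 2 powr (real m * (1 - b' * \<gamma>))"
        by (simp add: powr_diff[symmetric] algebra_simps)
      then have "2 * \<rho> / \<epsilon> = 2 * C * 2 powr (real m * (1 - b' * \<gamma>))"
        unfolding \<rho>_def \<epsilon>_def by (metis (no_types, opaque_lifting) mult.assoc times_divide_eq_right)
      moreover have "1 \<le> 2 powr (real m * (1 - b' * \<gamma>))" using b' by (intro ge_one_powr_ge_zero) auto
      ultimately show ?thesis by (simp add: distrib_right)
    qed
    have hf: "hit_intervals d K m \<subseteq> {..2 ^ m}" unfolding hit_intervals_def by auto
    have "(\<Sum>j\<in>{..2 ^ m}. N j) \<le> (\<Sum>j\<in>{..2 ^ m}. 1 + (if j \<in> hit_intervals d K m then (2 * \<rho> / \<epsilon> + 2) ^ CARD('n) else 0))"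
      using \<rho>0 \<epsilon> by (intro sum_mono) (auto simp: N_def)
    also have "\<dots> = real (2 ^ m + 1) + real (card (hit_intervals d K m)) * (2 * \<rho> / \<epsilon> + 2) ^ CARD('n)"
      using hf by (simp add: sum.distrib sum.If_cases Int_absorb1 add.commute)
    also have "\<dots> \<le> (2 * 2 powr (real m * \<sigma>)) + (2 * C + 2) ^ CARD('n) * 2 powr (real m * \<sigma>)"
    proof (rule add_mono)
      have "2 ^ m \<le> 2 powr (real m * \<sigma>)"
        using \<sigma> mult_left_mono[of 1 \<sigma> "real m"] by (simp add: powr_realpow[symmetric])
      moreover have "(1::real) \<le> 2 ^ m" by simp
      ultimately have "1 + 2 ^ m \<le> 2 * 2 powr (real m * \<sigma>)" by linarith
      then show "real (2 ^ m + 1) \<le> 2 * 2 powr (real m * \<sigma>)" by (simp add: add.commute)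
      have "real (card (hit_intervals d K m)) * (2 * \<rho> / \<epsilon> + 2) ^ CARD('n) \<le>
          2 powr (real m * b) * ((2 * C + 2) * 2 powr (real m * (1 - b' * \<gamma>))) ^ CARD('n)"
        using hits base \<rho>0 \<epsilon> by (intro mult_mono power_mono) auto
      also have "\<dots> = (2 * C + 2) ^ CARD('n) * 2 powr (real m * (b + real CARD('n) * (1 - b' * \<gamma>)))"
      proof -
        have "(2 powr x) ^ CARD('n) = 2 powr (real CARD('n) * x)" for x :: real by (simp add: powr_power mult.commute)
        moreover have "real m * (b + real CARD('n) * (1 - b' * \<gamma>)) = real m * b + real CARD('n) * (real m * (1 - b' * \<gamma>))"
          by (simp add: distrib_left)
        ultimately show ?thesis by (simp only: power_mult_distrib powr_add mult_ac)
      qed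
      also have "\<dots> \<le> (2 * C + 2) ^ CARD('n) * 2 powr (real m * \<sigma>)"
        using \<sigma> C by (intro mult_left_mono) (auto intro!: mult_left_mono)
      finally show "real (card (hit_intervals d K m)) * (2 * \<rho> / \<epsilon> + 2) ^ CARD('n) \<le> (2 * C + 2) ^ CARD('n) * 2 powr (real m * \<sigma>)" .
    qed
    also have "\<dots> \<le> C' * 2 powr (real m * \<sigma>)"
      unfolding C'_def by (simp add: distrib_right)
    finally show "(\<Sum>j\<in>{..2 ^ m}. N j) \<le> C' * 2 powr (real m * \<sigma>)" .
    show "\<epsilon> + real CARD('n) * \<epsilon> \<le> C' * 2 powr - real m"
      using C \<epsilon> unfolding C'_def \<epsilon>_def[symmetric] by (simp add: distrib_right)
  qed
qed

text \<open>The next multiple of \<open>\<eta>\<close> after \<open>e s\<close> is at most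
  \<open>\<eta>\<close> away and is mapped above \<open>s\<close>; over one more step
  \<open>d\<close> gains more than the length of the time interval and so passes
  \<open>t\<close>.\<close>

lemma e_increment_le:
  assumes \<eta>: "0 < \<eta>" "\<eta> \<le> 1"
    and inc: "\<And>k. real k * \<eta> \<le> real K + 1 \<Longrightarrow> 2 powr - real m < d (real k * \<eta> + \<eta>) - d (real k * \<eta>)"
    and st: "s \<in> {0..1}" "t \<in> {0..1}" "nat \<lfloor>s * 2 ^ m\<rfloor> = nat \<lfloor>t * 2 ^ m\<rfloor>"
  shows "\<bar>e s - e t\<bar> \<le> 2 * \<eta>"
proof -
  have *: "e t \<le> e s + 2 * \<eta>" if st: "s \<in> {0..1}" "t \<in> {0..1}" "t - s \<le> 2 powr - real m" for s t
  proof -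
    define k where "k = Suc (nat \<lfloor>e s / \<eta>\<rfloor>)"
    have es: "0 \<le> e s" "e s \<le> real K" using e_nonneg e_le_K st by auto
    have "0 \<le> e s / \<eta>" using es \<eta> by simp
    from nat_floor_bounds[OF this] have "e s / \<eta> < real k" "real k \<le> e s / \<eta> + 1"
      unfolding k_def of_nat_Suc by linarith+
    then have k: "e s < real k * \<eta>" "real k * \<eta> \<le> e s + \<eta>"
      using \<eta> by (simp_all add: pos_divide_less_eq field_simps)
    have "s < d (real k * \<eta>)" using e_less_imp[of s "real k * \<eta>"] st k by auto
    moreover have "2 powr - real m < d (real k * \<eta> + \<eta>) - d (real k * \<eta>)"
      using k es \<eta> by (intro inc) linarith
    ultimately have "t < d (real k * \<eta> + \<eta>)" using st by linarith
    then have "e t \<le> real k * \<eta> + \<eta>" using st \<eta> by (intro e_le) auto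
    then show ?thesis using k by linarith
  qed
  have "\<bar>s - t\<bar> \<le> 2 powr - real m" using st by (intro dyadic_close) auto
  then have "t - s \<le> 2 powr - real m" "s - t \<le> 2 powr - real m" by auto
  from *[OF st(1,2) this(1)] *[OF st(2,1) this(2)] show ?thesis by (simp add: abs_le_iff)
qed

end

section \<open>Entrances of the subordinator into dyadic intervals\<close>

text \<open>Neighbours in \<open>S\<close> may be arbitrarily close and only elements two apart are
  separated, so a block of length \<open>g\<close> holds at most two of them.\<close>

lemma card_le_if_separated:
  fixes g :: real
  assumes S: "S \<subseteq> {..N}" and g: "0 < g"
    and sep: "\<And>i j k. i \<in> S \<Longrightarrow> j \<in> S \<Longrightarrow> k \<in> S \<Longrightarrow> i < j \<Longrightarrow> j < k \<Longrightarrow> g \<le> real k - real i"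
  shows "real (card S) \<le> 2 * (real N / g + 1)"
proof -
  have fin: "finite S" using S finite_subset by blast
  define b where "b i = nat \<lfloor>real i / g\<rfloor>" for i :: nat
  define L where "L = nat \<lfloor>real N / g\<rfloor>"
  have bL: "b i \<in> {..L}" if "i \<in> S" for i
    using that S g unfolding b_def L_def by (auto intro!: nat_mono floor_mono divide_right_mono)
  have fib: "card {i \<in> S. b i = l} \<le> 2" for l
  proof (rule ccontr)
    assume "\<not> card {i \<in> S. b i = l} \<le> 2"
    then have c3: "3 \<le> card {i \<in> S. b i = l}" by simp
    define A where "A = {i \<in> S. b i = l}"
    have finA: "finite A" using fin by (simp add: A_def)
    define lo where "lo = Min A"
    define hi where "hi = Max A"
    have ne: "A \<noteq> {}" using c3 by (auto simp: A_def[symmetric])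
    have lo: "lo \<in> A" "\<And>i. i \<in> A \<Longrightarrow> lo \<le> i" and hi: "hi \<in> A" "\<And>i. i \<in> A \<Longrightarrow> i \<le> hi"
      using finA ne by (auto simp: lo_def hi_def)
    have "A \<subseteq> {lo, hi} \<Longrightarrow> False"
      using c3 card_mono[of "{lo, hi}" A] card_insert_le_m1[of 2 "{hi}" lo] unfolding A_def[symmetric] by simp
    then obtain j where j: "j \<in> A" "j \<noteq> lo" "j \<noteq> hi" by blast
    have "g \<le> real hi - real lo"
      using sep[of lo j hi] lo hi j unfolding A_def by (metis (no_types, lifting) le_neq_implies_less mem_Collect_eq)
    moreover have "real hi / g - real lo / g < 1"
    proof -
      have pos: "0 \<le> real hi / g" "0 \<le> real lo / g" using g by auto
      have eq: "nat \<lfloor>real hi / g\<rfloor> = l" "nat \<lfloor>real lo / g\<rfloor> = l"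
        using lo(1) hi(1) by (auto simp: A_def b_def)
      show ?thesis
        using nat_floor_bounds[OF pos(1)] nat_floor_bounds[OF pos(2)] unfolding eq by linarith
    qed
    then have "real hi - real lo < g" using g by (simp add: diff_divide_distrib[symmetric])
    ultimately show False by simp
  qed
  have "b ` S \<subseteq> {..L}" using bL by blast
  then have "card S = (\<Sum>l\<in>{..L}. card {i \<in> S. b i = l})"
    using sum.group[of S "{..L}" b "\<lambda>_. 1::nat"] fin by simp
  also have "\<dots> \<le> (\<Sum>l\<in>{..L}. 2)" by (intro sum_mono fib)
  finally have "real (card S) \<le> 2 * (real L + 1)" by simp
  moreover have "real L \<le> real N / g" unfolding L_def using g by (intro of_nat_floor) auto
  ultimately show ?thesis by simp
qed

context prob_space
begin

text \<open>Independence of the past of a subordinator from the next increment replaces the strong Markov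
  property: \<open>F\<close> depends on the path at the times \<open>r \<le> s\<close> only.\<close>

lemma subordinator_indep_next_increment:
  assumes D: "stable_subordinator \<beta> D" and t: "0 \<le> r" "r \<le> s" "0 \<le> h"
    and F [measurable]: "Measurable.pred (borel \<Otimes>\<^sub>M borel) (\<lambda>p. F (fst p) (snd p))"
  shows "prob {\<omega> \<in> space M. F (D r \<omega>) (D s \<omega>) \<and> D (s + h) \<omega> - D s \<omega> \<le> \<epsilon>} =
    prob {\<omega> \<in> space M. F (D r \<omega>) (D s \<omega>)} * prob {\<omega> \<in> space M. D h \<omega> \<le> \<epsilon>}"
proof -
  have s: "0 \<le> s" using t by simp
  have [measurable]: "random_variable borel (D r)" "random_variable borel (D s)"
    "random_variable borel (D (s + h))" "random_variable borel (D 0)"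
    using subordinator_measurable[OF D] t by auto
  \<comment> \<open>The first two increments recover \<open>D r\<close> and \<open>D s\<close> up to
    \<open>D 0\<close>, which vanishes only almost surely; hence the events are rewritten with
    \<open>D 0\<close> subtracted.\<close>
  define \<tau> :: "nat \<Rightarrow> real" where "\<tau> k = (if k = 0 then 0 else if k = 1 then r else if k = 2 then s else s + h)" for k
  define X where "X k \<omega> = D (\<tau> (Suc k)) \<omega> - D (\<tau> k) \<omega>" for k \<omega>
  have X: "X 0 = (\<lambda>\<omega>. D r \<omega> - D 0 \<omega>)" "X (Suc 0) = (\<lambda>\<omega>. D s \<omega> - D r \<omega>)" "X 2 = (\<lambda>\<omega>. D (s + h) \<omega> - D s \<omega>)"
    by (auto simp: X_def[abs_def] \<tau>_def numeral_2_eq_2)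
  have "indep_vars (\<lambda>_. borel) X {..<3}"
    unfolding X_def[abs_def] by (rule subordinator_indep[OF D]) (use t in \<open>auto simp: \<tau>_def\<close>)
  then have ind: "indep_var (PiM {0, Suc 0} (\<lambda>_. borel)) (\<lambda>\<omega>. restrict (\<lambda>i. X i \<omega>) {0, Suc 0})
      (PiM {2} (\<lambda>_. borel)) (\<lambda>\<omega>. restrict (\<lambda>i. X i \<omega>) {2})"
    by (rule indep_var_restrict) auto
  define P where "P = {f \<in> space (PiM {0, Suc 0} (\<lambda>_::nat. borel :: real measure)). F (f 0) (f 0 + f (Suc 0))}"
  define Q where "Q = {f \<in> space (PiM {2} (\<lambda>_::nat. borel :: real measure)). f 2 \<le> \<epsilon>}"
  have "(\<lambda>f. (f 0, f 0 + f (Suc 0))) \<in> measurable (PiM {0, Suc 0} (\<lambda>_::nat. borel :: real measure)) (borel \<Otimes>\<^sub>M borel)"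
    by measurable
  from measurable_compose[OF this F] have "P \<in> sets (PiM {0, Suc 0} (\<lambda>_. borel))"
    unfolding P_def by (simp add: pred_def)
  moreover have "Q \<in> sets (PiM {2} (\<lambda>_. borel))" unfolding Q_def by measurable
  ultimately have eq: "prob ((\<lambda>x. (restrict (\<lambda>i. X i x) {0, Suc 0}, restrict (\<lambda>i. X i x) {2})) -` (P \<times> Q) \<inter> space M) =
    prob ((\<lambda>\<omega>. restrict (\<lambda>i. X i \<omega>) {0, Suc 0}) -` P \<inter> space M) * prob ((\<lambda>\<omega>. restrict (\<lambda>i. X i \<omega>) {2}) -` Q \<inter> space M)"
    by (rule indep_varD[OF ind])
  have Fm [measurable]: "Measurable.pred M (\<lambda>\<omega>. F (u \<omega>) (v \<omega>))"
    if [measurable]: "u \<in> borel_measurable M" "v \<in> borel_measurable M" for u v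
  proof -
    have "(\<lambda>\<omega>. (u \<omega>, v \<omega>)) \<in> measurable M (borel \<Otimes>\<^sub>M borel)" by measurable
    from measurable_compose[OF this F] show ?thesis by simp
  qed
  have A: "(\<lambda>x. (restrict (\<lambda>i. X i x) {0, Suc 0}, restrict (\<lambda>i. X i x) {2})) -` (P \<times> Q) \<inter> space M =
    {\<omega> \<in> space M. F (D r \<omega> - D 0 \<omega>) (D s \<omega> - D 0 \<omega>) \<and> D (s + h) \<omega> - D s \<omega> \<le> \<epsilon>}"
    by (auto simp: P_def Q_def X space_PiM)
  have B: "(\<lambda>\<omega>. restrict (\<lambda>i. X i \<omega>) {0, Suc 0}) -` P \<inter> space M =
    {\<omega> \<in> space M. F (D r \<omega> - D 0 \<omega>) (D s \<omega> - D 0 \<omega>)}"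
    by (auto simp: P_def X space_PiM)
  have C: "(\<lambda>\<omega>. restrict (\<lambda>i. X i \<omega>) {2}) -` Q \<inter> space M = {\<omega> \<in> space M. D (s + h) \<omega> - D s \<omega> \<le> \<epsilon>}"
    by (auto simp: Q_def X space_PiM)
  have "prob {\<omega> \<in> space M. F (D r \<omega>) (D s \<omega>) \<and> D (s + h) \<omega> - D s \<omega> \<le> \<epsilon>} =
    prob {\<omega> \<in> space M. F (D r \<omega> - D 0 \<omega>) (D s \<omega> - D 0 \<omega>) \<and> D (s + h) \<omega> - D s \<omega> \<le> \<epsilon>}"
    by (rule finite_measure_eq_AE) (use subordinator_AE[OF D] in \<open>auto elim!: eventually_mono\<close>)
  also have "\<dots> = prob {\<omega> \<in> space M. F (D r \<omega> - D 0 \<omega>) (D s \<omega> - D 0 \<omega>)} * prob {\<omega> \<in> space M. D (s + h) \<omega> - D s \<omega> \<le> \<epsilon>}"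
    using eq unfolding A B C .
  also have "prob {\<omega> \<in> space M. F (D r \<omega> - D 0 \<omega>) (D s \<omega> - D 0 \<omega>)} = prob {\<omega> \<in> space M. F (D r \<omega>) (D s \<omega>)}"
    by (rule finite_measure_eq_AE) (use subordinator_AE[OF D] in \<open>auto elim!: eventually_mono\<close>)
  also have "prob {\<omega> \<in> space M. D (s + h) \<omega> - D s \<omega> \<le> \<epsilon>} = prob {\<omega> \<in> space M. D h \<omega> \<le> \<epsilon>}"
    by (rule subordinator_increment_prob[OF D s t(3)])
  finally show ?thesis .
qed

lemma floor_strict_increase_measurable:
  "Measurable.pred (borel \<Otimes>\<^sub>M borel) (\<lambda>p. nat \<lfloor>fst p * (a::real)\<rfloor> < nat \<lfloor>snd p * a\<rfloor>)"
  by measurable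

text \<open>Count the grid times \<open>k 2\<^bsup>-l\<^esup>\<close> at which the path enters a new interval of length \<open>2\<^bsup>-m\<^esup>\<close>.
  Independently of the past, with probability at least \<open>1/2\<close> the path then moves by at most \<open>2\<^bsup>-m\<^esup>\<close>
  during a time \<open>\<delta>\<close> of order \<open>2\<^bsup>-m \<beta>\<^esup>\<close>, and this can happen at most \<open>2 (K / \<delta> + 1)\<close> times.\<close>

lemma expected_entrances:
  assumes D: "stable_subordinator \<beta> D" and \<beta>: "0 < \<beta>" and \<delta>: "0 < \<delta>"
    and half: "1 / 2 \<le> prob {\<omega> \<in> space M. D \<delta> \<omega> \<le> 2 powr - real m}"
  shows "(\<Sum>k\<in>{1..K * 2 ^ l}. prob {\<omega> \<in> space M.
      nat \<lfloor>D (real (k - 1) / 2 ^ l) \<omega> * 2 ^ m\<rfloor> < nat \<lfloor>D (real k / 2 ^ l) \<omega> * 2 ^ m\<rfloor>}) \<le> 4 * (real K / \<delta> + 1)"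
proof -
  define F where "F k \<omega> \<longleftrightarrow> nat \<lfloor>D (real (k - 1) / 2 ^ l) \<omega> * 2 ^ m\<rfloor> < nat \<lfloor>D (real k / 2 ^ l) \<omega> * 2 ^ m\<rfloor>" for k \<omega>
  define G where "G k \<omega> \<longleftrightarrow> D (real k / 2 ^ l + \<delta>) \<omega> - D (real k / 2 ^ l) \<omega> \<le> 2 powr - real m" for k \<omega>
  have [measurable]: "random_variable borel (D (real k / 2 ^ l))" "random_variable borel (D (real k / 2 ^ l + \<delta>))" for k
    using subordinator_measurable[OF D] \<delta> by (auto intro!: subordinator_measurable[OF D] add_nonneg_nonneg)
  have Fm [measurable]: "Measurable.pred M (F k)" for k unfolding F_def by measurable
  have Gm [measurable]: "Measurable.pred M (G k)" for k unfolding G_def by measurable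
  \<comment> \<open>Supplies one factor 2 of the final constant 4; the other comes from
    \<open>card_le_if_separated\<close>.\<close>
  have FG: "prob {\<omega> \<in> space M. F k \<omega>} \<le> 2 * prob {\<omega> \<in> space M. F k \<omega> \<and> G k \<omega>}" for k
  proof -
    have "prob {\<omega> \<in> space M. F k \<omega> \<and> G k \<omega>} = prob {\<omega> \<in> space M. F k \<omega>} * prob {\<omega> \<in> space M. D \<delta> \<omega> \<le> 2 powr - real m}"
      unfolding F_def G_def
      by (rule subordinator_indep_next_increment[OF D, where F = "\<lambda>u v. nat \<lfloor>u * 2 ^ m\<rfloor> < nat \<lfloor>v * 2 ^ m\<rfloor>"])
         (use \<delta> floor_strict_increase_measurable in \<open>auto intro!: divide_right_mono\<close>)
    also have "\<dots> \<ge> prob {\<omega> \<in> space M. F k \<omega>} * (1 / 2)" by (intro mult_left_mono half) simp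
    finally show ?thesis by simp
  qed
  have count: "AE \<omega> in M. (\<Sum>k\<in>{1..K * 2 ^ l}. indicator {\<omega> \<in> space M. F k \<omega> \<and> G k \<omega>} \<omega>) \<le> 2 * (real K / \<delta> + 1)"
    using subordinator_AE_regular[OF D \<beta>] AE_space
  proof eventually_elim
    case (elim \<omega>)
    have mo: "strict_mono_on {0..} (\<lambda>t. D t \<omega>)" using elim by simp
    define S where "S = {k \<in> {1..K * 2 ^ l}. F k \<omega> \<and> G k \<omega>}"
    have le: "D x \<omega> \<le> D y \<omega>" if "0 \<le> x" "x \<le> y" for x y
      using strict_mono_onD[OF mo, of x y] that by (cases "x = y") auto
    have "(\<Sum>k\<in>{1..K * 2 ^ l}. indicator {\<omega> \<in> space M. F k \<omega> \<and> G k \<omega>} \<omega>) = real (card S)"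
    proof -
      have "(\<Sum>k\<in>{1..K * 2 ^ l}. indicator {\<omega> \<in> space M. F k \<omega> \<and> G k \<omega>} \<omega>) =
          (\<Sum>k\<in>{1..K * 2 ^ l}. if F k \<omega> \<and> G k \<omega> then 1 else 0 :: real)"
        using elim by (intro sum.cong) (auto simp: indicator_def)
      also have "\<dots> = real (card ({1..K * 2 ^ l} \<inter> {k. F k \<omega> \<and> G k \<omega>}))" by (simp add: sum.If_cases)
      also have "{1..K * 2 ^ l} \<inter> {k. F k \<omega> \<and> G k \<omega>} = S" by (auto simp: S_def)
      finally show ?thesis .
    qed
    also have "\<dots> \<le> 2 * (real (K * 2 ^ l) / (\<delta> * 2 ^ l) + 1)"
    proof (rule card_le_if_separated)
      show "S \<subseteq> {..K * 2 ^ l}" by (auto simp: S_def)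
      show "0 < \<delta> * 2 ^ l" using \<delta> by simp
      fix i j k assume ijk: "i \<in> S" "j \<in> S" "k \<in> S" "i < j" "j < k"
      define a where "a k = nat \<lfloor>D (real k / 2 ^ l) \<omega> * 2 ^ m\<rfloor>" for k
      have amono: "a x \<le> a y" if "x \<le> y" for x y
      proof -
        have "real x / 2 ^ l \<le> real y / 2 ^ l" using that by (intro divide_right_mono) auto
        then have "D (real x / 2 ^ l) \<omega> \<le> D (real y / 2 ^ l) \<omega>" by (intro le) auto
        then show ?thesis unfolding a_def by (intro nat_mono floor_mono mult_right_mono) auto
      qed
      \<comment> \<open>Two entrances after time \<open>i\<close> raise the interval index by at
        least 2, hence the path by more than one interval length. The slow stretch of duration
        \<open>\<delta>\<close> after \<open>i\<close> must therefore end before time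
        \<open>k\<close>; a single later entrance would not force this.\<close>
      have "a (j - 1) < a j" "a (k - 1) < a k" using ijk by (auto simp: S_def F_def a_def)
      moreover have "a i \<le> a (j - 1)" "a j \<le> a (k - 1)" using ijk by (auto intro!: amono)
      ultimately have "a i + 2 \<le> a k" by linarith
      then have "real (a i) + 2 \<le> real (a k)" by linarith
      moreover have D0: "0 \<le> D (real x / 2 ^ l) \<omega>" for x using le[of 0 "real x / 2 ^ l"] elim by simp
      have "D (real i / 2 ^ l) \<omega> * 2 ^ m < real (a i) + 1" "real (a k) \<le> D (real k / 2 ^ l) \<omega> * 2 ^ m"
        using nat_floor_bounds[of "D (real i / 2 ^ l) \<omega> * 2 ^ m"] nat_floor_bounds[of "D (real k / 2 ^ l) \<omega> * 2 ^ m"] D0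
        unfolding a_def by auto
      ultimately have "1 < (D (real k / 2 ^ l) \<omega> - D (real i / 2 ^ l) \<omega>) * 2 ^ m"
        by (simp add: left_diff_distrib)
      then have "2 powr - real m < D (real k / 2 ^ l) \<omega> - D (real i / 2 ^ l) \<omega>"
        by (simp add: powr_minus powr_realpow field_simps)
      moreover have "D (real i / 2 ^ l + \<delta>) \<omega> - D (real i / 2 ^ l) \<omega> \<le> 2 powr - real m"
        using ijk by (simp add: S_def G_def)
      ultimately have "D (real i / 2 ^ l + \<delta>) \<omega> < D (real k / 2 ^ l) \<omega>" by linarith
      then have "real i / 2 ^ l + \<delta> \<le> real k / 2 ^ l"
        using le[of "real k / 2 ^ l" "real i / 2 ^ l + \<delta>"] by (cases "real i / 2 ^ l + \<delta> \<le> real k / 2 ^ l") auto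
      then have "\<delta> \<le> (real k - real i) / 2 ^ l" by (simp add: diff_divide_distrib)
      then show "\<delta> * 2 ^ l \<le> real k - real i" by (simp add: pos_le_divide_eq)
    qed
    finally show ?case by simp
  qed
  have "(\<Sum>k\<in>{1..K * 2 ^ l}. prob {\<omega> \<in> space M. F k \<omega>}) \<le> (\<Sum>k\<in>{1..K * 2 ^ l}. 2 * prob {\<omega> \<in> space M. F k \<omega> \<and> G k \<omega>})"
    by (intro sum_mono FG)
  also have "\<dots> = 2 * expectation (\<lambda>\<omega>. \<Sum>k\<in>{1..K * 2 ^ l}. indicator {\<omega> \<in> space M. F k \<omega> \<and> G k \<omega>} \<omega>)"
    by (subst Bochner_Integration.integral_sum)
       (auto simp: sum_distrib_left integrable_indicator_iff emeasure_eq_measure)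
  also have "expectation (\<lambda>\<omega>. \<Sum>k\<in>{1..K * 2 ^ l}. indicator {\<omega> \<in> space M. F k \<omega> \<and> G k \<omega>} \<omega>) \<le> expectation (\<lambda>\<omega>. 2 * (real K / \<delta> + 1))"
    by (intro integral_mono_AE count Bochner_Integration.integrable_sum)
       (auto simp: integrable_indicator_iff emeasure_eq_measure)
  finally show ?thesis by (simp add: F_def prob_space)
qed

end

text \<open>Every value other than the initial one is first attained at a strict increase, so
  distinct values are counted by entrances.\<close>

lemma mono_range_subset_entrances:
  fixes a :: "nat \<Rightarrow> nat"
  assumes "\<And>k. k < n \<Longrightarrow> a k \<le> a (Suc k)"
  shows "a ` {..n} \<subseteq> insert (a 0) (a ` {k \<in> {1..n}. a (k - 1) < a k})"
  using assms
proof (induction n)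
  case (Suc n)
  then have IH: "a ` {..n} \<subseteq> insert (a 0) (a ` {k \<in> {1..n}. a (k - 1) < a k})" by simp
  have "a (Suc n) \<in> insert (a 0) (a ` {k \<in> {1..Suc n}. a (k - 1) < a k})"
  proof (cases "a n = a (Suc n)")
    case True
    have "a n \<in> a ` {..n}" by simp
    then have "a n \<in> insert (a 0) (a ` {k \<in> {1..n}. a (k - 1) < a k})" using IH by blast
    then show ?thesis unfolding True by auto
  next
    case False
    then have "a n < a (Suc n)" using Suc.prems[of n] by simp
    then show ?thesis by (intro insertI2 imageI) simp
  qed
  moreover have "a ` {k \<in> {1..n}. a (k - 1) < a k} \<subseteq> a ` {k \<in> {1..Suc n}. a (k - 1) < a k}" by auto
  ultimately show ?case using IH unfolding atMost_Suc by auto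
qed simp

lemma summable_geometric_powr:
  fixes x :: real
  assumes "0 < x"
  shows "summable (\<lambda>m. C * 2 powr - (real m * x))"
proof -
  have "(\<lambda>m. C * 2 powr - (real m * x)) = (\<lambda>m. C * (2 powr - x) ^ m)" by (simp add: powr_power mult.commute)
  moreover have "norm (2 powr - x) < 1" using assms by (simp add: powr_less_one)
  ultimately show ?thesis by (simp add: summable_mult summable_geometric)
qed

context prob_space
begin

text \<open>The expected number of entrances has order \<open>2 powr (m * \<beta>)\<close> uniformly
  in the grid level \<open>l\<close>. Markov's inequality at \<open>2 powr (m * b)\<close> gives a
  bound summable in \<open>m\<close>, and it survives the increasing union over \<open>l\<close>, so
  Borel-Cantelli applies.\<close>

lemma AE_hit_intervals:
  assumes D: "stable_subordinator \<beta> D" and \<beta>: "0 < \<beta>" "\<beta> < b"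
  shows "AE \<omega> in M. eventually (\<lambda>m. real (card (hit_intervals (\<lambda>t. D t \<omega>) K m)) \<le> 2 powr (real m * b)) sequentially"
proof -
  obtain c where c: "0 < c" and lap: "\<And>h l. 0 \<le> h \<Longrightarrow> 0 \<le> l \<Longrightarrow>
    expectation (\<lambda>\<omega>. exp (- l * D h \<omega>)) = exp (- c * h * l powr \<beta>)"
    using stable_subordinator_laplace[OF D \<beta>(1)] by blast
  \<comment> \<open>Makes \<open>D\<close> exceed \<open>2 powr - m\<close> by time
    \<open>c' * 2 powr - (m * \<beta>)\<close> with probability at most 1/2.\<close>
  define c' where "c' = (1 - exp (-1)) / (2 * c)"
  have c': "0 < c'" using c by (simp add: c'_def)
  \<comment> \<open>The 5 is 4 from the entrance bound plus 1 for the initial interval.\<close>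
  define B where "B = 5 + 4 * real K / c'"
  have B: "0 < B" using c' by (simp add: B_def add_pos_nonneg)
  define a where "a m l k \<omega> = nat \<lfloor>D (real k / 2 ^ l) \<omega> * 2 ^ m\<rfloor>" for m l k :: nat and \<omega>
  have Dm [measurable]: "random_variable borel (D (real k / 2 ^ l))" for k l :: nat
    by (rule subordinator_measurable[OF D]) simp
  have am [measurable]: "a m l k \<in> measurable M (count_space UNIV)" for m l k unfolding a_def by measurable
  define S where "S m l \<omega> = (\<Sum>k\<in>{1..K * 2 ^ l}. indicator {\<omega> \<in> space M. a m l (k - 1) \<omega> < a m l k \<omega>} \<omega> :: real)" for m l \<omega>
  define cnt where "cnt m l \<omega> = (\<Sum>j\<in>{..2 ^ m}. indicator {\<omega> \<in> space M. \<exists>k\<in>{..K * 2 ^ l}. a m l k \<omega> = j} \<omega> :: real)" for m l \<omega>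
  define vals where "vals m l \<omega> = {j. j \<le> 2 ^ m \<and> (\<exists>k\<in>{..K * 2 ^ l}. a m l k \<omega> = j)}" for m l \<omega>
  have cvals: "cnt m l \<omega> = real (card (vals m l \<omega>))" if "\<omega> \<in> space M" for m l \<omega>
  proof -
    have "cnt m l \<omega> = (\<Sum>j\<in>{..2 ^ m}. if \<exists>k\<in>{..K * 2 ^ l}. a m l k \<omega> = j then 1 else 0)"
      unfolding cnt_def using that by (intro sum.cong) (auto simp: indicator_def)
    also have "\<dots> = real (card ({..2 ^ m} \<inter> {j. \<exists>k\<in>{..K * 2 ^ l}. a m l k \<omega> = j}))" by (simp add: sum.If_cases)
    also have "{..2 ^ m} \<inter> {j. \<exists>k\<in>{..K * 2 ^ l}. a m l k \<omega> = j} = vals m l \<omega>" by (auto simp: vals_def)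
    finally show ?thesis .
  qed
  have vals_mono: "vals m l \<omega> \<subseteq> vals m (Suc l) \<omega>" for m l \<omega>
  proof
    fix j assume "j \<in> vals m l \<omega>"
    then obtain k where k: "j \<le> 2 ^ m" "k \<le> K * 2 ^ l" "a m l k \<omega> = j" by (auto simp: vals_def)
    have "a m (Suc l) (2 * k) \<omega> = j" using k(3) by (simp add: a_def)
    moreover have "2 * k \<le> K * 2 ^ Suc l" using k(2) by simp
    ultimately show "j \<in> vals m (Suc l) \<omega>" unfolding vals_def using k(1) by blast
  qed
  have entm [measurable]: "{\<omega> \<in> space M. a m l i \<omega> < a m l k \<omega>} \<in> events" for m l i k
    unfolding a_def by measurable
  have [measurable]: "S m l \<in> borel_measurable M" for m l
    unfolding S_def by (intro borel_measurable_sum borel_measurable_indicator entm)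
  have [measurable]: "cnt m l \<in> borel_measurable M" for m l
    unfolding cnt_def by measurable
  have ES: "expectation (S m l) \<le> 4 * (real K / (c' * 2 powr - (real m * \<beta>)) + 1)" for m l
  proof -
    define \<delta> where "\<delta> = c' * 2 powr - (real m * \<beta>)"
    have \<delta>: "0 < \<delta>" using c' by (simp add: \<delta>_def)
    have [measurable]: "random_variable borel (D \<delta>)" by (rule subordinator_measurable[OF D]) (use \<delta> in simp)
    have "prob {\<omega> \<in> space M. 2 powr - real m < D \<delta> \<omega>} * (1 - exp (-1)) \<le> (1 - exp (-1)) / 2"
    proof -
      have "prob {\<omega> \<in> space M. 2 powr - real m < D \<delta> \<omega>} * (1 - exp (-1)) \<le> c * \<delta> * (2 powr - real m) powr - \<beta>"
        by (rule subordinator_small_prob(2)[OF D _ _ lap]) (use \<delta> in auto)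
      also have "\<dots> = c * c' * (2 powr - (real m * \<beta>) * 2 powr (real m * \<beta>))"
        by (simp add: \<delta>_def powr_powr)
      also have "\<dots> = (1 - exp (-1)) / 2" using c by (simp add: c'_def powr_add[symmetric])
      finally show ?thesis .
    qed
    then have "prob {\<omega> \<in> space M. 2 powr - real m < D \<delta> \<omega>} * (1 - exp (-1)) \<le> (1 / 2) * (1 - exp (-1))" by simp
    then have "prob {\<omega> \<in> space M. 2 powr - real m < D \<delta> \<omega>} \<le> 1 / 2"
      by (rule mult_right_le_imp_le) simp
    moreover have "prob {\<omega> \<in> space M. D \<delta> \<omega> \<le> 2 powr - real m} = 1 - prob {\<omega> \<in> space M. 2 powr - real m < D \<delta> \<omega>}"
      by (subst prob_compl[symmetric]) (auto intro!: arg_cong[where f = prob])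
    ultimately have half: "1 / 2 \<le> prob {\<omega> \<in> space M. D \<delta> \<omega> \<le> 2 powr - real m}" by simp
    have "expectation (S m l) = (\<Sum>k\<in>{1..K * 2 ^ l}. prob {\<omega> \<in> space M. a m l (k - 1) \<omega> < a m l k \<omega>})"
      unfolding S_def by (subst Bochner_Integration.integral_sum)
        (auto simp: integrable_indicator_iff emeasure_eq_measure)
    also have "\<dots> \<le> 4 * (real K / \<delta> + 1)"
      unfolding a_def by (rule expected_entrances[OF D \<beta>(1) \<delta> half])
    finally show ?thesis by (simp add: \<delta>_def)
  qed
  have EB: "1 + expectation (S m l) \<le> B * 2 powr (real m * \<beta>)" for m l
  proof -
    have "real K / (c' * 2 powr - (real m * \<beta>)) = real K / c' * 2 powr (real m * \<beta>)"
      by (simp add: powr_minus field_simps)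
    moreover have "1 \<le> 2 powr (real m * \<beta>)" using \<beta> by (intro ge_one_powr_ge_zero) auto
    ultimately show ?thesis using ES[of m l] unfolding B_def distrib_right by simp
  qed
  have cS: "AE \<omega> in M. cnt m l \<omega> \<le> 1 + S m l \<omega>" for m l
    using subordinator_AE[OF D] AE_space
  proof eventually_elim
    case (elim \<omega>)
    then have mo: "mono_on {0..} (\<lambda>t. D t \<omega>)" by simp
    have amono: "a m l k \<omega> \<le> a m l (Suc k) \<omega>" for k
    proof -
      have "D (real k / 2 ^ l) \<omega> \<le> D (real (Suc k) / 2 ^ l) \<omega>"
        by (rule mono_onD[OF mo]) (auto intro!: divide_right_mono)
      then show ?thesis unfolding a_def by (intro nat_mono floor_mono mult_right_mono) auto
    qed
    define F where "F = {k \<in> {1..K * 2 ^ l}. a m l (k - 1) \<omega> < a m l k \<omega>}"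
    have "vals m l \<omega> \<subseteq> (\<lambda>k. a m l k \<omega>) ` {..K * 2 ^ l}" by (auto simp: vals_def)
    also have "\<dots> \<subseteq> insert (a m l 0 \<omega>) ((\<lambda>k. a m l k \<omega>) ` F)"
      unfolding F_def by (rule mono_range_subset_entrances) (rule amono)
    finally have "card (vals m l \<omega>) \<le> card (insert (a m l 0 \<omega>) ((\<lambda>k. a m l k \<omega>) ` F))"
      by (intro card_mono) (auto simp: F_def)
    also have "\<dots> \<le> Suc (card ((\<lambda>k. a m l k \<omega>) ` F))" by (rule card_insert_le_m1) simp_all
    also have "\<dots> \<le> Suc (card F)" by (simp add: card_image_le F_def)
    finally have "real (card (vals m l \<omega>)) \<le> 1 + real (card F)" by simp
    moreover have "S m l \<omega> = real (card F)"
    proof -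
      have "S m l \<omega> = (\<Sum>k\<in>{1..K * 2 ^ l}. if a m l (k - 1) \<omega> < a m l k \<omega> then 1 else 0)"
        unfolding S_def using elim by (intro sum.cong) (auto simp: indicator_def)
      also have "\<dots> = real (card ({1..K * 2 ^ l} \<inter> {k. a m l (k - 1) \<omega> < a m l k \<omega>}))" by (simp add: sum.If_cases)
      also have "{1..K * 2 ^ l} \<inter> {k. a m l (k - 1) \<omega> < a m l k \<omega>} = F" by (auto simp: F_def)
      finally show ?thesis .
    qed
    ultimately show ?case using elim by (simp add: cvals)
  qed
  define V where "V m l = {\<omega> \<in> space M. 2 powr (real m * b) < cnt m l \<omega>}" for m l
  have [measurable]: "V m l \<in> events" for m l unfolding V_def by measurable
  have PV: "prob (V m l) \<le> B * 2 powr - (real m * (b - \<beta>))" for m l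
  proof -
    have "2 powr (real m * b) * prob (V m l) = expectation (\<lambda>\<omega>. 2 powr (real m * b) * indicator (V m l) \<omega>)" by simp
    also have "\<dots> \<le> expectation (\<lambda>\<omega>. 1 + S m l \<omega>)"
    proof (rule integral_mono_AE)
      show "integrable M (\<lambda>\<omega>. 2 powr (real m * b) * indicator (V m l) \<omega>)"
        by (auto simp: integrable_indicator_iff emeasure_eq_measure)
      show "integrable M (\<lambda>\<omega>. 1 + S m l \<omega>)"
        unfolding S_def by (auto simp: integrable_indicator_iff emeasure_eq_measure intro!: Bochner_Integration.integrable_add Bochner_Integration.integrable_sum)
      show "AE \<omega> in M. 2 powr (real m * b) * indicator (V m l) \<omega> \<le> 1 + S m l \<omega>"
        using cS[of m l]
      proof eventually_elim
        case (elim \<omega>)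
        have "0 \<le> S m l \<omega>" unfolding S_def by (intro sum_nonneg) simp
        then show ?case using elim by (auto simp: indicator_def V_def)
      qed
    qed
    also have "\<dots> = 1 + expectation (S m l)"
      by (subst Bochner_Integration.integral_add)
        (auto simp: prob_space S_def[abs_def] integrable_indicator_iff emeasure_eq_measure intro!: Bochner_Integration.integrable_sum)
    also have "\<dots> \<le> B * 2 powr (real m * \<beta>)" by (rule EB)
    finally have "prob (V m l) \<le> B * 2 powr (real m * \<beta>) / 2 powr (real m * b)"
      by (simp add: pos_le_divide_eq mult.commute)
    also have "\<dots> = B * 2 powr - (real m * (b - \<beta>))" by (simp add: powr_diff[symmetric] algebra_simps flip: times_divide_eq_right)
    finally show ?thesis .
  qed
  \<comment> \<open>Each grid contains the coarser ones, so the counts grow with \<open>l\<close>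
    and continuity from below carries the bound over to all dyadic times.\<close>
  have "incseq (V m)" for m
  proof (rule incseq_SucI)
    fix l
    have "card (vals m l \<omega>) \<le> card (vals m (Suc l) \<omega>)" for \<omega>
      by (intro card_mono vals_mono) (simp add: vals_def)
    then have "cnt m l \<omega> \<le> cnt m (Suc l) \<omega>" if "\<omega> \<in> space M" for \<omega> using that by (simp add: cvals)
    then show "V m l \<le> V m (Suc l)" unfolding V_def by force
  qed
  then have "(\<lambda>l. prob (V m l)) \<longlonglongrightarrow> prob (\<Union>l. V m l)" for m
    by (intro finite_Lim_measure_incseq) auto
  then have PU: "prob (\<Union>l. V m l) \<le> B * 2 powr - (real m * (b - \<beta>))" for m
    by (rule LIMSEQ_le_const2) (use PV in auto)
  have "summable (\<lambda>m. B * 2 powr - (real m * (b - \<beta>)))" by (rule summable_geometric_powr) (use \<beta> in simp)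
  then have "summable (\<lambda>m. prob (\<Union>l. V m l))"
    by (rule summable_comparison_test') (use PU in auto)
  then have "AE \<omega> in M. eventually (\<lambda>m. \<omega> \<in> space M - (\<Union>l. V m l)) sequentially"
    by (intro borel_cantelli_AE1) (auto simp: emeasure_eq_measure)
  then show ?thesis
  proof eventually_elim
    case (elim \<omega>)
    then show ?case
    proof eventually_elim
      case (elim m)
      define Hs where "Hs = hit_intervals (\<lambda>t. D t \<omega>) K m"
      have fin: "finite Hs" unfolding Hs_def hit_intervals_def by simp
      have "\<forall>j\<in>Hs. \<exists>l. j \<in> vals m l \<omega>" unfolding Hs_def hit_intervals_def vals_def a_def by auto
      then obtain L where L: "\<And>j. j \<in> Hs \<Longrightarrow> j \<in> vals m (L j) \<omega>" by metis
      \<comment> \<open>There are finitely many hit intervals, so one grid level witnesses all of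
        them at once.\<close>
      define l where "l = Max (insert 0 (L ` Hs))"
      have "vals m i \<omega> \<subseteq> vals m j \<omega>" if "i \<le> j" for i j
        using that by (rule lift_Suc_mono_le[of "\<lambda>l. vals m l \<omega>", rotated]) (rule vals_mono)
      moreover have "L j \<le> l" if "j \<in> Hs" for j using fin that by (simp add: l_def)
      ultimately have "Hs \<subseteq> vals m l \<omega>" using L by blast
      then have "card Hs \<le> card (vals m l \<omega>)" by (intro card_mono) (auto simp: vals_def)
      then have "real (card Hs) \<le> cnt m l \<omega>" using elim by (simp add: cvals)
      also have "\<dots> \<le> 2 powr (real m * b)" using elim unfolding V_def by (auto simp: not_less)
      finally show ?case by (simp add: Hs_def)
    qed
  qed
qed

text \<open>Since \<open>b' < \<beta>\<close>, a time step \<open>\<eta> m\<close> is long compared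
  with the time \<open>D\<close> typically needs to grow by \<open>2 powr - m\<close>, and the
  failure probability is a stretched exponential. The half in \<open>\<eta>\<close> cancels the
  factor 2 of \<open>e_increment_le\<close>.\<close>

lemma AE_subordinator_increments:
  assumes D: "stable_subordinator \<beta> D" and \<beta>: "0 < b'" "b' < \<beta>"
  defines "\<eta> \<equiv> \<lambda>m::nat. 2 powr - (real m * b') / 2"
  shows "AE \<omega> in M. eventually (\<lambda>m. \<forall>k. real k * \<eta> m \<le> real K + 1 \<longrightarrow>
    2 powr - real m < D (real k * \<eta> m + \<eta> m) \<omega> - D (real k * \<eta> m) \<omega>) sequentially"
proof -
  have b0: "0 < \<beta>" using \<beta> by simp
  obtain c where c: "0 < c" and lap: "\<And>h l. 0 \<le> h \<Longrightarrow> 0 \<le> l \<Longrightarrow>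
    expectation (\<lambda>\<omega>. exp (- l * D h \<omega>)) = exp (- c * h * l powr \<beta>)"
    using stable_subordinator_laplace[OF D b0] by blast
  \<comment> \<open>There are of order \<open>2 powr (m * b')\<close> grid steps; the exponent
    \<open>b' + 1\<close> leaves the summable factor \<open>2 powr - m\<close>.\<close>
  obtain C where C: "0 < C" "\<And>n::nat. exp (- (c / 2) * 2 powr (real n * (\<beta> - b'))) \<le> C * 2 powr - (real n * (b' + 1))"
    using exp_neg_powr_bound[of "c / 2" "\<beta> - b'" "b' + 1"] c \<beta> by auto
  have \<eta>: "0 < \<eta> m" for m by (simp add: \<eta>_def)
  define n where "n m = nat \<lfloor>(real K + 1) / \<eta> m\<rfloor>" for m
  define A where "A m k = {\<omega> \<in> space M. D (real k * \<eta> m + \<eta> m) \<omega> - D (real k * \<eta> m) \<omega> \<le> 2 powr - real m}" for m k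
  have Dm [measurable]: "random_variable borel (D (real k * \<eta> m))" "random_variable borel (D (real k * \<eta> m + \<eta> m))" for k m
    using \<eta>[of m] by (auto intro!: subordinator_measurable[OF D] add_nonneg_nonneg mult_nonneg_nonneg)
  have [measurable]: "A m k \<in> events" for m k unfolding A_def by measurable
  have PA: "prob (A m k) \<le> exp 1 * (C * 2 powr - (real m * (b' + 1)))" for m k
  proof -
    have "prob (A m k) = prob {\<omega> \<in> space M. D (\<eta> m) \<omega> \<le> 2 powr - real m}"
      unfolding A_def by (rule subordinator_increment_prob[OF D]) (use \<eta>[of m] in auto)
    also have "\<dots> \<le> exp 1 * exp (- c * \<eta> m * (2 powr - real m) powr - \<beta>)"
      by (rule subordinator_small_prob(1)[OF D _ _ lap]) (use \<eta>[of m] in auto)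
    also have "- c * \<eta> m * (2 powr - real m) powr - \<beta> = - (c / 2) * 2 powr (real m * (\<beta> - b'))"
    proof -
      have "2 powr - (real m * b') * 2 powr (real m * \<beta>) = 2 powr (real m * (\<beta> - b'))"
        by (simp add: powr_add[symmetric] algebra_simps)
      then show ?thesis by (simp add: \<eta>_def powr_powr)
    qed
    also have "exp 1 * exp (- (c / 2) * 2 powr (real m * (\<beta> - b'))) \<le> exp 1 * (C * 2 powr - (real m * (b' + 1)))"
      by (intro mult_left_mono C) simp
    finally show ?thesis .
  qed
  define Z where "Z m = (\<Union>k\<in>{..n m}. A m k)" for m
  have [measurable]: "Z m \<in> events" for m unfolding Z_def by measurable
  have PZ: "prob (Z m) \<le> ((2 * real K + 3) * exp 1 * C) * 2 powr - (real m * 1)" for m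
  proof -
    have "prob (Z m) \<le> (\<Sum>k\<in>{..n m}. prob (A m k))"
      unfolding Z_def by (intro finite_measure_subadditive_finite) auto
    also have "\<dots> \<le> (\<Sum>k\<in>{..n m}. exp 1 * (C * 2 powr - (real m * (b' + 1))))" by (intro sum_mono PA)
    also have "\<dots> = (real (n m) + 1) * (exp 1 * (C * 2 powr - (real m * (b' + 1))))" by simp
    also have "\<dots> \<le> ((2 * real K + 3) * 2 powr (real m * b')) * (exp 1 * (C * 2 powr - (real m * (b' + 1))))"
    proof (rule mult_right_mono)
      have "real (n m) \<le> (real K + 1) / \<eta> m" unfolding n_def using \<eta>[of m] by (intro of_nat_floor) simp
      also have "\<dots> = (2 * real K + 2) * 2 powr (real m * b')" by (simp add: \<eta>_def powr_minus field_simps)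
      finally have "real (n m) \<le> (2 * real K + 2) * 2 powr (real m * b')" .
      moreover have "1 \<le> 2 powr (real m * b')" using \<beta> by (intro ge_one_powr_ge_zero) auto
      ultimately show "real (n m) + 1 \<le> (2 * real K + 3) * 2 powr (real m * b')" by (simp add: distrib_right)
    qed (use C in simp)
    also have "\<dots> = ((2 * real K + 3) * exp 1 * C) * (2 powr (real m * b') * 2 powr - (real m * (b' + 1)))" by simp
    also have "2 powr (real m * b') * 2 powr - (real m * (b' + 1)) = 2 powr - (real m * 1)"
      by (simp add: powr_add[symmetric] algebra_simps)
    finally show ?thesis .
  qed
  have "summable (\<lambda>m. ((2 * real K + 3) * exp 1 * C) * 2 powr - (real m * 1))" by (rule summable_geometric_powr) simp
  then have "summable (\<lambda>m. prob (Z m))" by (rule summable_comparison_test') (use PZ in auto)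
  then have "AE \<omega> in M. eventually (\<lambda>m. \<omega> \<in> space M - Z m) sequentially"
    by (intro borel_cantelli_AE1) (auto simp: emeasure_eq_measure)
  then show ?thesis
  proof eventually_elim
    case (elim \<omega>)
    then show ?case
    proof eventually_elim
      case (elim m)
      show ?case
      proof (intro allI impI)
        fix k assume k: "real k * \<eta> m \<le> real K + 1"
        then have "real k \<le> (real K + 1) / \<eta> m" using \<eta>[of m] by (simp add: pos_le_divide_eq)
        then have "k \<le> n m" unfolding n_def by (simp add: le_nat_floor)
        then have "\<omega> \<notin> A m k" using elim unfolding Z_def by auto
        then show "2 powr - real m < D (real k * \<eta> m + \<eta> m) \<omega> - D (real k * \<eta> m) \<omega>"
          using elim by (auto simp: A_def)
      qed
    qed
  qed
qed

end

section \<open>Almost sure dimensions\<close>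

text \<open>Projections do not increase diameters, so a lower bound for the range passes to the
  graph.\<close>

lemma hausdorff_measure_nonexpansive_image_eq_0:
  fixes f :: "'a::metric_space \<Rightarrow> 'b::metric_space"
  assumes f: "\<And>x y. dist (f x) (f y) \<le> dist x y" and zero: "hausdorff_measure s A = 0" and s: "0 \<le> s"
  shows "hausdorff_measure s (f ` A) = 0"
  unfolding hausdorff_measure_eq_0_iff
proof (intro allI impI)
  fix \<delta> :: real assume \<delta>: "0 < \<delta>"
  have "hausdorff_premeasure s \<delta> (f ` A) \<le> hausdorff_premeasure s \<delta> A"
    unfolding hausdorff_premeasure_def[of s \<delta> A]
  proof (rule INF_greatest, safe)
    fix U :: "nat \<Rightarrow> 'a set" assume U: "A \<subseteq> (\<Union>i. U i)" "\<forall>i. bounded (U i) \<and> diameter (U i) \<le> \<delta>"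
    have bd: "bounded (f ` U i) \<and> diameter (f ` U i) \<le> diameter (U i)" for i
    proof (cases "U i = {}")
      case False
      then obtain z where z: "z \<in> U i" by blast
      have d: "dist (f x) (f y) \<le> diameter (U i)" if "x \<in> U i" "y \<in> U i" for x y
        using f[of x y] diameter_bounded_bound[of "U i" x y] U(2) that by (meson order_trans)
      have "bounded (f ` U i)"
        unfolding bounded_def using d[OF z] by (intro exI[of _ "f z"] exI[of _ "diameter (U i)"]) auto
      moreover have "diameter (f ` U i) \<le> diameter (U i)"
      proof -
        have "diameter (f ` U i) = (SUP p\<in>f ` U i \<times> f ` U i. case p of (x, y) \<Rightarrow> dist x y)"
          using False unfolding diameter_def by simp
        also have "\<dots> \<le> diameter (U i)" using False d by (intro cSUP_least) auto
        finally show ?thesis .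
      qed
      ultimately show ?thesis by blast
    qed (simp add: diameter_def)
    have "hausdorff_premeasure s \<delta> (f ` A) \<le> (\<Sum>i. ennreal (diameter_power s (f ` U i)))"
    proof (rule hausdorff_premeasure_le)
      show "f ` A \<subseteq> (\<Union>i. f ` U i)" using U(1) by blast
      show "diameter (f ` U i) \<le> \<delta>" for i using bd[of i] U(2) by (meson order_trans)
    qed (use bd in blast)
    also have "\<dots> \<le> (\<Sum>i. ennreal (diameter_power s (U i)))"
    proof (intro suminf_le summableI ennreal_leI)
      fix i
      show "diameter_power s (f ` U i) \<le> diameter_power s (U i)"
        using bd[of i] s diameter_ge_0[of "f ` U i"] by (auto simp: diameter_power_def intro: powr_mono2)
    qed
    finally show "hausdorff_premeasure s \<delta> (f ` A) \<le> (\<Sum>i. ennreal (diameter_power s (U i)))" .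
  qed
  then show "hausdorff_premeasure s \<delta> (f ` A) = 0"
    using zero \<delta> unfolding hausdorff_measure_eq_0_iff by (metis le_zero_eq)
qed

text \<open>The range is treated as the \<open>snd\<close> image of this set, so covers of the graph
  and paths contained in it serve both statements.\<close>

definition graph_image :: "(real \<Rightarrow> 'w \<Rightarrow> 'b) \<Rightarrow> (real \<Rightarrow> 'w \<Rightarrow> real) \<Rightarrow> 'w \<Rightarrow> (real \<times> 'b) set" where
  "graph_image Y D \<omega> = (\<lambda>t. (t, Y (inverse_process D t \<omega>) \<omega>)) ` {0..1}"

text \<open>At \<open>b = b' = \<beta>\<close> and \<open>\<gamma> = H\<close> the last expression
  equals \<open>\<beta> + (1 - H * \<beta>) * d\<close>, which is below \<open>\<sigma>\<close>.
  Continuity in one common perturbation \<open>x\<close> leaves room for the strict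
  inequalities.\<close>

lemma hit_parameters:
  fixes H \<beta> d \<sigma> :: real
  assumes "0 < H" "H < 1" "0 < \<beta>" "\<beta> < 1" "\<beta> + (1 - H * \<beta>) * d < \<sigma>"
  obtains b b' \<gamma> where "\<beta> < b" "0 < b'" "b' < \<beta>" "0 < \<gamma>" "\<gamma> < H" "b' * \<gamma> < 1" "b + d * (1 - b' * \<gamma>) \<le> \<sigma>"
proof -
  define g where "g x = \<beta> * (1 + x) + d * (1 - (\<beta> * (1 - x)) * (H * (1 - x)))" for x
  have "continuous (at 0) g" unfolding g_def by (intro continuous_intros)
  then have "(g \<longlongrightarrow> g 0) (at_right 0)" by (simp add: continuous_at filterlim_at_split)
  moreover have "g 0 < \<sigma>" using assms by (simp add: g_def algebra_simps)
  ultimately have "eventually (\<lambda>x. g x < \<sigma>) (at_right 0)" by (rule order_tendstoD)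
  moreover have "eventually (\<lambda>x::real. 0 < x \<and> x < 1) (at_right 0)"
    using eventually_at_right_less[of 0] eventually_at_right[of 0 1] by (auto simp: eventually_at_right[of 0 1] intro!: exI[of _ 1])
  ultimately have "eventually (\<lambda>x. g x < \<sigma> \<and> 0 < x \<and> x < 1) (at_right 0)" by eventually_elim auto
  then obtain x where x: "g x < \<sigma>" "0 < x" "x < 1"
    using eventually_happens'[OF trivial_limit_at_right_real] by blast
  show ?thesis
  proof (rule that[of "\<beta> * (1 + x)" "\<beta> * (1 - x)" "H * (1 - x)"])
    show "\<beta> * (1 - x) < \<beta>" "H * (1 - x) < H" using assms x by (auto simp: algebra_simps)
    then have "\<beta> * (1 - x) < 1" "H * (1 - x) < 1" using assms(2,4) by linarith+
    then show "\<beta> * (1 - x) * (H * (1 - x)) < 1"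
      using mult_strict_mono[of "\<beta> * (1 - x)" 1 "H * (1 - x)" 1] assms x by auto
    show "\<beta> * (1 + x) + d * (1 - \<beta> * (1 - x) * (H * (1 - x))) \<le> \<sigma>" using x by (simp add: g_def)
  qed (use assms x in \<open>auto simp: algebra_simps\<close>)
qed

text \<open>Reduces the dimensions to countably many exponents, each of which may be treated on its
  own event of full probability; monotonicity in the exponent fills the gaps.\<close>

lemma dimensions_eq_of_sequences:
  fixes A :: "'a::euclidean_space set"
  assumes \<tau>: "0 < \<tau>"
    and low: "\<And>n::nat. hausdorff_measure (\<tau> * (1 - 1 / real (n + 2))) A \<noteq> 0"
    and up: "\<And>n::nat. box_counting_le A (\<tau> + 1 / real (n + 1))"
  shows "hausdorff_dimension A = \<tau> \<and> packing_dimension A = \<tau>"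
proof -
  have P: "packing_measure s A = 0" if "\<tau> < s" for s
  proof -
    have "0 < s - \<tau>" using that by simp
    then obtain n where n: "1 / real (Suc n) < s - \<tau>" by (rule nat_approx_posE)
    show ?thesis
      by (rule packing_measure_eq_0_if_box_counting_le[OF up[of n]]) (use n \<tau> in \<open>auto simp: add_nonneg_nonneg\<close>)
  qed
  have H: "hausdorff_measure s A \<noteq> 0" if s: "0 \<le> s" "s < \<tau>" for s
  proof
    assume zero: "hausdorff_measure s A = 0"
    have "0 < 1 - s / \<tau>" using s \<tau> by simp
    then obtain n where n: "1 / real (Suc n) < 1 - s / \<tau>" by (rule nat_approx_posE)
    have "1 / real (n + 2) \<le> 1 / real (Suc n)" by (simp add: frac_le)
    then have "s / \<tau> \<le> 1 - 1 / real (n + 2)" using n by linarith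
    then have "s \<le> \<tau> * (1 - 1 / real (n + 2))" using \<tau> by (simp add: pos_divide_le_eq mult.commute)
    from hausdorff_measure_eq_0_mono_exponent[OF zero s(1) this] show False using low[of n] by simp
  qed
  show ?thesis using hausdorff_packing_dimension_eqI[of \<tau> A] \<tau> P H by auto
qed

context prob_space
begin

lemma AE_inverse_path:
  assumes "stable_subordinator \<beta> D" "0 < \<beta>"
  shows "AE \<omega> in M. \<exists>K. inverse_path (\<lambda>t. D t \<omega>) (\<lambda>t. inverse_process D t \<omega>) K"
  using subordinator_AE_regular[OF assms]
proof eventually_elim
  case (elim \<omega>)
  then obtain K :: nat where "1 < D (real K) \<omega>" by blast
  then have "inverse_path (\<lambda>t. D t \<omega>) (\<lambda>t. inverse_process D t \<omega>) K"
    using elim by unfold_locales (auto simp: inverse_process_def)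
  then show ?case by blast
qed

lemma AE_graph_covered_staircase:
  fixes Y :: "real \<Rightarrow> 'a \<Rightarrow> real ^ 'n"
  assumes Y: "fractional_brownian_motion H Y" and D: "stable_subordinator \<beta> D"
    and H: "0 < H" "H < 1" and \<beta>: "0 < \<beta>" and \<sigma>: "1 / H < \<sigma>"
  shows "AE \<omega> in M. box_counting_le (graph_image Y D \<omega>) \<sigma>"
proof -
  \<comment> \<open>Since \<open>1 / H < \<sigma>\<close>, its reciprocal is an admissible Hoelder
    exponent below \<open>H\<close>.\<close>
  define \<gamma> where "\<gamma> = 1 / \<sigma>"
  have s0: "0 < \<sigma>" using H \<sigma> by (smt (verit) divide_pos_pos)
  have \<gamma>: "0 < \<gamma>" "\<gamma> < H" "1 / \<gamma> = \<sigma>" using H \<sigma> s0 by (auto simp: \<gamma>_def field_simps)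
  have "AE \<omega> in M. \<forall>K. \<exists>C n0. 0 < C \<and> (\<forall>s t. 0 \<le> s \<longrightarrow> s < real K \<longrightarrow> 0 \<le> t \<longrightarrow> t < real K \<longrightarrow>
    \<bar>s - t\<bar> \<le> 2 powr - real (n0::nat) \<longrightarrow> norm (Y s \<omega> - Y t \<omega>) \<le> C * \<bar>s - t\<bar> powr \<gamma>)"
    unfolding AE_all_countable by (intro allI fbm_AE_hoelder[OF Y \<gamma>(1,2)])
  then show ?thesis using AE_inverse_path[OF D \<beta>]
  proof eventually_elim
    case (elim \<omega>)
    then obtain K where "inverse_path (\<lambda>t. D t \<omega>) (\<lambda>t. inverse_process D t \<omega>) K" by blast
    then interpret ip: inverse_path "\<lambda>t. D t \<omega>" "\<lambda>t. inverse_process D t \<omega>" K .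
    \<comment> \<open>\<open>Suc K\<close> is taken because the Hoelder bound holds on a half-open
      interval, while the inverse may attain the value \<open>K\<close>.\<close>
    obtain C n0 where C: "0 < C" and h: "\<forall>s t. 0 \<le> s \<longrightarrow> s < real (Suc K) \<longrightarrow> 0 \<le> t \<longrightarrow> t < real (Suc K) \<longrightarrow>
      \<bar>s - t\<bar> \<le> 2 powr - real n0 \<longrightarrow> norm (Y s \<omega> - Y t \<omega>) \<le> C * \<bar>s - t\<bar> powr \<gamma>"
      using elim(1) by blast
    have "covered_by (graph_image Y D \<omega>) ((2 * real K + 2 + C) * 2 powr (real m * \<sigma>)) ((2 * real K + 2 + C) * 2 powr - real m)"
      if "n0 \<le> m" for m
      unfolding graph_image_def \<gamma>(3)[symmetric]
      by (rule ip.graph_covered_by_staircase[OF C \<gamma>(1) _ _ that]) (use \<gamma> H h in \<open>auto simp: dist_norm add.commute\<close>)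
    then show ?case
      using box_counting_leI[of "2 * real K + 2 + C" \<sigma> n0 "graph_image Y D \<omega>"] C s0 by auto
  qed
qed

lemma AE_graph_covered_hits:
  fixes Y :: "real \<Rightarrow> 'a \<Rightarrow> real ^ 'n"
  assumes Y: "fractional_brownian_motion H Y" and D: "stable_subordinator \<beta> D"
    and H: "0 < H" "H < 1" and \<beta>: "0 < \<beta>" "\<beta> < 1"
    and \<sigma>: "1 \<le> \<sigma>" "\<beta> + (1 - H * \<beta>) * real CARD('n) < \<sigma>"
  shows "AE \<omega> in M. box_counting_le (graph_image Y D \<omega>) \<sigma>"
proof -
  obtain b b' \<gamma> where p: "\<beta> < b" "0 < b'" "b' < \<beta>" "0 < \<gamma>" "\<gamma> < H" "b' * \<gamma> < 1"
    "b + real CARD('n) * (1 - b' * \<gamma>) \<le> \<sigma>"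
    using hit_parameters[OF H \<beta> \<sigma>(2)] by blast
  define \<eta> where "\<eta> m = 2 powr - (real m * b') / 2" for m :: nat
  have \<eta>: "0 < \<eta> m" "\<eta> m \<le> 1" for m
  proof -
    have "2 powr - (real m * b') \<le> 2 powr 0" using p by (intro powr_mono) auto
    then show "0 < \<eta> m" "\<eta> m \<le> 1" by (auto simp: \<eta>_def)
  qed
  have "AE \<omega> in M. \<forall>K. \<exists>C n0. 0 < C \<and> (\<forall>s t. 0 \<le> s \<longrightarrow> s < real K \<longrightarrow> 0 \<le> t \<longrightarrow> t < real K \<longrightarrow>
    \<bar>s - t\<bar> \<le> 2 powr - real (n0::nat) \<longrightarrow> norm (Y s \<omega> - Y t \<omega>) \<le> C * \<bar>s - t\<bar> powr \<gamma>)"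
    unfolding AE_all_countable by (intro allI fbm_AE_hoelder[OF Y p(4,5)])
  moreover have "AE \<omega> in M. \<forall>K. eventually (\<lambda>m. real (card (hit_intervals (\<lambda>t. D t \<omega>) K m)) \<le> 2 powr (real m * b)) sequentially"
    unfolding AE_all_countable by (intro allI AE_hit_intervals[OF D \<beta>(1) p(1)])
  moreover have "AE \<omega> in M. \<forall>K. eventually (\<lambda>m. \<forall>k. real k * \<eta> m \<le> real (K::nat) + 1 \<longrightarrow>
    2 powr - real m < D (real k * \<eta> m + \<eta> m) \<omega> - D (real k * \<eta> m) \<omega>) sequentially"
    unfolding AE_all_countable \<eta>_def by (intro allI AE_subordinator_increments[OF D p(2,3)])
  ultimately show ?thesis using AE_inverse_path[OF D \<beta>(1)]
  proof eventually_elim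
    case (elim \<omega>)
    then obtain K where "inverse_path (\<lambda>t. D t \<omega>) (\<lambda>t. inverse_process D t \<omega>) K" by blast
    then interpret ip: inverse_path "\<lambda>t. D t \<omega>" "\<lambda>t. inverse_process D t \<omega>" K .
    obtain C n0 where C: "0 < C" and h: "\<forall>s t. 0 \<le> s \<longrightarrow> s < real (Suc K) \<longrightarrow> 0 \<le> t \<longrightarrow> t < real (Suc K) \<longrightarrow>
      \<bar>s - t\<bar> \<le> 2 powr - real n0 \<longrightarrow> norm (Y s \<omega> - Y t \<omega>) \<le> C * \<bar>s - t\<bar> powr \<gamma>"
      using elim(1) by blast
    have "eventually (\<lambda>m. real n0 / b' \<le> real m) sequentially"
      using filterlim_real_sequentially unfolding filterlim_at_top by blast
    moreover have "eventually (\<lambda>m. real (card (hit_intervals (\<lambda>t. D t \<omega>) K m)) \<le> 2 powr (real m * b)) sequentially"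
      using elim(2) by blast
    moreover have "eventually (\<lambda>m. \<forall>k. real k * \<eta> m \<le> real K + 1 \<longrightarrow>
      2 powr - real m < D (real k * \<eta> m + \<eta> m) \<omega> - D (real k * \<eta> m) \<omega>) sequentially"
      using elim(3) by blast
    ultimately have "eventually (\<lambda>m. real n0 / b' \<le> real m \<and>
       real (card (hit_intervals (\<lambda>t. D t \<omega>) K m)) \<le> 2 powr (real m * b) \<and>
       (\<forall>k. real k * \<eta> m \<le> real K + 1 \<longrightarrow> 2 powr - real m < D (real k * \<eta> m + \<eta> m) \<omega> - D (real k * \<eta> m) \<omega>)) sequentially"
      by eventually_elim blast
    then obtain m0 where m0: "\<And>m. m0 \<le> m \<Longrightarrow> real n0 / b' \<le> real m"
       "\<And>m. m0 \<le> m \<Longrightarrow> real (card (hit_intervals (\<lambda>t. D t \<omega>) K m)) \<le> 2 powr (real m * b)"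
       "\<And>m k. m0 \<le> m \<Longrightarrow> real k * \<eta> m \<le> real K + 1 \<Longrightarrow> 2 powr - real m < D (real k * \<eta> m + \<eta> m) \<omega> - D (real k * \<eta> m) \<omega>"
      unfolding eventually_sequentially by blast
    define C1 where "C1 = 2 + (2 * C + 2) ^ CARD('n) + 1 + real CARD('n)"
    have C1: "0 < C1" using C by (simp add: C1_def add_pos_nonneg)
    have "covered_by (graph_image Y D \<omega>) (C1 * 2 powr (real m * \<sigma>)) (C1 * 2 powr - real m)" if m: "m0 \<le> m" for m
      unfolding graph_image_def C1_def
    proof (rule ip.graph_covered_by_hits[OF C p(4) _ p(2) p(6) _ _ m0(2)[OF m] \<sigma>(1) p(7)])
      show "norm (Y s \<omega> - Y t \<omega>) \<le> C * \<bar>s - t\<bar> powr \<gamma>"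
        if "0 \<le> s" "s < real K + 1" "0 \<le> t" "t < real K + 1" "\<bar>s - t\<bar> \<le> 2 powr - real n0" for s t
        using h that by (simp add: add.commute)
      show "real n0 \<le> real m * b'" using m0(1)[OF m] p by (simp add: pos_divide_le_eq)
      show "\<bar>inverse_process D s \<omega> - inverse_process D t \<omega>\<bar> \<le> 2 powr - (real m * b')"
        if "s \<in> {0..1}" "t \<in> {0..1}" "nat \<lfloor>s * 2 ^ m\<rfloor> = nat \<lfloor>t * 2 ^ m\<rfloor>" for s t
        using ip.e_increment_le[OF \<eta> m0(3)[OF m] that] by (simp add: \<eta>_def)
    qed
    then show ?case
      using box_counting_leI[of C1 \<sigma> m0 "graph_image Y D \<omega>"] C1 \<sigma> by auto
  qed
qed

text \<open>On the event considered \<open>x = E (D x)\<close>, so the path of \<open>(D, Y)\<close> on a short interval \<open>[0, T]\<close> lies in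
  the graph.\<close>

lemma AE_graph_contains_path:
  assumes D: "stable_subordinator \<beta> D" and \<beta>: "0 < \<beta>"
  shows "AE \<omega> in M. \<exists>T. 0 < T \<and> T \<le> 1 \<and> (\<lambda>x. (D x \<omega>, Y x \<omega>)) ` {0..T} \<subseteq> graph_image Y D \<omega>"
  using subordinator_AE_regular[OF D \<beta>] AE_inverse_path[OF D \<beta>]
proof eventually_elim
  case (elim \<omega>)
  then obtain K where "inverse_path (\<lambda>t. D t \<omega>) (\<lambda>t. inverse_process D t \<omega>) K" by blast
  then interpret ip: inverse_path "\<lambda>t. D t \<omega>" "\<lambda>t. inverse_process D t \<omega>" K .
  have "((\<lambda>t. D t \<omega>) \<longlongrightarrow> 0) (at_right 0)" using elim by fastforce
  then have "eventually (\<lambda>t. D t \<omega> < 1) (at_right 0)" by (rule order_tendstoD) simp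
  then obtain r where r: "0 < r" "\<And>t. 0 < t \<Longrightarrow> t < r \<Longrightarrow> D t \<omega> < 1"
    unfolding eventually_at_right[OF zero_less_one] by blast
  define T where "T = min 1 (r / 2)"
  have T: "0 < T" "T \<le> 1" "T < r" using r by (auto simp: T_def)
  have "(D x \<omega>, Y x \<omega>) \<in> graph_image Y D \<omega>" if x: "x \<in> {0..T}" for x
  proof -
    have "D x \<omega> \<le> D T \<omega>" using x by (intro ip.d_mono) auto
    then have "D x \<omega> \<le> 1" using r(2)[of T] T by simp
    moreover have "0 \<le> D x \<omega>" using ip.d_mono[of 0 x] x ip.d0 by simp
    ultimately show ?thesis using ip.e_d[of x] x unfolding graph_image_def by (intro image_eqI[of _ _ "D x \<omega>"]) auto
  qed
  then show ?case using T by blast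
qed

lemma AE_range_subset_bounded:
  fixes Y :: "real \<Rightarrow> 'a \<Rightarrow> real ^ 'n"
  assumes Y: "fractional_brownian_motion H Y" and D: "stable_subordinator \<beta> D" and \<beta>: "0 < \<beta>"
  shows "AE \<omega> in M. bounded (snd ` graph_image Y D \<omega>)"
proof -
  have "AE \<omega> in M. continuous_on {0..} (\<lambda>t. Y t \<omega>)"
    using Y unfolding fractional_brownian_motion_def by blast
  then show ?thesis using AE_inverse_path[OF D \<beta>]
  proof eventually_elim
    case (elim \<omega>)
    then obtain K where "inverse_path (\<lambda>t. D t \<omega>) (\<lambda>t. inverse_process D t \<omega>) K" by blast
    then interpret ip: inverse_path "\<lambda>t. D t \<omega>" "\<lambda>t. inverse_process D t \<omega>" K .
    have "continuous_on {0..real K} (\<lambda>t. Y t \<omega>)" by (rule continuous_on_subset[OF elim(1)]) auto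
    then have "bounded ((\<lambda>t. Y t \<omega>) ` {0..real K})"
      by (intro compact_imp_bounded compact_continuous_image) auto
    moreover have "snd ` graph_image Y D \<omega> \<subseteq> (\<lambda>t. Y t \<omega>) ` {0..real K}"
      unfolding graph_image_def using ip.e_nonneg ip.e_le_K by auto
    ultimately show ?case by (rule bounded_subset)
  qed
qed


lemma AE_range_hausdorff_measure:
  fixes Y :: "real \<Rightarrow> 'a \<Rightarrow> real ^ 'n"
  assumes Y: "fractional_brownian_motion H Y" and D: "stable_subordinator \<beta> D" and H: "0 < H" and \<beta>: "0 < \<beta>"
    and s: "0 \<le> s" "s < min (real CARD('n)) (1 / H)"
  shows "AE \<omega> in M. hausdorff_measure s (snd ` graph_image Y D \<omega>) \<noteq> 0"
  using AE_fbm_image_hausdorff_measure[OF Y H s] AE_graph_contains_path[OF D \<beta>, of Y]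
proof eventually_elim
  case (elim \<omega>)
  then obtain T where T: "0 < T" "T \<le> 1" "(\<lambda>x. (D x \<omega>, Y x \<omega>)) ` {0..T} \<subseteq> graph_image Y D \<omega>" by blast
  have "(\<lambda>x. Y x \<omega>) ` {0..T} \<subseteq> snd ` graph_image Y D \<omega>"
    using image_mono[OF T(3), of snd] by (simp add: image_image)
  from hausdorff_measure_mono[OF this, of s] show ?case using elim(1) T(1,2) by fastforce
qed

text \<open>Above, the projected staircase cover gives \<open>1 / H\<close>, and mere boundedness
  gives the ambient dimension when that is smaller.\<close>

lemma AE_range_dimensions:
  fixes Y :: "real \<Rightarrow> 'a \<Rightarrow> real ^ 'n"
  assumes Y: "fractional_brownian_motion H Y" and D: "stable_subordinator \<beta> D"
    and H: "0 < H" "H < 1" and \<beta>: "0 < \<beta>"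
  shows "AE \<omega> in M. hausdorff_dimension (snd ` graph_image Y D \<omega>) = min (real CARD('n)) (1 / H) \<and>
    packing_dimension (snd ` graph_image Y D \<omega>) = min (real CARD('n)) (1 / H)"
proof -
  define \<tau> where "\<tau> = min (real CARD('n)) (1 / H)"
  have \<tau>: "0 < \<tau>" using H by (simp add: \<tau>_def)
  have "AE \<omega> in M. \<forall>n::nat. hausdorff_measure (\<tau> * (1 - 1 / real (n + 2))) (snd ` graph_image Y D \<omega>) \<noteq> 0"
    unfolding AE_all_countable
  proof
    fix n :: nat
    have "0 \<le> \<tau> * (1 - 1 / real (n + 2))" "\<tau> * (1 - 1 / real (n + 2)) < \<tau>" using \<tau> by auto
    then show "AE \<omega> in M. hausdorff_measure (\<tau> * (1 - 1 / real (n + 2))) (snd ` graph_image Y D \<omega>) \<noteq> 0"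
      unfolding \<tau>_def by (rule AE_range_hausdorff_measure[OF Y D H(1) \<beta>])
  qed
  moreover have "AE \<omega> in M. \<forall>n::nat. box_counting_le (graph_image Y D \<omega>) (1 / H + 1 / real (n + 1))"
    unfolding AE_all_countable by (intro allI AE_graph_covered_staircase[OF Y D H \<beta>]) simp
  ultimately show ?thesis using AE_range_subset_bounded[OF Y D \<beta>]
  proof eventually_elim
    case (elim \<omega>)
    have up: "box_counting_le (snd ` graph_image Y D \<omega>) (\<tau> + 1 / real (n + 1))" for n :: nat
    proof (cases "1 / H \<le> real CARD('n)")
      case True
      then have "\<tau> = 1 / H" by (simp add: \<tau>_def)
      then show ?thesis using elim(2) by (auto intro: box_counting_le_image dist_snd_le)
    next
      case False
      show ?thesis
        by (rule box_counting_le_mono[OF bounded_box_counting_le[OF elim(3)]]) (use False in \<open>simp add: \<tau>_def\<close>)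
    qed
    show ?case
      using dimensions_eq_of_sequences[OF \<tau>, of "snd ` graph_image Y D \<omega>"] elim(1) up unfolding \<tau>_def by blast
  qed
qed

text \<open>For \<open>H d \<ge> 1\<close> the range already has dimension \<open>1 / H\<close>, so
  projecting the graph onto space loses nothing, and the staircase cover matches it from
  above.\<close>

lemma AE_graph_dimensions_rough:
  fixes Y :: "real \<Rightarrow> 'a \<Rightarrow> real ^ 'n"
  assumes Y: "fractional_brownian_motion H Y" and D: "stable_subordinator \<beta> D"
    and H: "0 < H" "H < 1" "1 \<le> H * real CARD('n)" and \<beta>: "0 < \<beta>"
  shows "AE \<omega> in M. hausdorff_dimension (graph_image Y D \<omega>) = 1 / H \<and> packing_dimension (graph_image Y D \<omega>) = 1 / H"
proof -
  have "1 / H \<le> real CARD('n)" using H by (simp add: pos_divide_le_eq mult.commute)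
  then have m: "min (real CARD('n)) (1 / H) = 1 / H" by (rule min_absorb2)
  have \<tau>: "0 < 1 / H" using H by simp
  have "AE \<omega> in M. \<forall>n::nat. hausdorff_measure (1 / H * (1 - 1 / real (n + 2))) (snd ` graph_image Y D \<omega>) \<noteq> 0"
    unfolding AE_all_countable
  proof
    fix n :: nat
    have "0 \<le> x * (1 - 1 / real (n + 2)) \<and> x * (1 - 1 / real (n + 2)) < x" if "0 < x" for x :: real
      using that by auto
    from this[OF \<tau>] have "0 \<le> 1 / H * (1 - 1 / real (n + 2))" "1 / H * (1 - 1 / real (n + 2)) < 1 / H"
      by blast+
    then show "AE \<omega> in M. hausdorff_measure (1 / H * (1 - 1 / real (n + 2))) (snd ` graph_image Y D \<omega>) \<noteq> 0"
      by (intro AE_range_hausdorff_measure[OF Y D H(1) \<beta>]) (simp_all only: m)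
  qed
  moreover have "AE \<omega> in M. \<forall>n::nat. box_counting_le (graph_image Y D \<omega>) (1 / H + 1 / real (n + 1))"
    unfolding AE_all_countable by (intro allI AE_graph_covered_staircase[OF Y D H(1,2) \<beta>]) simp
  ultimately show ?thesis
  proof eventually_elim
    case (elim \<omega>)
    have low: "hausdorff_measure (1 / H * (1 - 1 / real (n + 2))) (graph_image Y D \<omega>) \<noteq> 0" for n :: nat
    proof
      assume "hausdorff_measure (1 / H * (1 - 1 / real (n + 2))) (graph_image Y D \<omega>) = 0"
      from hausdorff_measure_nonexpansive_image_eq_0[OF dist_snd_le this] show False
        using elim(1) H by simp
    qed
    show ?case by (rule dimensions_eq_of_sequences[OF \<tau> low]) (use elim(2) in blast)
  qed
qed

lemma AE_graph_dimensions_smooth: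
  fixes Y :: "real \<Rightarrow> 'a \<Rightarrow> real ^ 'n"
  assumes Y: "fractional_brownian_motion H Y" and D: "stable_subordinator \<beta> D" and ind: "indep_processes Y D"
    and H: "0 < H" "H < 1" "H * real CARD('n) < 1" and \<beta>: "0 < \<beta>" "\<beta> < 1"
  defines "\<tau> \<equiv> \<beta> + (1 - H * \<beta>) * real CARD('n)"
  shows "AE \<omega> in M. hausdorff_dimension (graph_image Y D \<omega>) = \<tau> \<and> packing_dimension (graph_image Y D \<omega>) = \<tau>"
proof -
  \<comment> \<open>In this form \<open>\<tau> \<ge> 1\<close> is visible; the cover needs it, since
    already the time axis takes \<open>2 ^ m\<close> sets.\<close>
  have "\<tau> = real CARD('n) + \<beta> * (1 - H * real CARD('n))" by (simp add: \<tau>_def algebra_simps)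
  moreover have "0 \<le> \<beta> * (1 - H * real CARD('n))" using H \<beta> by simp
  moreover have "1 \<le> real CARD('n)" by (simp add: Suc_leI)
  ultimately have \<tau>: "1 \<le> \<tau>" by linarith
  then have \<tau>0: "0 < \<tau>" by simp
  have "AE \<omega> in M. \<forall>n::nat. \<forall>T. 0 < T \<and> T \<le> 1 \<longrightarrow>
      hausdorff_measure (\<tau> * (1 - 1 / real (n + 2))) ((\<lambda>x. (D x \<omega>, Y x \<omega>)) ` {0..T}) \<noteq> 0"
    unfolding AE_all_countable[where P = "\<lambda>n \<omega>. \<forall>T. 0 < T \<and> T \<le> 1 \<longrightarrow>
      hausdorff_measure (\<tau> * (1 - 1 / real (n + 2))) ((\<lambda>x. (D x \<omega>, Y x \<omega>)) ` {0..T}) \<noteq> 0"]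
  proof
    fix n :: nat
    have "0 \<le> \<tau> * (1 - 1 / real (n + 2))" "\<tau> * (1 - 1 / real (n + 2)) < \<tau>" using \<tau>0 by auto
    then show "AE \<omega> in M. \<forall>T. 0 < T \<and> T \<le> 1 \<longrightarrow>
        hausdorff_measure (\<tau> * (1 - 1 / real (n + 2))) ((\<lambda>x. (D x \<omega>, Y x \<omega>)) ` {0..T}) \<noteq> 0"
      unfolding \<tau>_def by (rule AE_graph_image_hausdorff_measure[OF Y D ind H(1,3) \<beta>(1)])
  qed
  moreover have "AE \<omega> in M. \<forall>n::nat. box_counting_le (graph_image Y D \<omega>) (\<tau> + 1 / real (n + 1))"
    unfolding AE_all_countable
  proof
    fix n :: nat
    have pos: "0 < 1 / real (n + 1)" by simp
    have "1 \<le> \<tau> + 1 / real (n + 1)" "\<beta> + (1 - H * \<beta>) * real CARD('n) < \<tau> + 1 / real (n + 1)"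
      using \<tau> pos unfolding \<tau>_def[symmetric] by linarith+
    then show "AE \<omega> in M. box_counting_le (graph_image Y D \<omega>) (\<tau> + 1 / real (n + 1))"
      by (rule AE_graph_covered_hits[OF Y D H(1,2) \<beta>])
  qed
  ultimately show ?thesis using AE_graph_contains_path[OF D \<beta>(1), of Y]
  proof eventually_elim
    case (elim \<omega>)
    then obtain T where T: "0 < T" "T \<le> 1" "(\<lambda>x. (D x \<omega>, Y x \<omega>)) ` {0..T} \<subseteq> graph_image Y D \<omega>" by blast
    have low: "hausdorff_measure (\<tau> * (1 - 1 / real (n + 2))) (graph_image Y D \<omega>) \<noteq> 0" for n :: nat
    proof
      assume "hausdorff_measure (\<tau> * (1 - 1 / real (n + 2))) (graph_image Y D \<omega>) = 0"
      then have "hausdorff_measure (\<tau> * (1 - 1 / real (n + 2))) ((\<lambda>x. (D x \<omega>, Y x \<omega>)) ` {0..T}) = 0"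
        using hausdorff_measure_mono[OF T(3), of "\<tau> * (1 - 1 / real (n + 2))"] by simp
      then show False using elim(1) T(1,2) by blast
    qed
    show ?case by (rule dimensions_eq_of_sequences[OF \<tau>0 low]) (use elim(2) in blast)
  qed
qed

end

theorem proposition3p6:
  fixes M :: "'w measure"
    and Y :: "real \<Rightarrow> 'w \<Rightarrow> real ^ 'n"
    and D E :: "real \<Rightarrow> 'w \<Rightarrow> real"
    and X :: "real \<Rightarrow> 'w \<Rightarrow> real ^ 'n"
    and H \<beta> :: real
  assumes "prob_space M"
    and "0 < H" "H < 1"
    and "0 < \<beta>" "\<beta> < 1"
    and "prob_space.fractional_brownian_motion M H Y"
    and "prob_space.stable_subordinator M \<beta> D"
    and "prob_space.indep_processes M Y D"
    and "\<And>t \<omega>. 0 \<le> t \<Longrightarrow> \<omega> \<in> space M \<Longrightarrow> E t \<omega> = inverse_process D t \<omega>"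
    and "\<And>t \<omega>. 0 \<le> t \<Longrightarrow> \<omega> \<in> space M \<Longrightarrow> X t \<omega> = Y (E t \<omega>) \<omega>"
  shows "(AE \<omega> in M.
            hausdorff_dimension ((\<lambda>t. X t \<omega>) ` {0..1}) = min (real CARD('n)) (1 / H) \<and>
            packing_dimension ((\<lambda>t. X t \<omega>) ` {0..1}) = min (real CARD('n)) (1 / H)) \<and>
         (AE \<omega> in M.
            hausdorff_dimension ((\<lambda>t. (t, X t \<omega>)) ` {0..1}) =
              (if 1 \<le> H * real CARD('n) then 1 / H
               else \<beta> + (1 - H * \<beta>) * real CARD('n)) \<and>
            packing_dimension ((\<lambda>t. (t, X t \<omega>)) ` {0..1}) =
              (if 1 \<le> H * real CARD('n) then 1 / H
               else \<beta> + (1 - H * \<beta>) * real CARD('n)))"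
proof -
  interpret prob_space M by fact
  note Y = assms(6) and D = assms(7) and ind = assms(8)
  \<comment> \<open>\<open>E\<close> and \<open>X\<close> are prescribed on \<open>space M\<close>
    only, so the sets are identified there and \<open>AE_space\<close> is added in each
    case.\<close>
  have G: "(\<lambda>t. (t, X t \<omega>)) ` {0..1} = graph_image Y D \<omega>"
    and R: "(\<lambda>t. X t \<omega>) ` {0..1} = snd ` graph_image Y D \<omega>" if "\<omega> \<in> space M" for \<omega>
    unfolding graph_image_def using assms(9,10) that by (auto simp: image_image intro!: image_cong)
  show ?thesis
  proof
    show "AE \<omega> in M.
            hausdorff_dimension ((\<lambda>t. X t \<omega>) ` {0..1}) = min (real CARD('n)) (1 / H) \<and>
            packing_dimension ((\<lambda>t. X t \<omega>) ` {0..1}) = min (real CARD('n)) (1 / H)"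
      using AE_range_dimensions[OF Y D assms(2,3,4)] AE_space
      by eventually_elim (simp add: R)
    show "AE \<omega> in M.
            hausdorff_dimension ((\<lambda>t. (t, X t \<omega>)) ` {0..1}) =
              (if 1 \<le> H * real CARD('n) then 1 / H
               else \<beta> + (1 - H * \<beta>) * real CARD('n)) \<and>
            packing_dimension ((\<lambda>t. (t, X t \<omega>)) ` {0..1}) =
              (if 1 \<le> H * real CARD('n) then 1 / H
               else \<beta> + (1 - H * \<beta>) * real CARD('n))"
    proof (cases "1 \<le> H * real CARD('n)")
      case True
      show ?thesis
        using AE_graph_dimensions_rough[OF Y D assms(2,3) True assms(4)] AE_space
        by eventually_elim (simp add: G True)
    next
      case False
      then have "H * real CARD('n) < 1" by simp
      from AE_graph_dimensions_smooth[OF Y D ind assms(2,3) this assms(4,5)] AE_space show ?thesis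
        by eventually_elim (use False in \<open>simp add: G\<close>)
    qed
  qed
qed

end
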